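(* Let $n\ge2$ and let $M\subset\mathbb R^n$ be an origin-symmetric star-shaped body such that $\|x\|_M^{-1}$ is a positive definite distribution. Then for any origin-symmetric star-shaped bodies $K,L\subset\mathbb R^n$ such that, for every $\xi\in S^{n-1}$, $$\mathrm{Vol}_{n-1}(K\cap\xi^\perp)\le\mathrm{Vol}_{n-1}(L\cap\xi^\perp),$$ we have $$\int_K\|x\|_M^{-1}\,dx\le\int_L\|x\|_M^{-1}\,dx.$$
   Context: $\xi^\perp$ is the hyperplane through the origin orthogonal to $\xi$. A star-shaped body is a compact set with non-empty interior that is star-shaped with respect to the origin. The Minkowski functional of $M$ is $\|x\|_M=\min\{a>0: x\in aM\}$. The Fourier transform of a tempered distribution $f$ is defined by $\langle\hat f,\phi\rangle=\langle f,\hat\phi\rangle$ for Schwartz functions $\phi$, with $\hat\phi(\xi)=\int\phi(x)e^{-i(x,\xi)}dx$. A distribution $f$ is positive definite iff $\langle\hat f,\phi\rangle\ge0$ for every nonnegative Schwartz function $\phi$. *)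

theory Defs
  imports "HOL-Analysis.Analysis"
begin

definition origin_symmetric :: "'a::real_vector set \<Rightarrow> bool" where
  "origin_symmetric K \<longleftrightarrow> (\<forall>x\<in>K. - x \<in> K)"

(* The origin is not required to be an interior point. *)
definition star_body :: "'a::euclidean_space set \<Rightarrow> bool" where
  "star_body K \<longleftrightarrow> compact K \<and> interior K \<noteq> {} \<and> (\<forall>x\<in>K. closed_segment 0 x \<subseteq> K)"

(* For a star body M and x \<noteq> 0 the infimum is attained as soon as some multiple of M contains x.
   Otherwise it is \<top>, so that its inverse, the radial function of M, is 0.
   At x = 0 it is 0, with inverse \<top>. *)
definition minkowski_functional :: "'a::real_vector set \<Rightarrow> 'a \<Rightarrow> ennreal" where
  "minkowski_functional M x = (INF a\<in>{a::real. 0 < a \<and> x \<in> (\<lambda>y. a *\<^sub>R y) ` M}. ennreal a)"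

(* Analogue of lborel_def: Lebesgue measure in the coordinates of an orthonormal
   basis B of the subspace V. It lives on the ambient space and is concentrated on V; by rotation
   invariance of Lebesgue measure it does not depend on the choice of B. *)
definition lborel_subspace :: "'a::euclidean_space set \<Rightarrow> 'a measure" where
  "lborel_subspace V =
    (let B = (SOME B. pairwise orthogonal B \<and> (\<forall>b\<in>B. norm b = 1) \<and> span B = V)
     in distr (\<Pi>\<^sub>M b\<in>B. lborel) borel (\<lambda>c. \<Sum>b\<in>B. c b *\<^sub>R b))"

definition perp :: "'a::euclidean_space \<Rightarrow> 'a set" where
  "perp \<xi> = {x. orthogonal \<xi> x}"

definition section_volume :: "'a::euclidean_space set \<Rightarrow> 'a \<Rightarrow> ennreal" where
  "section_volume K \<xi> = emeasure (lborel_subspace (perp \<xi>)) (K \<inter> perp \<xi>)"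

primrec iterated_deriv ::
    "'a::euclidean_space list \<Rightarrow> ('a \<Rightarrow> complex) \<Rightarrow> 'a \<Rightarrow> complex" where
  "iterated_deriv [] \<phi> = \<phi>"
| "iterated_deriv (v # vs) \<phi> = (\<lambda>x. frechet_derivative (iterated_deriv vs \<phi>) (at x) v)"

definition schwartz :: "('a::euclidean_space \<Rightarrow> complex) \<Rightarrow> bool" where
  "schwartz \<phi> \<longleftrightarrow>
    (\<forall>vs\<in>lists Basis.
       (\<forall>x. iterated_deriv vs \<phi> differentiable at x) \<and>
       (\<forall>k::nat. bounded (range (\<lambda>x. norm x ^ k *\<^sub>R iterated_deriv vs \<phi> x))))"

definition schwartz_seminorm ::
    "nat \<Rightarrow> 'a::euclidean_space list \<Rightarrow> ('a \<Rightarrow> complex) \<Rightarrow> real" where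
  "schwartz_seminorm k vs \<phi> = (SUP x. norm x ^ k * norm (iterated_deriv vs \<phi> x))"

(* Distributions are functionals on all functions; only their values on Schwartz functions matter. *)
definition tempered_distribution ::
    "(('a::euclidean_space \<Rightarrow> complex) \<Rightarrow> complex) \<Rightarrow> bool" where
  "tempered_distribution T \<longleftrightarrow>
    (\<forall>\<phi> \<psi>. schwartz \<phi> \<longrightarrow> schwartz \<psi> \<longrightarrow> T (\<lambda>x. \<phi> x + \<psi> x) = T \<phi> + T \<psi>) \<and>
    (\<forall>c \<phi>. schwartz \<phi> \<longrightarrow> T (\<lambda>x. c * \<phi> x) = c * T \<phi>) \<and>
    (\<exists>C N. \<forall>\<phi>. schwartz \<phi> \<longrightarrow>
       norm (T \<phi>) \<le> C * (\<Sum>k\<le>N. \<Sum>vs | set vs \<subseteq> Basis \<and> length vs \<le> N. schwartz_seminorm k vs \<phi>))"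

definition fourier :: "('a::euclidean_space \<Rightarrow> complex) \<Rightarrow> 'a \<Rightarrow> complex" where
  "fourier \<phi> \<xi> = (LINT x|lborel. \<phi> x * exp (- \<i> * complex_of_real (x \<bullet> \<xi>)))"

definition fourier_distribution ::
    "(('a::euclidean_space \<Rightarrow> complex) \<Rightarrow> complex) \<Rightarrow> ('a \<Rightarrow> complex) \<Rightarrow> complex" where
  "fourier_distribution T \<phi> = T (fourier \<phi>)"

definition positive_definite_distribution ::
    "(('a::euclidean_space \<Rightarrow> complex) \<Rightarrow> complex) \<Rightarrow> bool" where
  "positive_definite_distribution T \<longleftrightarrow>
    tempered_distribution T \<and>
    (\<forall>\<phi>. schwartz \<phi> \<longrightarrow> (\<forall>x. \<phi> x \<in> \<real>\<^sub>\<ge>\<^sub>0) \<longrightarrow> fourier_distribution T \<phi> \<in> \<real>\<^sub>\<ge>\<^sub>0)"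

(* The value \<top> of f, which must be taken on a null set only, is replaced by 0. *)
definition distribution_of ::
    "('a::euclidean_space \<Rightarrow> ennreal) \<Rightarrow> ('a \<Rightarrow> complex) \<Rightarrow> complex" where
  "distribution_of f \<phi> = (LINT x|lborel. complex_of_real (enn2real (f x)) * \<phi> x)"

end

theory Submission
  imports Defs "HOL-Probability.Probability"
begin

text \<open>
  Write \<open>f\<close> for the reciprocal of the Minkowski functional of \<open>M\<close>. Testing positive definiteness of \<open>f\<close>
  on translated Gaussians shows that the Fourier transform \<open>F\<close> of \<open>f \<cdot> gauss 1\<close> is a nonnegative
  function. Hence, with \<open>A\<^sub>K(\<eta>)\<close> the volume of the section of \<open>K\<close> by the hyperplane orthogonal to \<open>\<eta>\<close>
  and any weight \<open>c \<ge> 0\<close>, the hypothesis gives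
  \<open>\<integral> c(\<eta>) F(\<eta>) A\<^sub>K(\<eta>) / norm \<eta> \<le> \<integral> c(\<eta>) F(\<eta>) A\<^sub>L(\<eta>) / norm \<eta>\<close>.
  For a Gaussian weight \<open>c\<close> this integral can be computed: \<open>A\<^sub>K(\<eta>) / norm \<eta>\<close> is the integral over \<open>K\<close> of
  the Dirac mass at \<open>x \<bullet> \<eta> = 0\<close>, which is a superposition of the characters \<open>exp (- \<i> t (x \<bullet> \<eta>))\<close>,
  so Fubini turns it into an integral over \<open>K\<close> of Gaussian averages of \<open>f\<close> along lines through the origin.
  Take \<open>c\<close> to be the difference of the Gaussians of parameters \<open>(\<sigma> a)\<^sup>2\<close> and \<open>\<sigma>\<^sup>2\<close> with \<open>a < 1\<close>. As \<open>f\<close> is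
  homogeneous of degree \<open>-1\<close>, a change of variables shows that the integral converges, as \<open>\<sigma>\<close> tends to
  \<open>0\<close>, to a positive constant (a Frullani integral) times \<open>\<integral>\<^sub>K f\<close>.
\<close>

section \<open>Gaussians\<close>

definition gauss :: "real \<Rightarrow> 'a::real_normed_vector \<Rightarrow> real" where
  "gauss a x = exp (- (a * (norm x)\<^sup>2 / 2))"

lemma gauss_pos [simp]: "0 < gauss a x" and gauss_nonneg [simp]: "0 \<le> gauss a x"
  by (simp_all add: gauss_def)

lemma gauss_le_1: "0 \<le> a \<Longrightarrow> gauss a x \<le> 1"
  by (simp add: gauss_def)

lemma continuous_on_gauss [continuous_intros]: "continuous_on A (gauss a)"
  unfolding gauss_def [abs_def] by (intro continuous_intros) auto

lemma borel_measurable_gauss [measurable]: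
  "gauss a \<in> borel_measurable (borel :: 'a::real_normed_vector measure)"
  by (intro borel_measurable_continuous_onI continuous_on_gauss)

lemma gauss_scaleR: "gauss a (c *\<^sub>R x) = gauss (a * c\<^sup>2) x"
  by (simp add: gauss_def power_mult_distrib mult.assoc)

lemma gauss_uminus [simp]: "gauss a (- x) = gauss a x"
  by (simp add: gauss_def)

lemma gauss_add_param: "gauss (a + b) x = gauss a x * gauss b x"
  by (simp add: gauss_def exp_add [symmetric] add_divide_distrib distrib_right)

lemma gauss_antimono: "a \<le> b \<Longrightarrow> gauss b x \<le> gauss a x"
  by (simp add: gauss_def mult_right_mono divide_right_mono)

lemma gauss_sum_orthonormal:
  assumes "finite B" "pairwise orthogonal B" "\<forall>b\<in>B. norm b = 1"
  shows "gauss a (\<Sum>b\<in>B. c b *\<^sub>R b) = (\<Prod>b\<in>B. gauss a (c b))"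
proof -
  have "(norm (\<Sum>b\<in>B. c b *\<^sub>R b))\<^sup>2 = (\<Sum>b\<in>B. (norm (c b *\<^sub>R b))\<^sup>2)"
    using assms by (intro norm_sum_Pythagorean) (auto simp: pairwise_def orthogonal_def)
  then show ?thesis
    using assms by (simp add: gauss_def sum_distrib_left sum_divide_distrib sum_negf [symmetric] exp_sum)
qed

lemma gauss_real_fourier:
  fixes s :: real
  assumes "0 < a"
  shows "integrable lborel (gauss a :: real \<Rightarrow> real)"
    and "(LINT t|lborel. complex_of_real (gauss a t) * exp (- \<i> * complex_of_real (t * s)))
      = complex_of_real (sqrt (2 * pi / a) * gauss (1 / a) s)"
proof -
  have g: "gauss a t = sqrt (2 * pi / a) * normal_density 0 (1 / sqrt a) t" for t :: real
    using assms by (simp add: gauss_def normal_density_def real_sqrt_divide real_sqrt_mult power_divide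
        field_simps)
  show "integrable lborel (gauss a :: real \<Rightarrow> real)"
    using assms by (subst g [abs_def]) simp
  have "complex_of_real (exp (- ((- s / sqrt a)\<^sup>2) / 2)) = char std_normal_distribution (- s / sqrt a)"
    by (simp add: char_std_normal_distribution)
  also have "\<dots> = (LINT x|lborel. complex_of_real (std_normal_density x)
      * exp (- \<i> * complex_of_real (x / sqrt a * s)))"
    unfolding char_def by (subst integral_density) (auto simp: scaleR_conv_of_real mult_ac)
  also have "\<dots> = (LINT x|lborel. sqrt a *\<^sub>R (complex_of_real (std_normal_density (sqrt a * x))
      * exp (- \<i> * complex_of_real (x * s))))"
    using assms by (subst lborel_integral_real_affine [where c = "sqrt a" and t = 0]) auto
  also have "\<dots> = (LINT x|lborel. (1 / sqrt (2 * pi / a)) *\<^sub>R (complex_of_real (gauss a x)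
      * exp (- \<i> * complex_of_real (x * s))))"
    using assms by (intro Bochner_Integration.integral_cong)
      (auto simp: gauss_def normal_density_def real_sqrt_divide power_mult_distrib scaleR_conv_of_real)
  also have "\<dots> = (1 / sqrt (2 * pi / a)) *\<^sub>R (LINT x|lborel. (complex_of_real (gauss a x)
      * exp (- \<i> * complex_of_real (x * s))))"
    by simp
  finally show "(LINT t|lborel. complex_of_real (gauss a t) * exp (- \<i> * complex_of_real (t * s)))
      = complex_of_real (sqrt (2 * pi / a) * gauss (1 / a) s)"
    using assms by (simp add: gauss_def power_divide scaleR_conv_of_real field_simps)
qed

lemma integrable_gauss:
  assumes "0 < a"
  shows "integrable lborel (gauss a :: 'a::euclidean_space \<Rightarrow> real)"
    and "fourier (\<lambda>x. complex_of_real (gauss a x)) \<xi>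
      = complex_of_real (sqrt (2 * pi / a) ^ DIM('a) * gauss (1 / a) (\<xi> :: 'a))"
proof -
  interpret product_sigma_finite "\<lambda>_::'a. lborel :: real measure" ..
  have B: "gauss c (\<Sum>b\<in>Basis. x b *\<^sub>R b :: 'a) = (\<Prod>b\<in>Basis. gauss c (x b))" for c x
    by (intro gauss_sum_orthonormal) (auto simp: pairwise_def orthogonal_def inner_Basis)
  have "integrable (\<Pi>\<^sub>M b\<in>Basis. lborel) (\<lambda>x. \<Prod>b\<in>(Basis::'a set). gauss a (x b :: real))"
    using assms gauss_real_fourier(1) by (intro product_integrable_prod [where f = "\<lambda>_. gauss a"]) auto
  then have "integrable (\<Pi>\<^sub>M b\<in>Basis. lborel) (\<lambda>x. gauss a (\<Sum>b\<in>Basis. x b *\<^sub>R b :: 'a))"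
    by (simp add: B)
  then show "integrable lborel (gauss a :: 'a \<Rightarrow> real)"
    unfolding lborel_eq [where 'a='a] by (rule integrable_distr_eq [THEN iffD2, rotated 2]) measurable
  have E: "complex_of_real (gauss a (\<Sum>b\<in>Basis. x b *\<^sub>R b)) *
           exp (- \<i> * complex_of_real ((\<Sum>b\<in>Basis. x b *\<^sub>R b) \<bullet> \<xi>)) =
           (\<Prod>b\<in>Basis. complex_of_real (gauss a (x b)) * exp (- \<i> * complex_of_real (x b * (b \<bullet> \<xi>))))" for x
    unfolding B inner_sum_left of_real_sum sum_distrib_left exp_sum [OF finite_Basis] inner_scaleR_left
        prod.distrib of_real_prod
    by (rule refl)
  have "gauss (1 / a) \<xi> = gauss (1 / a) (\<Sum>b\<in>Basis. (b \<bullet> \<xi>) *\<^sub>R b)"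
    by (simp only: inner_commute [of _ \<xi>] euclidean_representation)
  then have R: "gauss (1 / a) \<xi> = (\<Prod>b\<in>Basis. gauss (1 / a) (b \<bullet> \<xi>))"
    by (simp only: B)
  have "fourier (\<lambda>x. complex_of_real (gauss a x)) \<xi> =
     (LINT x|(\<Pi>\<^sub>M b\<in>Basis. lborel). (\<Prod>b\<in>Basis. complex_of_real (gauss a (x b))
         * exp (- \<i> * complex_of_real (x b * (b \<bullet> \<xi>)))))"
    unfolding fourier_def lborel_eq [where 'a='a]
    by (subst integral_distr, measurable) (simp only: E)
  also have "\<dots> = (\<Prod>b\<in>Basis. (LINT t|lborel. complex_of_real (gauss a t)
      * exp (- \<i> * complex_of_real (t * (b \<bullet> \<xi>)))))"
  proof (intro product_integral_prod)
    fix b :: 'a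
    have "integrable lborel (\<lambda>t::real. complex_of_real (gauss a t))"
      using gauss_real_fourier(1) [OF assms] by simp
    then show "integrable lborel (\<lambda>t. complex_of_real (gauss a t)
        * exp (- \<i> * complex_of_real (t * (b \<bullet> \<xi>))))"
      by (rule Bochner_Integration.integrable_bound) (auto simp: norm_mult)
  qed simp
  also have "\<dots> = complex_of_real (sqrt (2 * pi / a) ^ DIM('a) * gauss (1 / a) \<xi>)"
    unfolding gauss_real_fourier(2) [OF assms] R by (simp add: prod.distrib)
  finally show "fourier (\<lambda>x. complex_of_real (gauss a x)) \<xi>
      = complex_of_real (sqrt (2 * pi / a) ^ DIM('a) * gauss (1 / a) \<xi>)" .
qed

lemma integral_gauss:
  assumes "0 < a"
  shows "(LINT x|lborel. gauss a (x :: 'a::euclidean_space)) = sqrt (2 * pi / a) ^ DIM('a)"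
proof -
  have "complex_of_real (LINT x|lborel. gauss a (x :: 'a))
      = fourier (\<lambda>x. complex_of_real (gauss a x)) (0::'a)"
    by (simp add: fourier_def)
  then show ?thesis
    using assms by (simp only: integrable_gauss(2) of_real_eq_iff) (simp add: gauss_def)
qed

lemma nn_integral_gauss:
  assumes "0 < a"
  shows "(\<integral>\<^sup>+x. ennreal (gauss a (x :: 'a::euclidean_space)) \<partial>lborel) = ennreal (sqrt (2 * pi / a) ^ DIM('a))"
  using nn_integral_eq_integral [OF integrable_gauss(1) [OF assms, where 'a='a]]
    integral_gauss [OF assms, where 'a='a] by simp

lemma nn_integral_inverse_one_plus_square: "(\<integral>\<^sup>+t. ennreal (1 / (1 + t\<^sup>2)) \<partial>lborel) < \<infinity>"
proof -
  have "einterval (- \<infinity>) \<infinity> = UNIV"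
    by (auto simp: einterval_def)
  then have "integrable lborel (\<lambda>t::real. 1 / (1 + t\<^sup>2))"
    using integrable_inverse_1_plus_square by (simp add: set_integrable_def inverse_eq_divide)
  then show ?thesis
    by (auto simp: integrable_iff_bounded)
qed

text \<open>The proof writes \<open>1 / norm y\<close> as a superposition of Gaussians in \<open>y\<close>.\<close>

lemma nn_integral_gauss_div_norm:
  assumes "2 \<le> DIM('a::euclidean_space)" "0 < a"
  shows "(\<integral>\<^sup>+y. ennreal (gauss a y / norm y) \<partial>(lborel :: 'a measure)) < \<infinity>"
proof -
  define c where "c = sqrt (2 * pi / a) ^ (DIM('a) - 2) * (2 * pi) * (1 + 1 / a)"
  have le: "ennreal (gauss a y / norm y) \<le> (\<integral>\<^sup>+t. ennreal (gauss (a + t\<^sup>2) y) \<partial>lborel)" for y :: 'a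
  proof (cases "y = 0")
    case False
    have *: "gauss (a + t\<^sup>2) y = gauss a y * gauss ((norm y)\<^sup>2) t" for t :: real
      by (simp add: gauss_add_param) (simp add: gauss_def mult.commute)
    have "(\<integral>\<^sup>+t. ennreal (gauss (a + t\<^sup>2) y) \<partial>lborel)
        = ennreal (gauss a y) * (\<integral>\<^sup>+t. ennreal (gauss ((norm y)\<^sup>2) (t::real)) \<partial>lborel)"
      unfolding * by (subst nn_integral_cmult [symmetric]) (auto simp: ennreal_mult)
    also have "\<dots> = ennreal (gauss a y * (sqrt (2 * pi) / norm y))"
      using False by (simp add: nn_integral_gauss real_sqrt_divide ennreal_mult [symmetric])
    also have "\<dots> \<ge> ennreal (gauss a y / norm y)"
    proof (rule ennreal_leI)
      have "1 \<le> sqrt (2 * pi)"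
        using pi_gt3 by simp
      then have "gauss a y / norm y * 1 \<le> gauss a y / norm y * sqrt (2 * pi)"
        by (intro mult_left_mono) auto
      then show "gauss a y / norm y \<le> gauss a y * (sqrt (2 * pi) / norm y)"
        by simp
    qed
    finally show ?thesis .
  qed simp
  have bd: "sqrt (2 * pi / (a + t\<^sup>2)) ^ DIM('a) \<le> c * (1 / (1 + t\<^sup>2))" for t :: real
  proof -
    have pos: "0 < a + t\<^sup>2" "0 < 1 + t\<^sup>2"
      using assms by (auto simp: add_pos_nonneg)
    have "DIM('a) = (DIM('a) - 2) + 2"
      using assms by simp
    then have "sqrt (2 * pi / (a + t\<^sup>2)) ^ DIM('a)
        = sqrt (2 * pi / (a + t\<^sup>2)) ^ (DIM('a) - 2) * (sqrt (2 * pi / (a + t\<^sup>2)))\<^sup>2"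
      by (metis power_add)
    also have "\<dots> = sqrt (2 * pi / (a + t\<^sup>2)) ^ (DIM('a) - 2) * (2 * pi * (1 / (a + t\<^sup>2)))"
      using pos by simp
    also have "\<dots> \<le> sqrt (2 * pi / a) ^ (DIM('a) - 2) * (2 * pi * ((1 + 1 / a) * (1 / (1 + t\<^sup>2))))"
    proof (intro mult_mono power_mono)
      show "1 / (a + t\<^sup>2) \<le> (1 + 1 / a) * (1 / (1 + t\<^sup>2))"
        using pos assms by (simp add: divide_simps) (simp add: algebra_simps)
    qed (use pos assms in \<open>auto simp: frac_le intro!: divide_left_mono mult_pos_pos\<close>)
    finally show ?thesis
      by (simp only: c_def mult.assoc)
  qed
  have "(\<integral>\<^sup>+y. ennreal (gauss a y / norm y) \<partial>(lborel :: 'a measure))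
      \<le> (\<integral>\<^sup>+y. \<integral>\<^sup>+t. ennreal (gauss (a + t\<^sup>2) y) \<partial>lborel \<partial>(lborel :: 'a measure))"
    by (intro nn_integral_mono le)
  also have "\<dots> = (\<integral>\<^sup>+t. \<integral>\<^sup>+y. ennreal (gauss (a + t\<^sup>2) y) \<partial>(lborel :: 'a measure) \<partial>lborel)"
    by (rule lborel_pair.Fubini') (simp add: gauss_def)
  also have "\<dots> = (\<integral>\<^sup>+t. ennreal (sqrt (2 * pi / (a + t\<^sup>2)) ^ DIM('a)) \<partial>lborel)"
    using assms by (simp add: nn_integral_gauss add_pos_nonneg)
  also have "\<dots> \<le> (\<integral>\<^sup>+t. ennreal c * ennreal (1 / (1 + t\<^sup>2)) \<partial>lborel)"
    using bd assms by (intro nn_integral_mono) (auto simp: ennreal_mult'[symmetric] c_def intro!: ennreal_leI)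
  also have "\<dots> = ennreal c * (\<integral>\<^sup>+t. ennreal (1 / (1 + t\<^sup>2)) \<partial>lborel)"
    by (rule nn_integral_cmult) simp
  also have "\<dots> < \<infinity>"
    using nn_integral_inverse_one_plus_square by (simp add: ennreal_mult_less_top)
  finally show ?thesis .
qed

lemma real_polynomial_function_frechet_derivative:
  fixes p :: "'a::real_normed_vector \<Rightarrow> real"
  assumes "real_polynomial_function p"
  shows "p differentiable at x"
    and "real_polynomial_function (\<lambda>x. frechet_derivative p (at x) v)"
proof -
  have "(\<forall>x. p differentiable at x) \<and> real_polynomial_function (\<lambda>x. frechet_derivative p (at x) v)"
    using assms
  proof induction
    case (linear f)
    have f: "(f has_derivative f) (at x)" for x
      using linear by (rule bounded_linear_imp_has_derivative)
    then have "frechet_derivative f (at x) = f" for x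
      using frechet_derivative_at by metis
    then show ?case
      using f by (auto intro: real_polynomial_function.intros differentiableI [OF f])
  next
    case (const c)
    then show ?case
      by (auto intro: real_polynomial_function.intros)
  next
    case (add f g)
    have "frechet_derivative (\<lambda>x. f x + g x) (at x) v
        = frechet_derivative f (at x) v + frechet_derivative g (at x) v" for x
    proof -
      have "((\<lambda>x. f x + g x) has_derivative
          (\<lambda>h. frechet_derivative f (at x) h + frechet_derivative g (at x) h)) (at x)"
        using add by (intro has_derivative_add) (auto simp: frechet_derivative_works [THEN iffD1])
      then show ?thesis
        by (metis (no_types, lifting) frechet_derivative_at)
    qed
    then show ?case
      using add by (auto intro: real_polynomial_function.intros)
  next
    case (mult f g)
    have "((\<lambda>x. f x * g x) has_derivative
        (\<lambda>h. f x * frechet_derivative g (at x) h + frechet_derivative f (at x) h * g x)) (at x)" for x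
      using mult by (intro has_derivative_mult) (auto simp: frechet_derivative_works [THEN iffD1])
    then have "frechet_derivative (\<lambda>x. f x * g x) (at x) v
        = f x * frechet_derivative g (at x) v + frechet_derivative f (at x) v * g x" for x
      by (metis (no_types, lifting) frechet_derivative_at)
    then show ?case
      using mult by (auto intro!: real_polynomial_function.intros(3,4))
  qed
  then show "p differentiable at x" "real_polynomial_function (\<lambda>x. frechet_derivative p (at x) v)"
    by auto
qed

lemma real_polynomial_function_growth:
  fixes p :: "'a::real_normed_vector \<Rightarrow> real"
  assumes "real_polynomial_function p"
  shows "\<exists>C N. \<forall>x. \<bar>p x\<bar> \<le> C * (1 + norm x) ^ N"
  using assms
proof induction
  case (linear f)
  obtain K where K: "0 \<le> K" "\<And>x. norm (f x) \<le> norm x * K"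
    using bounded_linear.nonneg_bounded [OF linear] by auto
  have "\<bar>f x\<bar> \<le> K * (1 + norm x) ^ 1" for x
    using K(1) K(2) [of x] by (simp add: distrib_left mult.commute)
  then show ?case
    by blast
next
  case (const c)
  have "\<bar>c\<bar> \<le> \<bar>c\<bar> * (1 + norm x) ^ 0" for x :: 'a
    by simp
  then show ?case
    by blast
next
  case (add f g)
  then obtain C N D K where fg: "\<And>x. \<bar>f x\<bar> \<le> C * (1 + norm x) ^ N" "\<And>x. \<bar>g x\<bar> \<le> D * (1 + norm x) ^ K"
    by blast
  have "\<bar>f x + g x\<bar> \<le> (\<bar>C\<bar> + \<bar>D\<bar>) * (1 + norm x) ^ (N + K)" for x
  proof -
    have "\<bar>f x\<bar> \<le> \<bar>C\<bar> * (1 + norm x) ^ N" "\<bar>g x\<bar> \<le> \<bar>D\<bar> * (1 + norm x) ^ K"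
      using fg by (meson abs_ge_self mult_right_mono norm_ge_zero order_trans zero_le_power
          add_nonneg_nonneg zero_le_one)+
    moreover have "\<bar>C\<bar> * (1 + norm x) ^ N \<le> \<bar>C\<bar> * (1 + norm x) ^ (N + K)"
        "\<bar>D\<bar> * (1 + norm x) ^ K \<le> \<bar>D\<bar> * (1 + norm x) ^ (N + K)"
      by (intro mult_left_mono power_increasing; simp)+
    ultimately show ?thesis
      unfolding distrib_right using abs_triangle_ineq [of "f x" "g x"] by linarith
  qed
  then show ?case
    by blast
next
  case (mult f g)
  then obtain C N D K where fg: "\<And>x. \<bar>f x\<bar> \<le> C * (1 + norm x) ^ N" "\<And>x. \<bar>g x\<bar> \<le> D * (1 + norm x) ^ K"
    by blast
  have "\<bar>f x * g x\<bar> \<le> (C * D) * (1 + norm x) ^ (N + K)" for x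
    using mult_mono [OF fg(1) [of x] fg(2) [of x]] order_trans [OF abs_ge_zero fg(1) [of x]]
    by (simp add: abs_mult power_add mult_ac)
  then show ?case
    by blast
qed

lemma bounded_polynomial_times_gauss:
  fixes p :: "'a::real_normed_vector \<Rightarrow> real"
  assumes "real_polynomial_function p" "0 < a"
  shows "\<exists>C. \<forall>x. norm x ^ k * \<bar>p x * gauss a (x - w)\<bar> \<le> C"
proof -
  obtain C N where CN: "\<And>x. \<bar>p x\<bar> \<le> C * (1 + norm x) ^ N"
    using real_polynomial_function_growth [OF assms(1)] by blast
  have C: "0 \<le> C"
    using order_trans [OF abs_ge_zero CN [of 0]] by simp
  define m where "m = N + k"
  have "norm x ^ k * \<bar>p x * gauss a (x - w)\<bar> \<le> C * ((1 + norm w) ^ m * exp ((real m)\<^sup>2 / (2 * a)))" for x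
  proof -
    define r where "r = norm (x - w)"
    have r: "0 \<le> r"
      by (simp add: r_def)
    have "1 + norm x \<le> 1 + (norm w + r)"
      using norm_triangle_ineq [of w "x - w"] by (simp add: r_def)
    also have "\<dots> \<le> (1 + norm w) * (1 + r)"
      using r by (simp add: algebra_simps)
    finally have x: "1 + norm x \<le> (1 + norm w) * (1 + r)" .
    have "0 \<le> (a * r - real m)\<^sup>2"
      by simp
    then have "real m * r - a * r\<^sup>2 / 2 \<le> (real m)\<^sup>2 / (2 * a)"
      using assms(2) by (simp add: field_simps power2_eq_square)
    then have "exp (real m * r) * gauss a (x - w) \<le> exp ((real m)\<^sup>2 / (2 * a))"
      by (simp add: gauss_def r_def [symmetric] exp_add [symmetric])
    moreover have "(1 + r) ^ m \<le> exp (real m * r)"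
      using r exp_ge_add_one_self [of r] power_mono [of "1
          + r" "exp r" m] by (simp add: exp_of_nat_mult [symmetric])
    ultimately have e: "(1 + r) ^ m * gauss a (x - w) \<le> exp ((real m)\<^sup>2 / (2 * a))"
      by (meson gauss_nonneg mult_right_mono order_trans)
    have "norm x ^ k * \<bar>p x * gauss a (x - w)\<bar> = norm x ^ k * \<bar>p x\<bar> * gauss a (x - w)"
      by (simp add: abs_mult)
    also have "\<dots> \<le> (1 + norm x) ^ k * (C * (1 + norm x) ^ N) * gauss a (x - w)"
      using CN C by (intro mult_right_mono mult_mono power_mono) auto
    also have "\<dots> = C * ((1 + norm x) ^ m * gauss a (x - w))"
      by (simp add: m_def power_add mult_ac)
    also have "\<dots> \<le> C * (((1 + norm w) * (1 + r)) ^ m * gauss a (x - w))"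
      using C x by (intro mult_left_mono mult_right_mono power_mono) auto
    also have "\<dots> = C * ((1 + norm w) ^ m * ((1 + r) ^ m * gauss a (x - w)))"
      by (simp add: power_mult_distrib mult_ac)
    also have "\<dots> \<le> C * ((1 + norm w) ^ m * exp ((real m)\<^sup>2 / (2 * a)))"
      using C e by (intro mult_left_mono) auto
    finally show ?thesis .
  qed
  then show ?thesis
    by blast
qed

lemma iterated_deriv_gauss:
  fixes w :: "'a::euclidean_space"
  shows "\<exists>p. real_polynomial_function p \<and>
    iterated_deriv vs (\<lambda>x. complex_of_real (gauss a (x - w))) = (\<lambda>x. complex_of_real (p x * gauss a (x - w)))"
proof (induction vs)
  case Nil
  show ?case
    by (rule exI [of _ "\<lambda>_. 1"]) (auto intro: real_polynomial_function.intros)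
next
  case (Cons v vs)
  then obtain p where p: "real_polynomial_function p"
      "iterated_deriv vs (\<lambda>x. complex_of_real (gauss a (x - w)))
          = (\<lambda>x. complex_of_real (p x * gauss a (x - w)))"
    by blast
  define q where "q x = frechet_derivative p (at x) v + p x * (- a * ((x - w) \<bullet> v))" for x
  have lin: "real_polynomial_function (\<lambda>x. x \<bullet> v)"
    by (intro real_polynomial_function.intros bounded_linear_inner_left)
  have "q = (\<lambda>x. frechet_derivative p (at x) v + p x * (- a * (x \<bullet> v + - (w \<bullet> v))))"
    by (simp add: q_def inner_diff_left fun_eq_iff)
  then have "real_polynomial_function q"
    using real_polynomial_function_frechet_derivative(2) [OF p(1)] p(1) lin
    by (simp only:) (intro real_polynomial_function.intros(2-4))
  moreover have "frechet_derivative (\<lambda>x. complex_of_real (p x * gauss a (x - w))) (at x) v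
      = complex_of_real (q x * gauss a (x - w))" for x
  proof -
    have p': "(p has_derivative frechet_derivative p (at x)) (at x)"
      using real_polynomial_function_frechet_derivative(1) [OF p(1)] by (rule frechet_derivative_works
          [THEN iffD1])
    have "((\<lambda>x. gauss a (x - w)) has_derivative (\<lambda>h. - (a * ((x - w) \<bullet> h)) * gauss a (x - w))) (at x)"
      unfolding gauss_def power2_norm_eq_inner
      by (rule derivative_eq_intros refl | simp)+
        (simp add: fun_eq_iff inner_commute field_simps)
    then have "((\<lambda>x. complex_of_real (p x * gauss a (x - w))) has_derivative
        (\<lambda>h. complex_of_real (p x * (- (a * ((x - w) \<bullet> h)) * gauss a (x - w))
          + frechet_derivative p (at x) h * gauss a (x - w)))) (at x)"
      by (intro has_derivative_of_real has_derivative_mult p')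
    then show ?thesis
      by (subst frechet_derivative_at [symmetric], assumption) (simp add: q_def algebra_simps)
  qed
  ultimately show ?case
    using p(2) by auto
qed

lemma schwartz_gauss:
  fixes w :: "'a::euclidean_space"
  assumes "0 < a"
  shows "schwartz (\<lambda>x. complex_of_real (gauss a (x - w)))"
  unfolding schwartz_def
proof (intro ballI conjI allI)
  fix vs :: "'a list" and k :: nat
  obtain p where p: "real_polynomial_function p"
      "iterated_deriv vs (\<lambda>x. complex_of_real (gauss a (x - w)))
          = (\<lambda>x. complex_of_real (p x * gauss a (x - w)))"
    using iterated_deriv_gauss by blast
  have "(\<lambda>x. gauss a (x - w)) differentiable at x" for x
    unfolding gauss_def power2_norm_eq_inner
    by (rule differentiableI) (auto intro!: derivative_eq_intros)
  then have "(\<lambda>x. p x * gauss a (x - w)) differentiable at x" for x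
    using real_polynomial_function_frechet_derivative(1) [OF p(1)] by (intro differentiable_mult)
  then show "iterated_deriv vs (\<lambda>x. complex_of_real (gauss a (x - w))) differentiable at x" for x
    unfolding p(2)
    by - (rule differentiableI, rule has_derivative_of_real, rule frechet_derivative_works [THEN iffD1])
  obtain C where "\<And>x. norm x ^ k * \<bar>p x * gauss a (x - w)\<bar> \<le> C"
    using bounded_polynomial_times_gauss [OF p(1) assms] by blast
  then show "bounded (range (\<lambda>x. norm x ^ k *\<^sub>R iterated_deriv vs (\<lambda>x. complex_of_real (gauss a (x - w))) x))"
    unfolding p(2) bounded_iff by (auto simp: abs_mult norm_mult)
qed

lemma nn_integral_lborel_affine:
  fixes t :: "'a::euclidean_space"
  assumes [measurable]: "f \<in> borel_measurable borel" and "c \<noteq> 0"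
  shows "(\<integral>\<^sup>+x. f x \<partial>lborel) = ennreal (\<bar>c\<bar> ^ DIM('a)) * (\<integral>\<^sup>+x. f (t + c *\<^sub>R x) \<partial>lborel)"
  by (subst lborel_affine [OF assms(2), of t])
     (simp add: nn_integral_density nn_integral_distr nn_integral_cmult)

lemma nn_integral_lborel_translate:
  fixes t :: "'a::euclidean_space"
  assumes "f \<in> borel_measurable borel"
  shows "(\<integral>\<^sup>+x. f (t + x) \<partial>lborel) = (\<integral>\<^sup>+x. f x \<partial>lborel)"
  using nn_integral_lborel_affine [OF assms, of 1 t] by simp

lemma fourier_shift:
  fixes w y :: "'a::euclidean_space"
  assumes [measurable]: "\<phi> \<in> borel_measurable borel"
  shows "fourier (\<lambda>x. \<phi> (x - w)) y = exp (- \<i> * complex_of_real (w \<bullet> y)) * fourier \<phi> y"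
proof -
  have "fourier (\<lambda>x. \<phi> (x - w)) y = (LINT x|lborel. \<phi> x * exp (- \<i> * complex_of_real ((w + x) \<bullet> y)))"
    unfolding fourier_def
    by (subst (1) lborel_distr_plus [of w, symmetric], subst integral_distr) simp_all
  also have "\<dots> = (LINT x|lborel. exp (- \<i> * complex_of_real (w \<bullet> y))
      * (\<phi> x * exp (- \<i> * complex_of_real (x \<bullet> y))))"
    by (intro Bochner_Integration.integral_cong) (simp_all add: inner_add_left exp_add [symmetric]
        algebra_simps)
  also have "\<dots> = exp (- \<i> * complex_of_real (w \<bullet> y)) * fourier \<phi> y"
    by (simp add: fourier_def)
  finally show ?thesis .
qed

text \<open>A translation invariant measure with the same Gaussian integral as Lebesgue measure is
  Lebesgue measure: apply Tonelli to \<open>\<integral>\<integral> 1\<^sub>A(x) gauss 1 (y - x)\<close>, translating each variable once.\<close>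

lemma lborel_eq_orthonormal:
  fixes B :: "'a::euclidean_space set"
  assumes B: "pairwise orthogonal B" "\<forall>b\<in>B. norm b = 1" "span B = UNIV"
  shows "lborel = distr (\<Pi>\<^sub>M b\<in>B. lborel) borel (\<lambda>c. \<Sum>b\<in>B. c b *\<^sub>R b)"
proof -
  have "0 \<notin> B"
    using B(2) by force
  then have ind: "independent B"
    by (intro pairwise_orthogonal_independent B(1))
  then have [simp]: "finite B"
    by (rule independent_imp_finite)
  have card: "card B = DIM('a)"
    using ind B(3) by (metis dim_UNIV dim_eq_card_independent dim_span)
  interpret P: product_sigma_finite "\<lambda>_::'a. lborel :: real measure" ..
  interpret Pi: finite_product_sigma_finite "\<lambda>_::'a. lborel :: real measure" B
    by standard simp
  define P where "P = (\<Pi>\<^sub>M b\<in>B. (lborel :: real measure))"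
  interpret SP: sigma_finite_measure P
    unfolding P_def by (rule Pi.sigma_finite_measure_axioms)
  define S where "S c = (\<Sum>b\<in>B. c b *\<^sub>R b)" for c :: "'a \<Rightarrow> real"
  have S [measurable]: "S \<in> P \<rightarrow>\<^sub>M borel"
    unfolding S_def P_def by measurable
  interpret LP: pair_sigma_finite "lborel :: 'a measure" P ..
  have S_coord: "S (\<lambda>b. x \<bullet> b) = x" for x
    unfolding S_def using B by (intro orthonormal_basis_expand) auto
  have transl: "(\<integral>\<^sup>+c. f (S c + x) \<partial>P) = (\<integral>\<^sup>+c. f (S c) \<partial>P)"
    if [measurable]: "f \<in> borel_measurable borel" for f :: "'a \<Rightarrow> ennreal" and x
  proof -
    define T where "T c = (\<lambda>b\<in>B. (x \<bullet> b) + c b)" for c :: "'a \<Rightarrow> real"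
    have T [measurable]: "T \<in> P \<rightarrow>\<^sub>M P"
      unfolding T_def P_def by measurable
    have "distr P P T = P"
      unfolding P_def
    proof (rule P.PiM_eqI)
      fix A :: "'a \<Rightarrow> real set"
      assume A: "\<And>b. b \<in> B \<Longrightarrow> A b \<in> sets lborel"
      have "emeasure (distr (Pi\<^sub>M B (\<lambda>b. lborel)) (Pi\<^sub>M B (\<lambda>b. lborel)) T) (Pi\<^sub>E B A)
          = emeasure (Pi\<^sub>M B (\<lambda>b. lborel)) (T -` Pi\<^sub>E B A \<inter> space (Pi\<^sub>M B (\<lambda>b. lborel)))"
        using A T by (intro emeasure_distr) (auto simp: P_def intro!: sets_PiM_I_finite)
      also have "T -` Pi\<^sub>E B A \<inter> space (Pi\<^sub>M B (\<lambda>b. lborel)) = Pi\<^sub>E B (\<lambda>b. (+) (x \<bullet> b) -` A b)"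
        by (auto simp: T_def space_PiM PiE_iff)
      also have "emeasure (Pi\<^sub>M B (\<lambda>b. lborel)) \<dots> = (\<Prod>b\<in>B. emeasure lborel ((+) (x \<bullet> b) -` A b))"
      proof (rule P.emeasure_PiM)
        show "(+) (x \<bullet> b) -` A b \<in> sets lborel" if "b \<in> B" for b
          using measurable_sets [of "(+) (x \<bullet> b)" borel borel "A b"] A [OF that] by simp
      qed simp
      also have "\<dots> = (\<Prod>b\<in>B. emeasure lborel (A b))"
      proof (rule prod.cong [OF refl])
        fix b assume "b \<in> B"
        then have "emeasure (distr lborel borel ((+) (x \<bullet> b))) (A b) = emeasure lborel ((+) (x \<bullet> b) -` A b)"
          using A by (subst emeasure_distr) auto
        then show "emeasure lborel ((+) (x \<bullet> b) -` A b) = emeasure lborel (A b)"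
          by (simp add: lborel_distr_plus)
      qed
      finally show "emeasure (distr (Pi\<^sub>M B (\<lambda>b. lborel)) (Pi\<^sub>M B (\<lambda>b. lborel)) T) (Pi\<^sub>E B A)
          = (\<Prod>b\<in>B. emeasure lborel (A b))" .
    qed simp_all
    moreover have "S (T c) = S c + x" for c
      using S_coord [of x] by (simp add: T_def S_def scaleR_add_left sum.distrib add.commute)
    ultimately have "(\<integral>\<^sup>+c. f (S c + x) \<partial>P) = (\<integral>\<^sup>+c. f (S c) \<partial>distr P P T)"
      by (subst nn_integral_distr) auto
    then show ?thesis
      using \<open>distr P P T = P\<close> by simp
  qed
  have G: "(\<integral>\<^sup>+c. ennreal (gauss 1 (S c)) \<partial>P) = (\<integral>\<^sup>+x. ennreal (gauss 1 (x::'a)) \<partial>lborel)"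
  proof -
    have "(\<integral>\<^sup>+c. ennreal (gauss 1 (S c)) \<partial>P) = (\<integral>\<^sup>+c. (\<Prod>b\<in>B. ennreal (gauss 1 (c b))) \<partial>P)"
      unfolding S_def using B by (simp add: gauss_sum_orthonormal prod_ennreal)
    also have "\<dots> = (\<Prod>b\<in>B. (\<integral>\<^sup>+t. ennreal (gauss 1 (t::real)) \<partial>lborel))"
      unfolding P_def by (rule P.product_nn_integral_prod) auto
    finally show ?thesis
      by (simp add: nn_integral_gauss card ennreal_power)
  qed
  have "emeasure lborel A = emeasure (distr P borel S) A" if [measurable]: "A \<in> sets borel" for A :: "'a set"
  proof -
    define g where "g = (\<integral>\<^sup>+x. ennreal (gauss 1 (x::'a)) \<partial>lborel)"
    have g: "g \<noteq> 0" "g \<noteq> \<top>"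
      by (simp_all add: g_def nn_integral_gauss)
    have "g * emeasure lborel A = (\<integral>\<^sup>+x. indicator A x * (\<integral>\<^sup>+c. ennreal (gauss 1 (S c + - x)) \<partial>P) \<partial>lborel)"
      by (subst transl) (simp_all add: G g_def nn_integral_multc mult.commute)
    also have "\<dots> = (\<integral>\<^sup>+x. (\<integral>\<^sup>+c. indicator A x * ennreal (gauss 1 (S c - x)) \<partial>P) \<partial>lborel)"
      by (intro nn_integral_cong) (simp add: nn_integral_cmult)
    also have "\<dots> = (\<integral>\<^sup>+c. (\<integral>\<^sup>+x. indicator A x * ennreal (gauss 1 (S c - x)) \<partial>lborel) \<partial>P)"
      by (rule LP.Fubini' [symmetric]) measurable
    also have "\<dots> = (\<integral>\<^sup>+c. (\<integral>\<^sup>+x. indicator A (S c + x) * ennreal (gauss 1 x) \<partial>lborel) \<partial>P)"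
    proof (rule nn_integral_cong)
      fix c
      have "(\<lambda>x. indicator A x * ennreal (gauss 1 (S c - x))) \<in> borel_measurable borel"
        by measurable
      from nn_integral_lborel_translate [OF this, of "S c"]
      show "(\<integral>\<^sup>+x. indicator A x * ennreal (gauss 1 (S c - x)) \<partial>lborel)
          = (\<integral>\<^sup>+x. indicator A (S c + x) * ennreal (gauss 1 x) \<partial>lborel)"
        by simp
    qed
    also have "\<dots> = (\<integral>\<^sup>+x. (\<integral>\<^sup>+c. indicator A (S c + x) * ennreal (gauss 1 x) \<partial>P) \<partial>lborel)"
      by (rule LP.Fubini') measurable
    also have "\<dots> = (\<integral>\<^sup>+x. (\<integral>\<^sup>+c. indicator A (S c + x) \<partial>P) * ennreal (gauss 1 x) \<partial>lborel)"
      by (intro nn_integral_cong nn_integral_multc) measurable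
    also have "\<dots> = g * (\<integral>\<^sup>+c. indicator A (S c) \<partial>P)"
      by (subst transl) (simp_all add: g_def nn_integral_multc mult.commute [of _ "ennreal _"])
    also have "(\<integral>\<^sup>+c. indicator A (S c) \<partial>P) = emeasure (distr P borel S) A"
      by (simp add: nn_integral_distr flip: nn_integral_indicator)
    finally show ?thesis
      using g by (simp add: ennreal_mult_cancel_left)
  qed
  then have "lborel = distr P borel S"
    by (intro measure_eqI) auto
  then show ?thesis
    by (simp add: P_def S_def [abs_def])
qed

section \<open>Lebesgue measure on hyperplanes\<close>

lemma closed_perp: "closed (perp \<xi>)"
  unfolding perp_def orthogonal_def by (intro closed_Collect_eq continuous_intros)

lemma sets_perp [measurable]: "perp \<xi> \<in> sets borel"
  by (simp add: closed_perp borel_closed)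

lemma lborel_subspace_perp_basis:
  fixes \<xi> :: "'a::euclidean_space"
  assumes "norm \<xi> = 1"
  obtains B where "finite B" "pairwise orthogonal (insert \<xi> B)" "\<forall>b\<in>insert \<xi> B. norm b = 1"
    "\<xi> \<notin> B" "span B = perp \<xi>" "span (insert \<xi> B) = UNIV" "card B = DIM('a) - 1"
    "lborel_subspace (perp \<xi>) = distr (\<Pi>\<^sub>M b\<in>B. lborel) borel (\<lambda>c. \<Sum>b\<in>B. c b *\<^sub>R b)"
proof -
  have "subspace (perp \<xi>)"
    by (auto simp: perp_def subspace_def orthogonal_def inner_add_right)
  then have ex: "\<exists>B. pairwise orthogonal B \<and> (\<forall>b\<in>B. norm b = 1) \<and> span B = perp \<xi>"
    by (rule orthonormal_basis_subspace) blast
  define B where "B = (SOME B. pairwise orthogonal B \<and> (\<forall>b\<in>B. norm b = 1) \<and> span B = perp \<xi>)"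
  have B: "pairwise orthogonal B" "\<forall>b\<in>B. norm b = 1" "span B = perp \<xi>"
    using someI_ex [OF ex] by (auto simp: B_def)
  have sub: "B \<subseteq> perp \<xi>"
    using B(3) span_superset by blast
  have notin: "\<xi> \<notin> B"
    using sub assms by (auto simp: perp_def orthogonal_def)
  have pw: "pairwise orthogonal (insert \<xi> B)"
    using B(1) sub by (auto simp: pairwise_insert perp_def orthogonal_commute)
  have nm: "\<forall>b\<in>insert \<xi> B. norm b = 1"
    using B(2) assms by auto
  then have "0 \<notin> insert \<xi> B"
    by (metis norm_zero zero_neq_one)
  then have ind: "independent (insert \<xi> B)"
    by (intro pairwise_orthogonal_independent pw)
  then have fin: "finite B"
    using independent_imp_finite [OF ind] by simp
  have "x \<in> span (insert \<xi> B)" for x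
  proof -
    have "x - (x \<bullet> \<xi>) *\<^sub>R \<xi> \<in> span B"
      using assms unfolding B(3) perp_def
      by (simp add: orthogonal_def inner_diff_right inner_commute norm_eq_1)
    then have "x - (x \<bullet> \<xi>) *\<^sub>R \<xi> \<in> span (insert \<xi> B)"
      by (meson span_mono subset_insertI subsetD)
    then have "(x - (x \<bullet> \<xi>) *\<^sub>R \<xi>) + (x \<bullet> \<xi>) *\<^sub>R \<xi> \<in> span (insert \<xi> B)"
      by (rule span_add) (auto intro: span_scale span_base)
    then show ?thesis
      by simp
  qed
  then have sp: "span (insert \<xi> B) = UNIV"
    by auto
  have "card (insert \<xi> B) = DIM('a)"
    using ind sp by (metis dim_UNIV dim_eq_card_independent dim_span)
  then have "card B = DIM('a) - 1"
    using notin fin by simp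
  moreover have "lborel_subspace (perp \<xi>) = distr (\<Pi>\<^sub>M b\<in>B. lborel) borel (\<lambda>c. \<Sum>b\<in>B. c b *\<^sub>R b)"
    unfolding lborel_subspace_def Let_def B_def ..
  ultimately show ?thesis
    using that fin pw nm notin B(3) sp by blast
qed

lemma sets_lborel_subspace [measurable_cong, simp]: "sets (lborel_subspace V) = sets borel"
  by (simp add: lborel_subspace_def Let_def)

lemma nn_integral_lborel_perp:
  fixes \<xi> :: "'a::euclidean_space"
  assumes "norm \<xi> = 1" and [measurable]: "h \<in> borel_measurable borel"
  shows "(\<integral>\<^sup>+x. h x \<partial>lborel) = (\<integral>\<^sup>+x. \<integral>\<^sup>+s. h (x + s *\<^sub>R \<xi>) \<partial>lborel \<partial>lborel_subspace (perp \<xi>))"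
proof -
  obtain B where B: "finite B" "pairwise orthogonal (insert \<xi> B)" "\<forall>b\<in>insert \<xi> B. norm b = 1"
    "\<xi> \<notin> B" "span B = perp \<xi>" "span (insert \<xi> B) = UNIV" "card B = DIM('a) - 1"
    "lborel_subspace (perp \<xi>) = distr (\<Pi>\<^sub>M b\<in>B. lborel) borel (\<lambda>c. \<Sum>b\<in>B. c b *\<^sub>R b)"
    by (rule lborel_subspace_perp_basis [OF assms(1)])
  interpret product_sigma_finite "\<lambda>_::'a. lborel :: real measure" ..
  have [simp]: "(\<Sum>b\<in>B. (c(\<xi> := s)) b *\<^sub>R b) = (\<Sum>b\<in>B. c b *\<^sub>R b)" for c s
    using B(4) by (intro sum.cong) auto
  have [measurable]: "(\<lambda>x. \<integral>\<^sup>+s. h (x + s *\<^sub>R \<xi>) \<partial>lborel) \<in> borel_measurable borel"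
    by measurable
  have "(\<integral>\<^sup>+x. h x \<partial>lborel) = (\<integral>\<^sup>+c. h (\<Sum>b\<in>insert \<xi> B. c b *\<^sub>R b) \<partial>(\<Pi>\<^sub>M b\<in>insert \<xi> B. lborel))"
    by (subst lborel_eq_orthonormal [OF B(2,3,6)], subst nn_integral_distr) auto
  also have "\<dots> = (\<integral>\<^sup>+c. \<integral>\<^sup>+s. h (\<Sum>b\<in>insert \<xi> B. (c(\<xi> := s)) b *\<^sub>R b) \<partial>lborel \<partial>(\<Pi>\<^sub>M b\<in>B. lborel))"
    by (subst product_nn_integral_insert [OF B(1,4)]) auto
  also have "\<dots> = (\<integral>\<^sup>+c. \<integral>\<^sup>+s. h ((\<Sum>b\<in>B. c b *\<^sub>R b) + s *\<^sub>R \<xi>) \<partial>lborel \<partial>(\<Pi>\<^sub>M b\<in>B. lborel))"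
    using B(1,4) by (simp del: fun_upd_apply) (simp add: add.commute)
  also have "\<dots> = (\<integral>\<^sup>+x. \<integral>\<^sup>+s. h (x + s *\<^sub>R \<xi>) \<partial>lborel \<partial>lborel_subspace (perp \<xi>))"
    unfolding B(8) by (subst nn_integral_distr) auto
  finally show ?thesis .
qed

lemma AE_lborel_subspace_perp:
  assumes "norm (\<xi> :: 'a::euclidean_space) = 1"
  shows "AE x in lborel_subspace (perp \<xi>). x \<in> perp \<xi>"
proof -
  obtain B where B: "finite B" "pairwise orthogonal (insert \<xi> B)" "\<forall>b\<in>insert \<xi> B. norm b = 1"
    "\<xi> \<notin> B" "span B = perp \<xi>" "span (insert \<xi> B) = UNIV" "card B = DIM('a) - 1"
    "lborel_subspace (perp \<xi>) = distr (\<Pi>\<^sub>M b\<in>B. lborel) borel (\<lambda>c. \<Sum>b\<in>B. c b *\<^sub>R b)"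
    by (rule lborel_subspace_perp_basis [OF assms(1)])
  have "(\<Sum>b\<in>B. c b *\<^sub>R b) \<in> perp \<xi>" for c
    unfolding B(5) [symmetric] by (intro span_sum span_scale span_base)
  then show ?thesis
    unfolding B(8) by (subst AE_distr_iff) auto
qed

lemma emeasure_lborel_subspace_perp_cball_le:
  assumes "norm (\<xi> :: 'a::euclidean_space) = 1" "0 \<le> r"
  shows "emeasure (lborel_subspace (perp \<xi>)) (cball 0 r) \<le> ennreal ((2 * r) ^ (DIM('a) - 1))"
proof -
  obtain B where B: "finite B" "pairwise orthogonal (insert \<xi> B)" "\<forall>b\<in>insert \<xi> B. norm b = 1"
    "\<xi> \<notin> B" "span B = perp \<xi>" "span (insert \<xi> B) = UNIV" "card B = DIM('a) - 1"
    "lborel_subspace (perp \<xi>) = distr (\<Pi>\<^sub>M b\<in>B. lborel) borel (\<lambda>c. \<Sum>b\<in>B. c b *\<^sub>R b)"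
    by (rule lborel_subspace_perp_basis [OF assms(1)])
  interpret product_sigma_finite "\<lambda>_::'a. lborel :: real measure" ..
  have coord: "\<bar>c a\<bar> \<le> norm (\<Sum>b\<in>B. c b *\<^sub>R b)" if "a \<in> B" for c a
  proof -
    have "b \<bullet> a = (if b = a then 1 else 0)" if "b \<in> B" for b
      using B(2,3) that \<open>a \<in> B\<close> by (auto simp: pairwise_def orthogonal_def norm_eq_1)
    then have "(\<Sum>b\<in>B. c b *\<^sub>R b) \<bullet> a = (\<Sum>b\<in>B. if b = a then c b else 0)"
      by (auto simp: inner_sum_left intro!: sum.cong)
    also have "\<dots> = c a"
      using that B(1) by simp
    finally show ?thesis
      using Cauchy_Schwarz_ineq2 [of "\<Sum>b\<in>B. c b *\<^sub>R b" a] B(3) that by simp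
  qed
  have "emeasure (lborel_subspace (perp \<xi>)) (cball 0 r)
      = emeasure (\<Pi>\<^sub>M b\<in>B. lborel) ((\<lambda>c. \<Sum>b\<in>B. c b *\<^sub>R b) -` cball 0 r
          \<inter> space (\<Pi>\<^sub>M b\<in>B. (lborel :: real measure)))"
    unfolding B(8) by (rule emeasure_distr) auto
  also have "\<dots> \<le> emeasure (\<Pi>\<^sub>M b\<in>B. lborel) (Pi\<^sub>E B (\<lambda>_. {- r..r}))"
  proof (rule emeasure_mono)
    show "(\<lambda>c. \<Sum>b\<in>B. c b *\<^sub>R b) -` cball 0 r \<inter> space (\<Pi>\<^sub>M b\<in>B. (lborel :: real measure))
        \<subseteq> Pi\<^sub>E B (\<lambda>_. {- r..r})"
    proof
      fix c
      assume c: "c \<in> (\<lambda>c. \<Sum>b\<in>B. c b *\<^sub>R b) -` cball 0 r \<inter> space (\<Pi>\<^sub>M b\<in>B. (lborel :: real measure))"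
      then have "\<bar>c b\<bar> \<le> r" if "b \<in> B" for b
        using coord [OF that, of c] by simp
      then show "c \<in> Pi\<^sub>E B (\<lambda>_. {- r..r})"
        using c by (auto simp: space_PiM PiE_iff abs_le_iff minus_le_iff)
    qed
  qed (use B(1) in \<open>auto intro!: sets_PiM_I_finite\<close>)
  also have "\<dots> = ennreal ((2 * r) ^ (DIM('a) - 1))"
    using B(1,7) assms(2) by (subst emeasure_PiM) (auto simp: ennreal_power)
  finally show ?thesis .
qed

section \<open>Exchanging the integrals\<close>

lemma borel_measurable_fst_snd:
  "fst \<in> borel \<rightarrow>\<^sub>M (borel :: 'a::topological_space measure)"
  "snd \<in> borel \<rightarrow>\<^sub>M (borel :: 'b::topological_space measure)"
  by (intro borel_measurable_continuous_onI continuous_intros)+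

lemma integral_lborel_Pair:
  fixes g :: "'a::euclidean_space \<times> 'b::euclidean_space \<Rightarrow> 'c::{banach, second_countable_topology}"
  assumes "integrable lborel g"
  shows "(LINT z|lborel. g z) = (LINT x|lborel. LINT y|lborel. g (x, y))"
  using lborel_pair.integral_fst' [of g] assms by (simp add: lborel_prod)

lemma nn_integral_lborel_Pair:
  fixes g :: "'a::euclidean_space \<times> 'b::euclidean_space \<Rightarrow> ennreal"
  assumes "g \<in> borel_measurable borel"
  shows "(\<integral>\<^sup>+z. g z \<partial>lborel) = (\<integral>\<^sup>+x. \<integral>\<^sup>+y. g (x, y) \<partial>lborel \<partial>lborel)"
  using lborel.nn_integral_fst [of g lborel] assms by (simp add: lborel_prod)

lemma integrable_lborel_product:
  fixes g :: "'a::euclidean_space \<Rightarrow> real" and h :: "'b::euclidean_space \<Rightarrow> real"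
  assumes g: "integrable lborel g" and h: "integrable lborel h"
  shows "integrable lborel (\<lambda>z. g (fst z) * h (snd z))"
proof -
  have [measurable]: "g \<in> borel_measurable borel" "h \<in> borel_measurable borel"
    using g h by auto
  have "integrable (lborel \<Otimes>\<^sub>M lborel) (\<lambda>z. g (fst z) * h (snd z))"
    using g h by (intro lborel_pair.Fubini_integrable) (auto simp: abs_mult)
  then show ?thesis
    by (simp add: lborel_prod)
qed

locale positive_definite_kernel =
  fixes f :: "'a::euclidean_space \<Rightarrow> real" and R :: real
  assumes dim: "2 \<le> DIM('a)"
    and meas [measurable]: "f \<in> borel_measurable borel"
    and nonneg [simp]: "0 \<le> f y"
    and R: "0 < R"
    and bound: "f y \<le> R / norm y"
    and homogeneous: "t \<noteq> 0 \<Longrightarrow> f (t *\<^sub>R y) = f y / \<bar>t\<bar>"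
    and fourier_nonneg: "fourier (\<lambda>y. complex_of_real (f y * gauss 1 y)) \<eta> \<in> \<real>\<^sub>\<ge>\<^sub>0"
begin

definition F :: "'a \<Rightarrow> real" where
  "F \<eta> = Re (fourier (\<lambda>y. complex_of_real (f y * gauss 1 y)) \<eta>)"

lemma F_nonneg [simp]: "0 \<le> F \<eta>"
  using fourier_nonneg [of \<eta>] unfolding F_def nonneg_Reals_def by force

lemma fourier_eq_F: "fourier (\<lambda>y. complex_of_real (f y * gauss 1 y)) \<eta> = complex_of_real (F \<eta>)"
  using fourier_nonneg [of \<eta>] unfolding F_def nonneg_Reals_def by force

lemma nn_integral_f_gauss_finite:
  assumes "0 < a"
  shows "(\<integral>\<^sup>+y. ennreal (f y * gauss a y) \<partial>lborel) < \<infinity>"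
proof -
  have "(\<integral>\<^sup>+y. ennreal (f y * gauss a y) \<partial>lborel)
      \<le> (\<integral>\<^sup>+y. ennreal R * ennreal (gauss a y / norm y) \<partial>(lborel :: 'a measure))"
  proof (rule nn_integral_mono)
    fix y
    have "f y * gauss a y \<le> R * (gauss a y / norm y)"
      using mult_right_mono [OF bound gauss_nonneg, of y a y] by simp
    then show "ennreal (f y * gauss a y) \<le> ennreal R * ennreal (gauss a y / norm y)"
      using R by (simp add: ennreal_leI flip: ennreal_mult)
  qed
  also have "\<dots> = ennreal R * (\<integral>\<^sup>+y. ennreal (gauss a y / norm y) \<partial>(lborel :: 'a measure))"
    by (rule nn_integral_cmult) simp
  also have "\<dots> < \<infinity>"
    using nn_integral_gauss_div_norm [OF dim assms] by (simp add: ennreal_mult_less_top)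
  finally show ?thesis .
qed

lemma integrable_f_gauss:
  assumes "0 < a"
  shows "integrable lborel (\<lambda>y. f y * gauss a y)"
  using nn_integral_f_gauss_finite [OF assms] by (simp add: integrable_iff_bounded)

lemma F_le: "F \<eta> \<le> (LINT y|lborel. f y * gauss 1 y)"
proof -
  have "F \<eta> \<le> cmod (fourier (\<lambda>y. complex_of_real (f y * gauss 1 y)) \<eta>)"
    unfolding F_def by (rule complex_Re_le_cmod)
  also have "\<dots> \<le> (LINT y|lborel. cmod (complex_of_real (f y * gauss 1 y)
      * exp (- \<i> * complex_of_real (y \<bullet> \<eta>))))"
    unfolding fourier_def by (rule integral_norm_bound)
  also have "\<dots> = (LINT y|lborel. f y * gauss 1 y)"
    by (simp add: norm_mult)
  finally show ?thesis .
qed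

lemma borel_measurable_F [measurable]: "F \<in> borel_measurable borel"
  unfolding F_def [abs_def] fourier_def by measurable

lemma swap_integrals:
  assumes \<psi>: "integrable lborel \<psi>" and "0 < s" "0 < m"
  defines "l \<equiv> \<lambda>\<eta>. gauss (s\<^sup>2) \<eta> * F \<eta> * (LINT x|lborel. \<psi> x * (sqrt (2 * pi) * m * gauss (m\<^sup>2) (x \<bullet> \<eta>)))"
  defines "r \<equiv> \<lambda>(x, t :: real, y). \<psi> x
      * (gauss (1 / m\<^sup>2) t * (f y * gauss 1 y * gauss (1 / s\<^sup>2) (y + t *\<^sub>R x)))"
  shows "integrable lborel l" and "integrable lborel r"
    and "(LINT \<eta>|lborel. l \<eta>) = (sqrt (2 * pi) / s) ^ DIM('a) * (LINT z|lborel. r z)"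
proof -
  have [measurable]: "\<psi> \<in> borel_measurable borel"
    using \<psi> by auto
  define W where "W = (\<lambda>(x, t :: real, y). \<psi> x * (gauss (1 / m\<^sup>2) t * (f y * gauss 1 y)))"
  define v where "v = (\<lambda>(x :: 'a, t, y). y + t *\<^sub>R x)"
  define e where "e z \<eta> = complex_of_real (W z) * (complex_of_real (gauss (s\<^sup>2) \<eta>)
      * exp (- \<i> * complex_of_real (\<eta> \<bullet> v z)))" for z \<eta>
  have Wm [measurable]: "W \<in> borel_measurable borel" and vm [measurable]: "v \<in> borel_measurable borel"
    unfolding W_def v_def borel_prod [symmetric] by measurable
  have W: "integrable lborel W"
  proof -
    have "integrable lborel (\<lambda>z. \<psi> (fst z) * (\<lambda>w. gauss (1 / m\<^sup>2) (fst w)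
        * (f (snd w) * gauss 1 (snd w))) (snd z))"
      using assms by (intro integrable_lborel_product \<psi> integrable_gauss(1) integrable_f_gauss) auto
    then show ?thesis
      by (simp add: W_def case_prod_unfold)
  qed
  have e: "integrable (lborel \<Otimes>\<^sub>M lborel) (\<lambda>(z, \<eta>). e z \<eta>)"
  proof (rule Bochner_Integration.integrable_bound)
    show "integrable (lborel \<Otimes>\<^sub>M lborel) (\<lambda>z. W (fst z) * gauss (s\<^sup>2) (snd z :: 'a))"
      using integrable_lborel_product [OF W integrable_gauss(1) [of "s\<^sup>2", where 'a='a]] assms
      by (simp add: lborel_prod)
    show "(\<lambda>(z, \<eta>). e z \<eta>) \<in> borel_measurable (lborel \<Otimes>\<^sub>M lborel)"
      unfolding e_def by measurable
  qed (auto simp: e_def norm_mult)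
  have inner_\<eta>: "(LINT \<eta>|lborel. e z \<eta>)
      = complex_of_real ((sqrt (2 * pi) / s) ^ DIM('a) * (W z * gauss (1 / s\<^sup>2) (v z)))" for z
    using integrable_gauss(2) [of "s\<^sup>2" "v z"] assms
    by (simp add: e_def fourier_def real_sqrt_divide mult_ac)
  have inner_z: "(LINT z|lborel. e z \<eta>)
      = complex_of_real (l \<eta>)" for \<eta>
  proof -
    have i: "integrable lborel (\<lambda>z. e z \<eta>)"
      by (rule Bochner_Integration.integrable_bound [OF W])
         (auto simp: e_def norm_mult gauss_le_1 mult_left_le)
    have t: "(LINT w|lborel. complex_of_real (gauss (1 / m\<^sup>2) (fst w) * (f (snd w) * gauss 1 (snd w)))
        * exp (- \<i> * complex_of_real (\<eta> \<bullet> v (x, w)))) =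
        complex_of_real (sqrt (2 * pi) * m * gauss (m\<^sup>2) (x \<bullet> \<eta>) * F \<eta>)" for x
    proof -
      note borel_measurable_fst_snd [measurable]
      have [measurable]: "(\<lambda>w. v (x, w)) \<in> borel_measurable borel"
        unfolding v_def by (simp add: case_prod_unfold)
      have "integrable lborel (\<lambda>w. complex_of_real (gauss (1 / m\<^sup>2) (fst w) * (f (snd w) * gauss 1 (snd w)))
        * exp (- \<i> * complex_of_real (\<eta> \<bullet> v (x, w))))"
      proof (rule Bochner_Integration.integrable_bound)
        show "integrable lborel (\<lambda>w. gauss (1 / m\<^sup>2) (fst w :: real) * (\<lambda>y. f y * gauss 1 y) (snd w))"
          using assms by (intro integrable_lborel_product integrable_gauss(1) integrable_f_gauss) auto
      qed (auto simp: norm_mult)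
      then have "(LINT w|lborel. complex_of_real (gauss (1 / m\<^sup>2) (fst w) * (f (snd w) * gauss 1 (snd w)))
        * exp (- \<i> * complex_of_real (\<eta> \<bullet> v (x, w)))) =
        (LINT t|lborel. LINT y|lborel. (complex_of_real (gauss (1 / m\<^sup>2) t)
            * exp (- \<i> * complex_of_real (t * (x \<bullet> \<eta>))))
          * (complex_of_real (f y * gauss 1 y) * exp (- \<i> * complex_of_real (y \<bullet> \<eta>))))"
        by (subst integral_lborel_Pair)
           (auto simp: v_def inner_add_right inner_commute exp_add [symmetric] algebra_simps)
      also have "\<dots> = (LINT t|lborel. (complex_of_real (gauss (1 / m\<^sup>2) t)
          * exp (- \<i> * complex_of_real (t * (x \<bullet> \<eta>)))) * complex_of_real (F \<eta>))"
        by (simp add: fourier_eq_F [symmetric] fourier_def)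
      also have "\<dots> = complex_of_real (sqrt (2 * pi / (1 / m\<^sup>2)) * gauss (1 / (1 / m\<^sup>2)) (x \<bullet> \<eta>))
          * complex_of_real (F \<eta>)"
        using assms by (subst gauss_real_fourier(2) [symmetric]) auto
      finally show ?thesis
        using assms by (simp add: real_sqrt_mult)
    qed
    have "(LINT z|lborel. e z \<eta>) = (LINT x|lborel. LINT w|lborel. e (x, w) \<eta>)"
      using i by (rule integral_lborel_Pair)
    also have "\<dots> = (LINT x|lborel. complex_of_real (\<psi> x * gauss (s\<^sup>2) \<eta>)
        * (LINT w|lborel. complex_of_real (gauss (1 / m\<^sup>2) (fst w) * (f (snd w) * gauss 1 (snd w)))
        * exp (- \<i> * complex_of_real (\<eta> \<bullet> v (x, w)))))"
      by (simp add: e_def W_def case_prod_unfold mult_ac flip: integral_mult_right_zero)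
    also have "\<dots> = (LINT x|lborel. complex_of_real (gauss (s\<^sup>2) \<eta> * F \<eta>
        * (\<psi> x * (sqrt (2 * pi) * m * gauss (m\<^sup>2) (x \<bullet> \<eta>)))))"
      unfolding t by (simp add: mult_ac)
    also have "\<dots> = complex_of_real (l \<eta>)"
      unfolding integral_complex_of_real integral_mult_right_zero l_def ..
    finally show ?thesis .
  qed
  have "integrable lborel (\<lambda>\<eta>. LINT z|lborel. e z \<eta>)"
    using e by (intro lborel_pair.integrable_snd) simp
  then have "integrable lborel (\<lambda>\<eta>. complex_of_real (l \<eta>))"
    unfolding inner_z .
  then show "integrable lborel l"
    by (simp only: complex_of_real_integrable_eq)
  have r: "r = (\<lambda>z. W z * gauss (1 / s\<^sup>2) (v z))"
    by (simp add: r_def W_def v_def case_prod_unfold mult_ac fun_eq_iff)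
  show "integrable lborel r"
    unfolding r
    by (rule Bochner_Integration.integrable_bound [OF W]) (auto simp: abs_mult gauss_le_1 mult_left_le)
  have "complex_of_real (LINT \<eta>|lborel. l \<eta>) = (LINT \<eta>|lborel. LINT z|lborel. e z \<eta>)"
    unfolding inner_z by simp
  also have "\<dots> = (LINT z|lborel. LINT \<eta>|lborel. e z \<eta>)"
    using e by (rule lborel_pair.Fubini_integral)
  also have "\<dots> = complex_of_real (LINT z|lborel. (sqrt (2 * pi) / s) ^ DIM('a) * r z)"
    unfolding inner_\<eta> r integral_complex_of_real ..
  finally show "(LINT \<eta>|lborel. l \<eta>) = (sqrt (2 * pi) / s) ^ DIM('a) * (LINT z|lborel. r z)"
    by (simp only: of_real_eq_iff) simp
qed

lemma nn_swap_integrals: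
  assumes [measurable]: "\<psi> \<in> borel_measurable borel"
    and \<psi>: "integrable lborel \<psi>" "\<And>x. 0 \<le> \<psi> x" and "0 < s" "0 < m"
  shows "(\<integral>\<^sup>+\<eta>. ennreal (gauss (s\<^sup>2) \<eta> * F \<eta>)
      * (\<integral>\<^sup>+x. ennreal (\<psi> x * (sqrt (2 * pi) * m * gauss (m\<^sup>2) (x \<bullet> \<eta>))) \<partial>lborel) \<partial>lborel)
    = ennreal ((sqrt (2 * pi) / s) ^ DIM('a)) * (\<integral>\<^sup>+x. ennreal (\<psi> x) *
        (\<integral>\<^sup>+t. ennreal (gauss (1 / m\<^sup>2) (t :: real))
            * (\<integral>\<^sup>+y. ennreal (f y * gauss 1 y * gauss (1 / s\<^sup>2) (y + t *\<^sub>R x)) \<partial>lborel) \<partial>lborel) \<partial>lborel)"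
proof -
  define l where "l \<eta> = gauss (s\<^sup>2) \<eta> * F \<eta>
      * (LINT x|lborel. \<psi> x * (sqrt (2 * pi) * m * gauss (m\<^sup>2) (x \<bullet> \<eta>)))" for \<eta>
  define r where "r = (\<lambda>(x, t :: real, y). \<psi> x
      * (gauss (1 / m\<^sup>2) t * (f y * gauss 1 y * gauss (1 / s\<^sup>2) (y + t *\<^sub>R x))))"
  note swap = swap_integrals [OF \<psi>(1) assms(4,5), folded l_def r_def]
  have r_nonneg: "0 \<le> r z" for z
    using \<psi>(2) by (auto simp: r_def split: prod.split)
  have l_nonneg: "0 \<le> l \<eta>" for \<eta>
    using \<psi>(2) assms(5) unfolding l_def by (intro mult_nonneg_nonneg integral_nonneg) auto
  have "integrable lborel (\<lambda>x. \<psi> x * (sqrt (2 * pi) * m * gauss (m\<^sup>2) (x \<bullet> \<eta>)))" for \<eta>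
  proof (rule Bochner_Integration.integrable_bound)
    show "integrable lborel (\<lambda>x. sqrt (2 * pi) * m * \<psi> x)"
      using \<psi>(1) by simp
  qed (use \<psi>(2) assms(5) in \<open>auto simp: abs_mult gauss_le_1 mult_left_le mult_ac intro!: mult_left_mono\<close>)
  then have inner: "(\<integral>\<^sup>+x. ennreal (\<psi> x * (sqrt (2 * pi) * m * gauss (m\<^sup>2) (x \<bullet> \<eta>))) \<partial>lborel)
      = ennreal (LINT x|lborel. \<psi> x * (sqrt (2 * pi) * m * gauss (m\<^sup>2) (x \<bullet> \<eta>)))" for \<eta>
    using \<psi>(2) assms(5) by (intro nn_integral_eq_integral) auto
  have "(\<integral>\<^sup>+\<eta>. ennreal (gauss (s\<^sup>2) \<eta> * F \<eta>)
      * (\<integral>\<^sup>+x. ennreal (\<psi> x * (sqrt (2 * pi) * m * gauss (m\<^sup>2) (x \<bullet> \<eta>))) \<partial>lborel) \<partial>lborel)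
      = (\<integral>\<^sup>+\<eta>. ennreal (l \<eta>) \<partial>lborel)"
    unfolding inner l_def using \<psi>(2) assms(5) by (simp add: ennreal_mult'')
  also have "\<dots> = ennreal (LINT \<eta>|lborel. l \<eta>)"
    using swap(1) l_nonneg by (intro nn_integral_eq_integral) auto
  also have "\<dots> = ennreal ((sqrt (2 * pi) / s) ^ DIM('a)) * ennreal (LINT z|lborel. r z)"
    unfolding swap(3) using r_nonneg assms(4) by (intro ennreal_mult) auto
  also have "ennreal (LINT z|lborel. r z) = (\<integral>\<^sup>+z. ennreal (r z) \<partial>lborel)"
    using swap(2) r_nonneg by (intro nn_integral_eq_integral [symmetric]) auto
  also have "\<dots> = (\<integral>\<^sup>+x. \<integral>\<^sup>+w. ennreal (r (x, w)) \<partial>lborel \<partial>lborel)"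
    using swap(2) by (intro nn_integral_lborel_Pair) auto
  also have "\<dots> = (\<integral>\<^sup>+x. \<integral>\<^sup>+t. \<integral>\<^sup>+y. ennreal (r (x, t, y)) \<partial>lborel \<partial>lborel \<partial>lborel)"
  proof (intro nn_integral_cong nn_integral_lborel_Pair)
    fix x
    show "(\<lambda>w. ennreal (r (x, w))) \<in> borel_measurable borel"
      unfolding r_def borel_prod [symmetric] case_prod_unfold by simp
  qed
  also have "\<dots> = (\<integral>\<^sup>+x. ennreal (\<psi> x) * (\<integral>\<^sup>+t. ennreal (gauss (1 / m\<^sup>2) (t :: real))
      * (\<integral>\<^sup>+y. ennreal (f y * gauss 1 y * gauss (1 / s\<^sup>2) (y + t *\<^sub>R x)) \<partial>lborel) \<partial>lborel) \<partial>lborel)"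
    using \<psi>(2) unfolding r_def by (simp add: ennreal_mult' nn_integral_cmult)
  finally show ?thesis .
qed

end

section \<open>Sections as limits of Gaussian slabs\<close>

lemma perp_scaleR: "c \<noteq> 0 \<Longrightarrow> perp (c *\<^sub>R \<xi>) = perp \<xi>"
  by (auto simp: perp_def orthogonal_def)

lemma norm_perp_add:
  assumes "x \<in> perp \<xi>"
  shows "norm x \<le> norm (x + s *\<^sub>R \<xi>)"
proof -
  have "(norm (x + s *\<^sub>R \<xi>))\<^sup>2 = (norm x)\<^sup>2 + (norm (s *\<^sub>R \<xi>))\<^sup>2"
    using assms by (intro norm_add_Pythagorean) (auto simp: perp_def orthogonal_def inner_commute)
  then show ?thesis
    by (metis le_add_same_cancel1 norm_ge_zero power2_le_imp_le zero_le_power2)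
qed

lemma nn_integral_gaussian_slab:
  fixes \<eta> :: "'a::euclidean_space" and \<psi> :: "'a \<Rightarrow> real"
  assumes \<eta>: "\<eta> \<noteq> 0" and "0 < m" and [measurable]: "\<psi> \<in> borel_measurable borel" and \<psi>: "\<And>x. 0 \<le> \<psi> x"
  shows "(\<integral>\<^sup>+x. ennreal (\<psi> x * (sqrt (2 * pi) * m * gauss (m\<^sup>2) (x \<bullet> \<eta>))) \<partial>lborel)
    = ennreal (sqrt (2 * pi) / norm \<eta>) *
      (\<integral>\<^sup>+x. \<integral>\<^sup>+v. ennreal (\<psi> (x + (v / (m * norm \<eta>)) *\<^sub>R (\<eta> /\<^sub>R norm \<eta>))
          * gauss 1 (v :: real)) \<partial>lborel \<partial>lborel_subspace (perp \<eta>))"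
proof -
  define \<xi> where "\<xi> = \<eta> /\<^sub>R norm \<eta>"
  have \<xi>: "norm \<xi> = 1" "\<eta> = norm \<eta> *\<^sub>R \<xi>"
    using \<eta> by (auto simp: \<xi>_def)
  have perp: "perp \<eta> = perp \<xi>"
    using \<eta> by (simp add: \<xi>_def perp_scaleR)
  have "(\<integral>\<^sup>+x. ennreal (\<psi> x * (sqrt (2 * pi) * m * gauss (m\<^sup>2) (x \<bullet> \<eta>))) \<partial>lborel)
      = (\<integral>\<^sup>+x. \<integral>\<^sup>+t. ennreal (\<psi> (x + t *\<^sub>R \<xi>)
          * (sqrt (2 * pi) * m * gauss (m\<^sup>2) ((x + t *\<^sub>R \<xi>) \<bullet> \<eta>))) \<partial>lborel \<partial>lborel_subspace (perp \<xi>))"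
    by (rule nn_integral_lborel_perp [OF \<xi>(1)]) measurable
  also have "\<dots> = (\<integral>\<^sup>+x. ennreal (sqrt (2 * pi) / norm \<eta>) *
      (\<integral>\<^sup>+v. ennreal (\<psi> (x + (v / (m * norm \<eta>)) *\<^sub>R \<xi>) * gauss 1 v) \<partial>lborel) \<partial>lborel_subspace (perp \<xi>))"
  proof (rule nn_integral_cong_AE)
    have eq: "(\<integral>\<^sup>+t. ennreal (\<psi> (x + t *\<^sub>R \<xi>)
        * (sqrt (2 * pi) * m * gauss (m\<^sup>2) ((x + t *\<^sub>R \<xi>) \<bullet> \<eta>))) \<partial>lborel)
      = ennreal (sqrt (2 * pi) / norm \<eta>) * (\<integral>\<^sup>+v. ennreal (\<psi> (x + (v / (m * norm \<eta>)) *\<^sub>R \<xi>)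
          * gauss 1 v) \<partial>lborel)"
      if x: "x \<in> perp \<xi>" for x
    proof -
      define c where "c = 1 / (m * norm \<eta>)"
      have c: "0 < c"
        using assms by (simp add: c_def)
      have "x \<bullet> \<eta> = 0"
        using x perp by (auto simp: perp_def orthogonal_def inner_commute)
      then have ip: "(x + t *\<^sub>R \<xi>) \<bullet> \<eta> = t * norm \<eta>" for t
        using \<eta> by (simp add: \<xi>_def inner_add_left power2_norm_eq_inner [symmetric] power2_eq_square)
      have g: "gauss (m\<^sup>2) (0 + c * v * norm \<eta>) = gauss 1 v" for v
        using assms(2) \<eta> by (simp add: c_def gauss_def power_mult_distrib power_divide)
      have "(\<integral>\<^sup>+t. ennreal (\<psi> (x + t *\<^sub>R \<xi>) * (sqrt (2 * pi) * m * gauss (m\<^sup>2) ((x + t *\<^sub>R \<xi>) \<bullet> \<eta>))) \<partial>lborel)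
        = ennreal \<bar>c\<bar> * (\<integral>\<^sup>+v. ennreal (\<psi> (x + (0 + c * v) *\<^sub>R \<xi>)
            * (sqrt (2 * pi) * m * gauss (m\<^sup>2) ((0 + c * v) * norm \<eta>))) \<partial>lborel)"
        unfolding ip using c by (intro nn_integral_real_affine) auto
      also have "\<dots> = (\<integral>\<^sup>+v. ennreal c * ennreal (\<psi> (x + (0 + c * v) *\<^sub>R \<xi>)
          * (sqrt (2 * pi) * m * gauss (m\<^sup>2) ((0 + c * v) * norm \<eta>))) \<partial>lborel)"
        using c by (subst nn_integral_cmult) auto
      also have "\<dots> = (\<integral>\<^sup>+v. ennreal (sqrt (2 * pi) / norm \<eta>) * ennreal (\<psi> (x + (v / (m * norm \<eta>)) *\<^sub>R \<xi>)
          * gauss 1 v) \<partial>lborel)"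
      proof (rule nn_integral_cong)
        fix v :: real
        have cv: "0 + c * v = v / (m * norm \<eta>)"
          by (simp add: c_def)
        have "ennreal c * ennreal (\<psi> (x + (0 + c * v) *\<^sub>R \<xi>)
            * (sqrt (2 * pi) * m * gauss (m\<^sup>2) ((0 + c * v) * norm \<eta>)))
          = ennreal (c * (\<psi> (x + (0 + c * v) *\<^sub>R \<xi>) * (sqrt (2 * pi) * m * gauss 1 v)))"
          using c \<psi> assms(2) g [of v] by (simp add: ennreal_mult')
        also have "c * (\<psi> (x + (0 + c * v) *\<^sub>R \<xi>) * (sqrt (2 * pi) * m * gauss 1 v))
          = sqrt (2 * pi) / norm \<eta> * (\<psi> (x + (v / (m * norm \<eta>)) *\<^sub>R \<xi>) * gauss 1 v)"
          unfolding cv using assms(2) by (simp add: c_def)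
        also have "ennreal \<dots> = ennreal (sqrt (2 * pi) / norm \<eta>)
            * ennreal (\<psi> (x + (v / (m * norm \<eta>)) *\<^sub>R \<xi>) * gauss 1 v)"
          using \<psi> by (intro ennreal_mult) simp_all
        finally show "ennreal c * ennreal (\<psi> (x + (0 + c * v) *\<^sub>R \<xi>)
            * (sqrt (2 * pi) * m * gauss (m\<^sup>2) ((0 + c * v) * norm \<eta>)))
          = ennreal (sqrt (2 * pi) / norm \<eta>) * ennreal (\<psi> (x + (v / (m * norm \<eta>)) *\<^sub>R \<xi>) * gauss 1 v)"
          .
      qed
      also have "\<dots> = ennreal (sqrt (2 * pi) / norm \<eta>) * (\<integral>\<^sup>+v. ennreal (\<psi> (x + (v / (m * norm \<eta>)) *\<^sub>R \<xi>)
          * gauss 1 v) \<partial>lborel)"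
        by (rule nn_integral_cmult) measurable
      finally show ?thesis .
    qed
    show "AE x in lborel_subspace (perp \<xi>). (\<integral>\<^sup>+t. ennreal (\<psi> (x + t *\<^sub>R \<xi>)
        * (sqrt (2 * pi) * m * gauss (m\<^sup>2) ((x + t *\<^sub>R \<xi>) \<bullet> \<eta>))) \<partial>lborel)
      = ennreal (sqrt (2 * pi) / norm \<eta>) * (\<integral>\<^sup>+v. ennreal (\<psi> (x + (v / (m * norm \<eta>)) *\<^sub>R \<xi>)
          * gauss 1 v) \<partial>lborel)"
      using AE_lborel_subspace_perp [OF \<xi>(1)] by eventually_elim (rule eq)
  qed
  also have "\<dots> = ennreal (sqrt (2 * pi) / norm \<eta>) *
      (\<integral>\<^sup>+x. \<integral>\<^sup>+v. ennreal (\<psi> (x + (v / (m * norm \<eta>)) *\<^sub>R \<xi>) * gauss 1 v) \<partial>lborel \<partial>lborel_subspace (perp \<xi>))"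
  proof (rule nn_integral_cmult)
    have "(\<lambda>x. \<integral>\<^sup>+v. ennreal (\<psi> (x + (v / (m * norm \<eta>)) *\<^sub>R \<xi>) * gauss 1 v) \<partial>lborel) \<in> borel_measurable borel"
      by measurable
    then show "(\<lambda>x. \<integral>\<^sup>+v. ennreal (\<psi> (x + (v / (m * norm \<eta>)) *\<^sub>R \<xi>) * gauss 1 v) \<partial>lborel)
        \<in> borel_measurable (lborel_subspace (perp \<xi>))"
      by (simp cong: measurable_cong_sets)
  qed
  finally show ?thesis
    by (simp only: perp [folded \<xi>_def] \<xi>_def [symmetric])
qed

lemma emeasure_perp_cball_le:
  fixes \<eta> :: "'a::euclidean_space"
  assumes "\<eta> \<noteq> 0" "0 \<le> r"
  shows "emeasure (lborel_subspace (perp \<eta>)) (cball 0 r) \<le> ennreal ((2 * r) ^ (DIM('a) - 1))"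
  using emeasure_lborel_subspace_perp_cball_le [of "\<eta> /\<^sub>R norm \<eta>" r] assms by (simp add: perp_scaleR)

lemma AE_lborel_subspace_perp':
  fixes \<eta> :: "'a::euclidean_space"
  assumes "\<eta> \<noteq> 0"
  shows "AE x in lborel_subspace (perp \<eta>). x \<in> perp \<eta>"
proof -
  have "perp (\<eta> /\<^sub>R norm \<eta>) = perp \<eta>"
    using assms by (simp add: perp_scaleR)
  from AE_lborel_subspace_perp [of "\<eta> /\<^sub>R norm \<eta>", unfolded this] show ?thesis
    using assms by simp
qed

lemma gaussian_slab_inner_le:
  fixes \<eta> :: "'a::euclidean_space" and \<psi> :: "'a \<Rightarrow> real"
  assumes \<eta>: "\<eta> \<noteq> 0" and \<psi>: "\<And>x. 0 \<le> \<psi> x" "\<And>x. \<psi> x \<le> indicator (cball 0 r) x" and x: "x \<in> perp \<eta>"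
  shows "(\<integral>\<^sup>+v. ennreal (\<psi> (x + (v * c) *\<^sub>R (\<eta> /\<^sub>R norm \<eta>)) * gauss 1 (v :: real)) \<partial>lborel)
    \<le> ennreal (sqrt (2 * pi)) * indicator (cball 0 r) x"
proof -
  have x': "x \<in> perp (\<eta> /\<^sub>R norm \<eta>)"
    using \<eta> x by (simp add: perp_scaleR)
  have "(\<integral>\<^sup>+v. ennreal (\<psi> (x + (v * c) *\<^sub>R (\<eta> /\<^sub>R norm \<eta>)) * gauss 1 (v :: real)) \<partial>lborel)
      \<le> (\<integral>\<^sup>+v. ennreal (gauss 1 (v :: real)) * indicator (cball 0 r) x \<partial>lborel)"
  proof (rule nn_integral_mono)
    fix v :: real
    define z where "z = x + (v * c) *\<^sub>R (\<eta> /\<^sub>R norm \<eta>)"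
    have "\<psi> z \<le> indicator (cball 0 r) x"
    proof (cases "norm z \<le> r")
      case True
      then have "norm x \<le> r"
        using norm_perp_add [OF x', of "v * c"] by (simp add: z_def)
      then show ?thesis
        using \<psi>(2) [of z] True by (simp add: indicator_def split: if_splits)
    next
      case False
      then show ?thesis
        using \<psi>(1) [of z] \<psi>(2) [of z] by (simp add: indicator_def)
    qed
    then have "\<psi> z * gauss 1 v \<le> indicator (cball 0 r) x * gauss 1 v"
      by (intro mult_right_mono) auto
    then show "ennreal (\<psi> z * gauss 1 v) \<le> ennreal (gauss 1 v) * indicator (cball 0 r) x"
      by (auto simp: indicator_def mult_le_0_iff ennreal_eq_0_iff split: if_splits intro: ennreal_leI)
  qed
  also have "\<dots> = ennreal (sqrt (2 * pi)) * indicator (cball 0 r) x"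
    by (simp add: nn_integral_multc nn_integral_gauss)
  finally show ?thesis .
qed

lemma gaussian_slab_le:
  fixes \<eta> :: "'a::euclidean_space" and \<psi> :: "'a \<Rightarrow> real"
  assumes \<eta>: "\<eta> \<noteq> 0" and "0 < m" and [measurable]: "\<psi> \<in> borel_measurable borel"
    and \<psi>: "\<And>x. 0 \<le> \<psi> x" "\<And>x. \<psi> x \<le> indicator (cball 0 r) x" and "0 \<le> r"
  shows "(\<integral>\<^sup>+x. ennreal (\<psi> x * (sqrt (2 * pi) * m * gauss (m\<^sup>2) (x \<bullet> \<eta>))) \<partial>lborel)
    \<le> ennreal (2 * pi / norm \<eta>) * ennreal ((2 * r) ^ (DIM('a) - 1))"
proof -
  have "(\<integral>\<^sup>+x. \<integral>\<^sup>+v. ennreal (\<psi> (x + (v / (m * norm \<eta>)) *\<^sub>R (\<eta> /\<^sub>R norm \<eta>))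
      * gauss 1 (v :: real)) \<partial>lborel \<partial>lborel_subspace (perp \<eta>))
      \<le> (\<integral>\<^sup>+x. ennreal (sqrt (2 * pi)) * indicator (cball 0 r) x \<partial>lborel_subspace (perp \<eta>))"
    using AE_lborel_subspace_perp' [OF \<eta>]
  proof (intro nn_integral_mono_AE, eventually_elim)
    case (elim x)
    show ?case
      using gaussian_slab_inner_le [OF \<eta> \<psi> elim(2), where c = "1 / (m * norm \<eta>)"] by simp
  qed
  also have "\<dots> = ennreal (sqrt (2 * pi)) * emeasure (lborel_subspace (perp \<eta>)) (cball 0 r)"
    by (rule nn_integral_cmult_indicator) simp
  also have "\<dots> \<le> ennreal (sqrt (2 * pi)) * ennreal ((2 * r) ^ (DIM('a) - 1))"
    using emeasure_perp_cball_le [OF \<eta> \<open>0 \<le> r\<close>] by (rule mult_left_mono) simp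
  finally have "ennreal (sqrt (2 * pi) / norm \<eta>) *
      (\<integral>\<^sup>+x. \<integral>\<^sup>+v. ennreal (\<psi> (x + (v / (m * norm \<eta>)) *\<^sub>R (\<eta> /\<^sub>R norm \<eta>))
          * gauss 1 (v :: real)) \<partial>lborel \<partial>lborel_subspace (perp \<eta>))
      \<le> ennreal (sqrt (2 * pi) / norm \<eta>) * (ennreal (sqrt (2 * pi)) * ennreal ((2 * r) ^ (DIM('a) - 1)))"
    by (rule mult_left_mono) simp
  also have "\<dots> = ennreal (2 * pi / norm \<eta>) * ennreal ((2 * r) ^ (DIM('a) - 1))"
    by (simp add: ennreal_mult' [symmetric] mult.assoc [symmetric])
  finally show ?thesis
    using nn_integral_gaussian_slab [OF \<eta> \<open>0 < m\<close> assms(3) \<psi>(1)] by simp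
qed

lemma gaussian_slab_tendsto:
  fixes \<eta> :: "'a::euclidean_space" and \<psi> :: "'a \<Rightarrow> real"
  assumes \<eta>: "\<eta> \<noteq> 0" and cont: "continuous_on UNIV \<psi>"
    and \<psi>: "\<And>x. 0 \<le> \<psi> x" "\<And>x. \<psi> x \<le> indicator (cball 0 r) x" and "0 \<le> r"
  shows "(\<lambda>k. \<integral>\<^sup>+x. ennreal (\<psi> x * (sqrt (2 * pi) * real (Suc k) * gauss ((real (Suc k))\<^sup>2) (x \<bullet> \<eta>))) \<partial>lborel)
    \<longlonglongrightarrow> ennreal (2 * pi / norm \<eta>) * (\<integral>\<^sup>+x. ennreal (\<psi> x) \<partial>lborel_subspace (perp \<eta>))"
proof -
  have [measurable]: "\<psi> \<in> borel_measurable borel"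
    using cont by (rule borel_measurable_continuous_onI)
  define \<xi> where "\<xi> = \<eta> /\<^sub>R norm \<eta>"
  define I where "I k x = (\<integral>\<^sup>+v. ennreal (\<psi> (x + (v / (real (Suc k) * norm \<eta>)) *\<^sub>R \<xi>)
      * gauss 1 (v :: real)) \<partial>lborel)" for k x
  have [measurable]: "I k \<in> borel_measurable borel" for k
    unfolding I_def by measurable
  have \<psi>1: "\<psi> x \<le> 1" for x
    using \<psi>(2) [of x] by (cases "x \<in> cball 0 r") auto
  have "(\<lambda>k. I k x) \<longlonglongrightarrow> (\<integral>\<^sup>+v. ennreal (\<psi> x * gauss 1 (v :: real)) \<partial>lborel)" for x
    unfolding I_def
  proof (rule nn_integral_dominated_convergence [where w = "\<lambda>v. ennreal (gauss 1 v)"])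
    show "(\<integral>\<^sup>+v. ennreal (gauss 1 (v :: real)) \<partial>lborel) < \<infinity>"
      by (simp add: nn_integral_gauss)
    show "AE v in lborel. ennreal (\<psi> (x + (v / (real (Suc k) * norm \<eta>)) *\<^sub>R \<xi>) * gauss 1 v)
        \<le> ennreal (gauss 1 v)" for k
      using \<psi>1 by (intro AE_I2 ennreal_leI) (auto intro: mult_left_le_one_le \<psi>)
    show "AE v in lborel. (\<lambda>k. ennreal (\<psi> (x + (v / (real (Suc k) * norm \<eta>)) *\<^sub>R \<xi>) * gauss 1 v))
        \<longlonglongrightarrow> ennreal (\<psi> x * gauss 1 v)"
    proof (intro AE_I2 tendsto_ennrealI tendsto_mult tendsto_const)
      fix v
      have "(\<lambda>k. v / norm \<eta> * (1 / real (Suc k))) \<longlonglongrightarrow> v / norm \<eta> * 0"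
        by (intro tendsto_mult tendsto_const lim_1_over_n [THEN LIMSEQ_Suc])
      then have "(\<lambda>k. x + (v / (real (Suc k) * norm \<eta>)) *\<^sub>R \<xi>) \<longlonglongrightarrow> x + 0 *\<^sub>R \<xi>"
        by (intro tendsto_add tendsto_scaleR tendsto_const) (simp add: mult.commute)
      then show "(\<lambda>k. \<psi> (x + (v / (real (Suc k) * norm \<eta>)) *\<^sub>R \<xi>)) \<longlonglongrightarrow> \<psi> x"
        using continuous_on_tendsto_compose [OF cont, of _ "x + 0 *\<^sub>R \<xi>"] by simp
    qed
  qed measurable
  then have I: "(\<lambda>k. I k x) \<longlonglongrightarrow> ennreal (sqrt (2 * pi)) * ennreal (\<psi> x)" for x
    using \<psi>(1) by (simp add: ennreal_mult' nn_integral_cmult nn_integral_gauss mult.commute)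
  have "(\<lambda>k. \<integral>\<^sup>+x. I k x \<partial>lborel_subspace (perp \<eta>))
      \<longlonglongrightarrow> (\<integral>\<^sup>+x. ennreal (sqrt (2 * pi)) * ennreal (\<psi> x) \<partial>lborel_subspace (perp \<eta>))"
  proof (rule nn_integral_dominated_convergence [where w
      = "\<lambda>x. ennreal (sqrt (2 * pi)) * indicator (cball 0 r) x"])
    have "(\<integral>\<^sup>+x. ennreal (sqrt (2 * pi)) * indicator (cball 0 r) x \<partial>lborel_subspace (perp \<eta>))
        = ennreal (sqrt (2 * pi)) * emeasure (lborel_subspace (perp \<eta>)) (cball 0 r)"
      by (rule nn_integral_cmult_indicator) simp
    also have "\<dots> < \<infinity>"
      using emeasure_perp_cball_le [OF \<eta> \<open>0 \<le> r\<close>] by (auto simp: ennreal_mult_less_top intro: le_less_trans)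
    finally show "(\<integral>\<^sup>+x. ennreal (sqrt (2 * pi)) * indicator (cball 0 r) x \<partial>lborel_subspace (perp \<eta>)) < \<infinity>" .
    show "AE x in lborel_subspace (perp \<eta>). I k x \<le> ennreal (sqrt (2 * pi)) * indicator (cball 0 r) x" for k
      using AE_lborel_subspace_perp' [OF \<eta>]
    proof eventually_elim
      case (elim x)
      show ?case
        using gaussian_slab_inner_le [OF \<eta> \<psi> elim(1), where c = "1 / (real (Suc k) * norm \<eta>)"]
        by (simp add: I_def \<xi>_def)
    qed
    have "(\<lambda>x. ennreal (sqrt (2 * pi)) * indicator (cball 0 r) x) \<in> borel_measurable (borel :: 'a measure)"
      by (intro borel_measurable_times_ennreal borel_measurable_const borel_measurable_indicator) simp
    then show "(\<lambda>x. ennreal (sqrt (2 * pi)) * indicator (cball 0 r) x)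
        \<in> borel_measurable (lborel_subspace (perp \<eta>))"
      by (simp cong: measurable_cong_sets)
  qed (use I in \<open>simp_all cong: measurable_cong_sets\<close>)
  then have lim: "(\<lambda>k. ennreal (sqrt (2 * pi) / norm \<eta>) * (\<integral>\<^sup>+x. I k x \<partial>lborel_subspace (perp \<eta>)))
      \<longlonglongrightarrow> ennreal (sqrt (2 * pi) / norm \<eta>) * (\<integral>\<^sup>+x. ennreal (sqrt (2 * pi))
          * ennreal (\<psi> x) \<partial>lborel_subspace (perp \<eta>))"
    by (intro ennreal_tendsto_cmult) simp_all
  have "ennreal (sqrt (2 * pi) / norm \<eta>) * (\<integral>\<^sup>+x. ennreal (sqrt (2 * pi))
      * ennreal (\<psi> x) \<partial>lborel_subspace (perp \<eta>))
      = ennreal (2 * pi / norm \<eta>) * (\<integral>\<^sup>+x. ennreal (\<psi> x) \<partial>lborel_subspace (perp \<eta>))"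
    by (subst nn_integral_cmult) (simp_all add: ennreal_mult' [symmetric] mult.assoc [symmetric] cong:
        measurable_cong_sets)
  moreover have "(\<integral>\<^sup>+x. ennreal (\<psi> x * (sqrt (2 * pi) * real (Suc k)
      * gauss ((real (Suc k))\<^sup>2) (x \<bullet> \<eta>))) \<partial>lborel)
      = ennreal (sqrt (2 * pi) / norm \<eta>) * (\<integral>\<^sup>+x. I k x \<partial>lborel_subspace (perp \<eta>))" for k
    unfolding I_def \<xi>_def by (rule nn_integral_gaussian_slab [OF \<eta> _ _ \<psi>(1)]) auto
  ultimately show ?thesis
    using lim by simp
qed

lemma tendsto_ennreal_mult_const:
  fixes c :: ennreal
  assumes "g \<longlonglongrightarrow> 1" "\<And>k. 0 < g k"
  shows "(\<lambda>k. ennreal (g k) * c) \<longlonglongrightarrow> c"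
proof (cases "c = \<top>")
  case True
  then have "ennreal (g k) * c = c" for k
    using assms(2) [of k] by (simp add: ennreal_mult_top)
  then show ?thesis
    by simp
next
  case False
  then have "(\<lambda>k. c * ennreal (g k)) \<longlonglongrightarrow> c * ennreal 1"
    using assms(1) by (intro ennreal_tendsto_cmult tendsto_ennrealI) (auto simp: less_top)
  then show ?thesis
    by (simp add: mult.commute)
qed

lemma compact_indicator_approx:
  fixes K :: "'a::euclidean_space set"
  assumes "compact K" "K \<noteq> {}"
  obtains \<phi> :: "nat \<Rightarrow> 'a \<Rightarrow> real" and r where "0 \<le> r" "\<And>k. continuous_on UNIV (\<phi> k)"
    "\<And>k x. 0 \<le> \<phi> k x" "\<And>k x. \<phi> k x \<le> indicator (cball 0 r) x" "\<And>k x. indicator K x \<le> \<phi> k x"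
    "\<And>x. (\<lambda>k. \<phi> k x) \<longlonglongrightarrow> indicator K x"
proof -
  obtain b where b: "\<And>x. x \<in> K \<Longrightarrow> norm x \<le> b"
    using compact_imp_bounded [OF assms(1)] by (auto simp: bounded_iff)
  have closed: "closed K"
    using assms(1) by (rule compact_imp_closed)
  have "0 \<le> b"
    using assms(2) b order_trans [OF norm_ge_zero] by blast
  define \<phi> where "\<phi> k x = max 0 (1 - real (Suc k) * infdist x K)" for k x
  have "continuous_on UNIV (\<phi> k)" for k
    unfolding \<phi>_def by (intro continuous_intros)
  moreover have "\<phi> k x \<le> indicator (cball 0 (b + 1)) x" for k x
  proof (cases "norm x \<le> b + 1")
    case True
    then show ?thesis
      by (simp add: \<phi>_def infdist_nonneg)
  next
    case False
    obtain y where y: "y \<in> K" "infdist x K = dist x y"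
      using infdist_attains_inf [OF closed assms(2)] by blast
    have "norm x \<le> norm y + dist x y"
      using norm_triangle_ineq2 [of x y] by (simp add: dist_norm)
    then have "1 \<le> 1 * infdist x K"
      using False y(2) b [OF y(1)] by simp
    also have "\<dots> \<le> real (Suc k) * infdist x K"
      by (intro mult_right_mono) (auto simp: infdist_nonneg)
    finally show ?thesis
      by (simp add: \<phi>_def)
  qed
  moreover have "indicator K x \<le> \<phi> k x" for k x
    by (auto simp: \<phi>_def indicator_def)
  moreover have "(\<lambda>k. \<phi> k x) \<longlonglongrightarrow> indicator K x" for x
  proof (cases "x \<in> K")
    case True
    then show ?thesis
      by (simp add: \<phi>_def)
  next
    case False
    then have pos: "0 < infdist x K"
      using in_closed_iff_infdist_zero [OF closed assms(2)] infdist_nonneg [of x K] by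
          (simp add: order_less_le)
    obtain N :: nat where N: "1 / infdist x K < real N"
      using reals_Archimedean2 by blast
    have "\<phi> k x = 0" if "N \<le> k" for k
    proof -
      have "1 / infdist x K \<le> real (Suc k)"
        using N that by simp
      then have "1 \<le> real (Suc k) * infdist x K"
        using pos by (simp add: pos_divide_le_eq)
      then show ?thesis
        by (simp add: \<phi>_def)
    qed
    then have "\<forall>\<^sub>F k in sequentially. \<phi> k x = 0"
      by (auto simp: eventually_sequentially)
    then show ?thesis
      using False by (simp add: tendsto_eventually)
  qed
  ultimately show ?thesis
    using that [of "b + 1" \<phi>] \<open>0 \<le> b\<close> by (simp add: \<phi>_def)
qed

context positive_definite_kernel
begin

definition line_transform :: "real \<Rightarrow> 'a \<Rightarrow> ennreal" where
  "line_transform s x =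
    (\<integral>\<^sup>+t. \<integral>\<^sup>+y. ennreal (f y * gauss 1 y * gauss (1 / s\<^sup>2) (y + t *\<^sub>R x)) \<partial>lborel \<partial>(lborel :: real measure))"

lemma borel_measurable_line_transform [measurable]: "line_transform s \<in> borel_measurable borel"
  unfolding line_transform_def [abs_def] by measurable

lemma slab_bound_finite:
  assumes "0 < s"
  shows "(\<integral>\<^sup>+\<eta>. ennreal (gauss (s\<^sup>2) \<eta> * F \<eta>) * (ennreal (2 * pi / norm \<eta>) * ennreal c) \<partial>lborel) < \<infinity>"
proof -
  define F0 where "F0 = (LINT y|lborel. f y * gauss 1 y)"
  have F0: "0 \<le> F0"
    unfolding F0_def by simp
  have "ennreal (gauss (s\<^sup>2) \<eta> * F \<eta>) * (ennreal (2 * pi / norm \<eta>) * ennreal c)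
      \<le> ennreal (2 * pi * F0) * ennreal c * ennreal (gauss (s\<^sup>2) \<eta> / norm \<eta>)" for \<eta>
  proof -
    have "gauss (s\<^sup>2) \<eta> * F \<eta> * (2 * pi / norm \<eta>) \<le> gauss (s\<^sup>2) \<eta> * F0 * (2 * pi / norm \<eta>)"
      using F_le [of \<eta>] by (intro mult_right_mono mult_left_mono) (auto simp: F0_def)
    then have "ennreal (gauss (s\<^sup>2) \<eta> * F \<eta> * (2 * pi / norm \<eta>)) * ennreal c
        \<le> ennreal (gauss (s\<^sup>2) \<eta> * F0 * (2 * pi / norm \<eta>)) * ennreal c"
      by (rule mult_right_mono [OF ennreal_leI]) simp
    moreover have "ennreal (gauss (s\<^sup>2) \<eta> * F \<eta>) * (ennreal (2 * pi / norm \<eta>) * ennreal c)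
        = ennreal (gauss (s\<^sup>2) \<eta> * F \<eta> * (2 * pi / norm \<eta>)) * ennreal c"
      by (simp only: mult.assoc [symmetric]) (subst ennreal_mult [symmetric], simp_all)
    moreover have "ennreal (2 * pi * F0) * ennreal c * ennreal (gauss (s\<^sup>2) \<eta> / norm \<eta>)
        = ennreal (2 * pi * F0 * (gauss (s\<^sup>2) \<eta> / norm \<eta>)) * ennreal c"
      using F0 by (subst ennreal_mult) (simp_all add: mult_ac)
    moreover have "2 * pi * F0 * (gauss (s\<^sup>2) \<eta> / norm \<eta>) = gauss (s\<^sup>2) \<eta> * F0 * (2 * pi / norm \<eta>)"
      by simp
    ultimately show ?thesis
      by (simp only:)
  qed
  then have "(\<integral>\<^sup>+\<eta>. ennreal (gauss (s\<^sup>2) \<eta> * F \<eta>) * (ennreal (2 * pi / norm \<eta>) * ennreal c) \<partial>lborel)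
      \<le> (\<integral>\<^sup>+\<eta>. ennreal (2 * pi * F0) * ennreal c * ennreal (gauss (s\<^sup>2) \<eta> / norm \<eta>) \<partial>(lborel :: 'a measure))"
    by (intro nn_integral_mono)
  also have "\<dots> = ennreal (2 * pi * F0) * ennreal c
      * (\<integral>\<^sup>+\<eta>. ennreal (gauss (s\<^sup>2) \<eta> / norm \<eta>) \<partial>(lborel :: 'a measure))"
    by (rule nn_integral_cmult) simp
  also have "\<dots> < \<infinity>"
    using nn_integral_gauss_div_norm [OF dim, of "s\<^sup>2"] assms by (simp add: ennreal_mult_less_top)
  finally show ?thesis .
qed

definition section_transform :: "('a \<Rightarrow> ennreal) \<Rightarrow> 'a \<Rightarrow> ennreal" where
  "section_transform \<psi> \<eta> = ennreal (2 * pi / norm \<eta>) * (\<integral>\<^sup>+x. \<psi> x \<partial>lborel_subspace (perp \<eta>))"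

lemma section_transform_continuous:
  fixes \<psi> :: "'a \<Rightarrow> real"
  assumes cont: "continuous_on UNIV \<psi>"
    and \<psi>: "\<And>x. 0 \<le> \<psi> x" "\<And>x. \<psi> x \<le> indicator (cball 0 r) x" and "0 \<le> r"
  shows "section_transform (\<lambda>x. ennreal (\<psi> x)) \<in> borel_measurable borel"
    and "0 < s \<Longrightarrow> (\<integral>\<^sup>+\<eta>. ennreal (gauss (s\<^sup>2) \<eta> * F \<eta>) * section_transform (\<lambda>x. ennreal (\<psi> x)) \<eta> \<partial>lborel)
      = ennreal ((sqrt (2 * pi) / s) ^ DIM('a)) * (\<integral>\<^sup>+x. ennreal (\<psi> x) * line_transform s x \<partial>lborel)"
proof -
  have [measurable]: "\<psi> \<in> borel_measurable borel"
    using cont by (rule borel_measurable_continuous_onI)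
  have int: "integrable lborel \<psi>"
  proof (rule Bochner_Integration.integrable_bound)
    show "integrable lborel (indicator (cball 0 r) :: 'a \<Rightarrow> real)"
      using emeasure_bounded_finite [OF bounded_cball, of "0::'a" r] by (simp add: integrable_indicator_iff)
    show "AE x in lborel. norm (\<psi> x) \<le> norm (indicator (cball 0 r) x :: real)"
      using \<psi> by (intro AE_I2) (metis abs_of_nonneg indicator_pos_le real_norm_def)
  qed simp
  define u where "u k \<eta> = (if \<eta> = 0 then 0 else
      (\<integral>\<^sup>+x. ennreal (\<psi> x * (sqrt (2 * pi) * real (Suc k) * gauss ((real (Suc k))\<^sup>2) (x \<bullet> \<eta>))) \<partial>lborel))"
          for k \<eta>
  have u_meas [measurable]: "u k \<in> borel_measurable borel" for k
    unfolding u_def by measurable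
  have u_lim: "(\<lambda>k. u k \<eta>) \<longlonglongrightarrow> section_transform (\<lambda>x. ennreal (\<psi> x)) \<eta>" for \<eta>
    using gaussian_slab_tendsto [OF _ cont \<psi> \<open>0 \<le> r\<close>, of \<eta>]
    by (cases "\<eta> = 0") (auto simp: u_def section_transform_def)
  show [measurable]: "section_transform (\<lambda>x. ennreal (\<psi> x)) \<in> borel_measurable borel"
    using u_lim by (rule borel_measurable_LIMSEQ_order) simp
  assume s: "0 < s"
  have "(\<lambda>k. \<integral>\<^sup>+\<eta>. ennreal (gauss (s\<^sup>2) \<eta> * F \<eta>) * u k \<eta> \<partial>lborel)
      \<longlonglongrightarrow> (\<integral>\<^sup>+\<eta>. ennreal (gauss (s\<^sup>2) \<eta> * F \<eta>) * section_transform (\<lambda>x. ennreal (\<psi> x)) \<eta> \<partial>lborel)"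
  proof (rule nn_integral_dominated_convergence)
    show "(\<integral>\<^sup>+\<eta>. ennreal (gauss (s\<^sup>2) \<eta> * F \<eta>) * (ennreal (2 * pi / norm \<eta>)
        * ennreal ((2 * r) ^ (DIM('a) - 1))) \<partial>lborel) < \<infinity>"
      by (rule slab_bound_finite [OF s])
    show "AE \<eta> in lborel. ennreal (gauss (s\<^sup>2) \<eta> * F \<eta>) * u k \<eta> \<le>
        ennreal (gauss (s\<^sup>2) \<eta> * F \<eta>) * (ennreal (2 * pi / norm \<eta>) * ennreal ((2 * r) ^ (DIM('a) - 1)))" for k
    proof (intro AE_I2 mult_left_mono)
      fix \<eta>
      show "u k \<eta> \<le> ennreal (2 * pi / norm \<eta>) * ennreal ((2 * r) ^ (DIM('a) - 1))"
        using gaussian_slab_le [OF _ _ _ \<psi> \<open>0 \<le> r\<close>, of \<eta> "real (Suc k)"] by (simp add: u_def)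
    qed simp
    show "AE \<eta> in lborel. (\<lambda>k. ennreal (gauss (s\<^sup>2) \<eta> * F \<eta>) * u k \<eta>)
        \<longlonglongrightarrow> ennreal (gauss (s\<^sup>2) \<eta> * F \<eta>) * section_transform (\<lambda>x. ennreal (\<psi> x)) \<eta>"
      using u_lim by (intro AE_I2 ennreal_tendsto_cmult) auto
  qed measurable
  moreover have "(\<integral>\<^sup>+\<eta>. ennreal (gauss (s\<^sup>2) \<eta> * F \<eta>) * u k \<eta> \<partial>lborel)
      = ennreal ((sqrt (2 * pi) / s) ^ DIM('a)) * (\<integral>\<^sup>+x. ennreal (\<psi> x) *
        (\<integral>\<^sup>+t. ennreal (gauss (1 / (real (Suc k))\<^sup>2) (t :: real))
            * (\<integral>\<^sup>+y. ennreal (f y * gauss 1 y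
            * gauss (1 / s\<^sup>2) (y + t *\<^sub>R x)) \<partial>lborel) \<partial>lborel) \<partial>lborel)" for k
  proof (subst nn_swap_integrals [symmetric])
    show "(\<integral>\<^sup>+\<eta>. ennreal (gauss (s\<^sup>2) \<eta> * F \<eta>) * u k \<eta> \<partial>lborel)
      = (\<integral>\<^sup>+\<eta>. ennreal (gauss (s\<^sup>2) \<eta> * F \<eta>)
          * (\<integral>\<^sup>+x. ennreal (\<psi> x * (sqrt (2 * pi) * real (Suc k)
          * gauss ((real (Suc k))\<^sup>2) (x \<bullet> \<eta>))) \<partial>lborel) \<partial>lborel)"
      by (rule nn_integral_cong_AE, rule eventually_mono [OF AE_lborel_singleton [of 0]]) (simp add: u_def)
  qed (use s int \<psi> in auto)
  moreover have "(\<lambda>k. \<integral>\<^sup>+x. ennreal (\<psi> x) *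
        (\<integral>\<^sup>+t. ennreal (gauss (1 / (real (Suc k))\<^sup>2) (t :: real))
            * (\<integral>\<^sup>+y. ennreal (f y * gauss 1 y * gauss (1 / s\<^sup>2) (y + t *\<^sub>R x)) \<partial>lborel) \<partial>lborel) \<partial>lborel)
      \<longlonglongrightarrow> (\<integral>\<^sup>+x. ennreal (\<psi> x) * line_transform s x \<partial>lborel)"
  proof -
    have mono: "gauss (1 / (real (Suc k))\<^sup>2) t \<le> gauss (1 / (real (Suc l))\<^sup>2) t" if "k
        \<le> l" for k l and t :: real
      using that by (intro gauss_antimono frac_le power_mono) auto
    have lim: "(\<lambda>k. gauss (1 / (real (Suc k))\<^sup>2) t) \<longlonglongrightarrow> 1" for t :: real
    proof -
      have "(\<lambda>k. (1 / real (Suc k))\<^sup>2) \<longlonglongrightarrow> 0\<^sup>2"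
        by (intro tendsto_power lim_1_over_n [THEN LIMSEQ_Suc])
      then have "(\<lambda>k. exp (- ((1 / (real (Suc k)))\<^sup>2 * (norm t)\<^sup>2 / 2))) \<longlonglongrightarrow> exp (- (0 * (norm t)\<^sup>2 / 2))"
        by (intro tendsto_intros) simp_all
      then show ?thesis
        by (simp add: gauss_def power_divide)
    qed
    have inner: "(\<lambda>k. \<integral>\<^sup>+t. ennreal (gauss (1 / (real (Suc k))\<^sup>2) (t :: real))
        * (\<integral>\<^sup>+y. ennreal (f y * gauss 1 y * gauss (1 / s\<^sup>2) (y + t *\<^sub>R x)) \<partial>lborel) \<partial>lborel)
      \<longlonglongrightarrow> line_transform s x" for x
      unfolding line_transform_def
    proof (rule nn_integral_LIMSEQ)
      show "incseq (\<lambda>k t. ennreal (gauss (1 / (real (Suc k))\<^sup>2) (t :: real))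
          * (\<integral>\<^sup>+y. ennreal (f y * gauss 1 y * gauss (1 / s\<^sup>2) (y + t *\<^sub>R x)) \<partial>lborel))"
        using mono by (intro monoI le_funI mult_right_mono ennreal_leI) auto
      fix t :: real
      show "(\<lambda>k. ennreal (gauss (1 / (real (Suc k))\<^sup>2) t)
          * (\<integral>\<^sup>+y. ennreal (f y * gauss 1 y * gauss (1 / s\<^sup>2) (y + t *\<^sub>R x)) \<partial>lborel))
          \<longlonglongrightarrow> (\<integral>\<^sup>+y. ennreal (f y * gauss 1 y * gauss (1 / s\<^sup>2) (y + t *\<^sub>R x)) \<partial>lborel)"
        using lim by (intro tendsto_ennreal_mult_const) auto
    qed measurable
    show ?thesis
    proof (rule nn_integral_LIMSEQ)
      show "incseq (\<lambda>k x. ennreal (\<psi> x) * (\<integral>\<^sup>+t. ennreal (gauss (1 / (real (Suc k))\<^sup>2) (t :: real))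
          * (\<integral>\<^sup>+y. ennreal (f y * gauss 1 y * gauss (1 / s\<^sup>2) (y + t *\<^sub>R x)) \<partial>lborel) \<partial>lborel))"
        using mono by (intro monoI le_funI mult_left_mono nn_integral_mono mult_right_mono ennreal_leI) auto
      show "(\<lambda>k. ennreal (\<psi> x) * (\<integral>\<^sup>+t. ennreal (gauss (1 / (real (Suc k))\<^sup>2) (t :: real))
          * (\<integral>\<^sup>+y. ennreal (f y * gauss 1 y * gauss (1 / s\<^sup>2) (y + t *\<^sub>R x)) \<partial>lborel) \<partial>lborel))
        \<longlonglongrightarrow> ennreal (\<psi> x) * line_transform s x" for x
        using inner by (intro ennreal_tendsto_cmult) auto
    qed measurable
  qed
  then have "(\<lambda>k. ennreal ((sqrt (2 * pi) / s) ^ DIM('a)) * (\<integral>\<^sup>+x. ennreal (\<psi> x) *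
        (\<integral>\<^sup>+t. ennreal (gauss (1 / (real (Suc k))\<^sup>2) (t :: real))
            * (\<integral>\<^sup>+y. ennreal (f y * gauss 1 y * gauss (1 / s\<^sup>2) (y + t *\<^sub>R x)) \<partial>lborel) \<partial>lborel) \<partial>lborel))
      \<longlonglongrightarrow> ennreal ((sqrt (2 * pi) / s) ^ DIM('a)) * (\<integral>\<^sup>+x. ennreal (\<psi> x) * line_transform s x \<partial>lborel)"
    by (intro ennreal_tendsto_cmult) auto
  ultimately show "(\<integral>\<^sup>+\<eta>. ennreal (gauss (s\<^sup>2) \<eta> * F \<eta>) * section_transform (\<lambda>x. ennreal (\<psi> x)) \<eta> \<partial>lborel)
      = ennreal ((sqrt (2 * pi) / s) ^ DIM('a)) * (\<integral>\<^sup>+x. ennreal (\<psi> x) * line_transform s x \<partial>lborel)"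
    by (simp only:) (rule LIMSEQ_unique)
qed

lemma section_transform_compact:
  fixes K :: "'a set"
  assumes K: "compact K"
  shows "section_transform (indicator K) \<in> borel_measurable borel"
    and "0 < s \<Longrightarrow> (\<integral>\<^sup>+\<eta>. ennreal (gauss (s\<^sup>2) \<eta> * F \<eta>) * section_transform (indicator K) \<eta> \<partial>lborel)
      = ennreal ((sqrt (2 * pi) / s) ^ DIM('a)) * (\<integral>\<^sup>+x. indicator K x * line_transform s x \<partial>lborel)"
    and "0 < s \<Longrightarrow> (\<integral>\<^sup>+\<eta>. ennreal (gauss (s\<^sup>2) \<eta> * F \<eta>) * section_transform (indicator K) \<eta> \<partial>lborel) < \<infinity>"
proof -
  have K_meas [measurable]: "K \<in> sets borel"
    using K by (simp add: borel_compact)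
  have "section_transform (indicator K) \<in> borel_measurable borel \<and>
    (\<forall>s>0. (\<integral>\<^sup>+\<eta>. ennreal (gauss (s\<^sup>2) \<eta> * F \<eta>) * section_transform (indicator K) \<eta> \<partial>lborel)
      = ennreal ((sqrt (2 * pi) / s) ^ DIM('a)) * (\<integral>\<^sup>+x. indicator K x * line_transform s x \<partial>lborel)) \<and>
    (\<forall>s>0. (\<integral>\<^sup>+\<eta>. ennreal (gauss (s\<^sup>2) \<eta> * F \<eta>) * section_transform (indicator K) \<eta> \<partial>lborel) < \<infinity>)"
  proof (cases "K = {}")
    case True
    then have "section_transform (indicator K) = (\<lambda>_. 0)"
      by (simp add: section_transform_def fun_eq_iff)
    then show ?thesis
      using True by simp
  next
    case False
    obtain \<phi> :: "nat \<Rightarrow> 'a \<Rightarrow> real" and r where "0 \<le> r" and cont: "\<And>k. continuous_on UNIV (\<phi> k)"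
      and \<phi>: "\<And>k x. 0 \<le> \<phi> k x" "\<And>k x. \<phi> k x \<le> indicator (cball 0 r) x" "\<And>k x. indicator K x \<le> \<phi> k x"
        "\<And>x. (\<lambda>k. \<phi> k x) \<longlonglongrightarrow> indicator K x"
      using compact_indicator_approx [OF K False] by metis
    obtain \<zeta> :: "nat \<Rightarrow> 'a \<Rightarrow> real" and r' where "0 \<le> r'" and cont_\<zeta>: "\<And>k. continuous_on UNIV (\<zeta> k)"
      and \<zeta>: "\<And>k x. 0 \<le> \<zeta> k x" "\<And>k x. \<zeta> k x \<le> indicator (cball 0 r') x" 
        "\<And>k x. indicator (cball 0 r) x \<le> \<zeta> k x"
      using compact_indicator_approx [of "cball (0::'a) r"] \<open>0 \<le> r\<close>
      by (metis compact_cball cball_eq_empty not_less)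
    have [measurable]: "\<phi> k \<in> borel_measurable borel" "\<zeta> k \<in> borel_measurable borel" for k
      using cont cont_\<zeta> by (auto intro: borel_measurable_continuous_onI)
    have \<phi>_lim: "(\<lambda>k. ennreal (\<phi> k x)) \<longlonglongrightarrow> indicator K x" for x
      using tendsto_ennrealI [OF \<phi>(4) [of x]] by (simp add: ennreal_indicator)
    have \<phi>_le: "ennreal (\<phi> k x) \<le> indicator (cball 0 r) x" for k x
      using ennreal_leI [OF \<phi>(2) [of k x]] by (simp add: ennreal_indicator)
    note cts = section_transform_continuous [OF cont \<phi>(1,2) \<open>0 \<le> r\<close>]
    have [measurable]: "section_transform (\<lambda>x. ennreal (\<phi> k x)) \<in> borel_measurable borel" for k
      by (rule cts(1))
    have lim: "(\<lambda>k. section_transform (\<lambda>x. ennreal (\<phi> k x)) \<eta>) \<longlonglongrightarrow> section_transform (indicator K) \<eta>" for \<eta>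
    proof (cases "\<eta> = 0")
      case False
      show ?thesis
        unfolding section_transform_def
      proof (intro ennreal_tendsto_cmult nn_integral_dominated_convergence)
        show "(\<integral>\<^sup>+x. indicator (cball 0 r) x \<partial>lborel_subspace (perp \<eta>)) < \<infinity>"
          using emeasure_perp_cball_le [OF False \<open>0 \<le> r\<close>] by (auto intro: le_less_trans)
        show "AE x in lborel_subspace (perp \<eta>). ennreal (\<phi> k x) \<le> indicator (cball 0 r) x" for k
          using \<phi>_le by simp
        show "AE x in lborel_subspace (perp \<eta>). (\<lambda>k. ennreal (\<phi> k x)) \<longlonglongrightarrow> indicator K x"
          using \<phi>_lim by simp
        have "indicator (cball 0 r) \<in> borel_measurable (borel :: 'a measure)"
          by (rule borel_measurable_indicator) simp
        then show "indicator (cball 0 r) \<in> borel_measurable (lborel_subspace (perp \<eta>))"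
          by (simp cong: measurable_cong_sets)
      qed (simp_all cong: measurable_cong_sets)
    qed (simp add: section_transform_def)
    have section_le: "section_transform (\<lambda>x. ennreal (\<phi> k x)) \<eta>
        \<le> ennreal (2 * pi / norm \<eta>) * ennreal ((2 * r) ^ (DIM('a) - 1))" for k \<eta>
    proof (cases "\<eta> = 0")
      case False
      have "(\<integral>\<^sup>+x. ennreal (\<phi> k x) \<partial>lborel_subspace (perp \<eta>))
          \<le> (\<integral>\<^sup>+x. indicator (cball 0 r) x \<partial>lborel_subspace (perp \<eta>))"
        using \<phi>_le by (rule nn_integral_mono)
      also have "\<dots> \<le> ennreal ((2 * r) ^ (DIM('a) - 1))"
        using emeasure_perp_cball_le [OF False \<open>0 \<le> r\<close>] by simp
      finally show ?thesis
        unfolding section_transform_def by (rule mult_left_mono) simp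
    qed (simp add: section_transform_def)
    have meas: "section_transform (indicator K) \<in> borel_measurable borel"
      using lim by (rule borel_measurable_LIMSEQ_order) simp
    note meas [measurable]
    have eq: "(\<integral>\<^sup>+\<eta>. ennreal (gauss (s\<^sup>2) \<eta> * F \<eta>) * section_transform (indicator K) \<eta> \<partial>lborel)
        = ennreal ((sqrt (2 * pi) / s) ^ DIM('a)) * (\<integral>\<^sup>+x. indicator K x * line_transform s x \<partial>lborel)"
            (is ?eq)
      and fin: "(\<integral>\<^sup>+\<eta>. ennreal (gauss (s\<^sup>2) \<eta> * F \<eta>) * section_transform (indicator K) \<eta> \<partial>lborel) < \<infinity>"
          (is ?fin)
      if s: "0 < s" for s
    proof -
      have l1: "(\<lambda>k. \<integral>\<^sup>+\<eta>. ennreal (gauss (s\<^sup>2) \<eta> * F \<eta>) * section_transform (\<lambda>x. ennreal (\<phi> k x)) \<eta> \<partial>lborel)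
        \<longlonglongrightarrow> (\<integral>\<^sup>+\<eta>. ennreal (gauss (s\<^sup>2) \<eta> * F \<eta>) * section_transform (indicator K) \<eta> \<partial>lborel)"
      proof (rule nn_integral_dominated_convergence)
        show "(\<integral>\<^sup>+\<eta>. ennreal (gauss (s\<^sup>2) \<eta> * F \<eta>) * (ennreal (2 * pi / norm \<eta>)
            * ennreal ((2 * r) ^ (DIM('a) - 1))) \<partial>lborel) < \<infinity>"
          by (rule slab_bound_finite [OF s])
        show "AE \<eta> in lborel. ennreal (gauss (s\<^sup>2) \<eta> * F \<eta>) * section_transform (\<lambda>x. ennreal (\<phi> k x)) \<eta> \<le>
            ennreal (gauss (s\<^sup>2) \<eta> * F \<eta>) * (ennreal (2 * pi / norm \<eta>)
                * ennreal ((2 * r) ^ (DIM('a) - 1)))" for k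
          using section_le by (intro AE_I2 mult_left_mono) auto
        show "AE \<eta> in lborel. (\<lambda>k. ennreal (gauss (s\<^sup>2) \<eta> * F \<eta>) * section_transform (\<lambda>x. ennreal (\<phi> k x)) \<eta>)
            \<longlonglongrightarrow> ennreal (gauss (s\<^sup>2) \<eta> * F \<eta>) * section_transform (indicator K) \<eta>"
          using lim by (intro AE_I2 ennreal_tendsto_cmult) auto
      qed measurable
      have fin_\<psi>: "(\<integral>\<^sup>+\<eta>. ennreal (gauss (s\<^sup>2) \<eta> * F \<eta>) * g \<eta> \<partial>lborel) < \<infinity>"
        if "\<And>\<eta>. g \<eta> \<le> ennreal (2 * pi / norm \<eta>) * ennreal c" for g :: "'a \<Rightarrow> ennreal" and c
      proof -
        have "(\<integral>\<^sup>+\<eta>. ennreal (gauss (s\<^sup>2) \<eta> * F \<eta>) * g \<eta> \<partial>lborel)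
          \<le> (\<integral>\<^sup>+\<eta>. ennreal (gauss (s\<^sup>2) \<eta> * F \<eta>) * (ennreal (2 * pi / norm \<eta>) * ennreal c) \<partial>lborel)"
          using that by (intro nn_integral_mono mult_left_mono) auto
        then show ?thesis
          using slab_bound_finite [OF s, of c] by (rule le_less_trans)
      qed
      have section_\<zeta>: "section_transform (\<lambda>x. ennreal (\<zeta> 0 x)) \<eta>
          \<le> ennreal (2 * pi / norm \<eta>) * ennreal ((2 * r') ^ (DIM('a) - 1))" for \<eta>
      proof (cases "\<eta> = 0")
        case False
        have "(\<integral>\<^sup>+x. ennreal (\<zeta> 0 x) \<partial>lborel_subspace (perp \<eta>))
            \<le> (\<integral>\<^sup>+x. indicator (cball 0 r') x \<partial>lborel_subspace (perp \<eta>))"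
          using ennreal_leI [OF \<zeta>(2)] by (intro nn_integral_mono) (simp add: ennreal_indicator)
        also have "\<dots> \<le> ennreal ((2 * r') ^ (DIM('a) - 1))"
          using emeasure_perp_cball_le [OF False \<open>0 \<le> r'\<close>] by simp
        finally show ?thesis
          unfolding section_transform_def by (rule mult_left_mono) simp
      qed (simp add: section_transform_def)
      have "ennreal ((sqrt (2 * pi) / s) ^ DIM('a)) * (\<integral>\<^sup>+x. ennreal (\<zeta> 0 x)
          * line_transform s x \<partial>lborel) < \<infinity>"
        using fin_\<psi> [OF section_\<zeta>] section_transform_continuous(2) [OF cont_\<zeta> \<zeta>(1,2) \<open>0 \<le> r'\<close> s]
        by simp
      then have fin_\<zeta>: "(\<integral>\<^sup>+x. ennreal (\<zeta> 0 x) * line_transform s x \<partial>lborel) < \<infinity>"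
        using s by (auto simp: ennreal_mult_less_top)
      have "(\<lambda>k. \<integral>\<^sup>+x. ennreal (\<phi> k x) * line_transform s x \<partial>lborel)
          \<longlonglongrightarrow> (\<integral>\<^sup>+x. indicator K x * line_transform s x \<partial>lborel)"
      proof (rule nn_integral_dominated_convergence [OF _ _ _ _ fin_\<zeta>])
        have "ennreal (\<phi> k x) \<le> ennreal (\<zeta> 0 x)" for k x
          using order_trans [OF \<phi>(2) \<zeta>(3)] by (rule ennreal_leI)
        then show "AE x in lborel. ennreal (\<phi> k x) * line_transform s x
            \<le> ennreal (\<zeta> 0 x) * line_transform s x" for k
          by (intro AE_I2 mult_right_mono) auto
        have ev: "(\<lambda>k. ennreal (\<phi> k x) * line_transform s x) \<longlonglongrightarrow> indicator K x * line_transform s x"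
          if "ennreal (\<zeta> 0 x) * line_transform s x \<noteq> \<infinity>" for x
        proof (cases "line_transform s x = \<infinity>")
          case True
          then have "\<zeta> 0 x \<le> 0"
            using that by (auto simp: ennreal_mult_top ennreal_eq_0_iff split: if_splits)
          then have *: "\<phi> k x = 0" for k
            using order_trans [OF \<phi>(2) \<zeta>(3), of k x 0] \<phi>(1) [of k x] by simp
          then show ?thesis
            using \<phi>(3) [of x 0] by (auto simp: indicator_def split: if_splits)
        next
          case False
          then show ?thesis
            using ennreal_tendsto_cmult [OF _ \<phi>_lim [of x], of "line_transform s x"]
            by (simp add: less_top mult.commute)
        qed
        have "AE x in lborel. ennreal (\<zeta> 0 x) * line_transform s x \<noteq> \<infinity>"
          using fin_\<zeta> by (intro nn_integral_noteq_infinite) auto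
        then show "AE x in lborel. (\<lambda>k. ennreal (\<phi> k x) * line_transform s x)
            \<longlonglongrightarrow> indicator K x * line_transform s x"
          by eventually_elim (rule ev)
      qed measurable
      then have l2: "(\<lambda>k. ennreal ((sqrt (2 * pi) / s) ^ DIM('a)) * (\<integral>\<^sup>+x. ennreal (\<phi> k x)
          * line_transform s x \<partial>lborel))
          \<longlonglongrightarrow> ennreal ((sqrt (2 * pi) / s) ^ DIM('a)) * (\<integral>\<^sup>+x. indicator K x * line_transform s x \<partial>lborel)"
        by (intro ennreal_tendsto_cmult) auto
      show ?eq
        using l1 l2 unfolding cts(2) [OF s] by (rule LIMSEQ_unique)
      show ?fin
      proof (rule fin_\<psi>)
        show "section_transform (indicator K) \<eta>
            \<le> ennreal (2 * pi / norm \<eta>) * ennreal ((2 * r) ^ (DIM('a) - 1))" for \<eta>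
          by (rule LIMSEQ_le_const2 [OF lim]) (use section_le in blast)
      qed
    qed
    show ?thesis
      using meas eq fin by blast
  qed
  then show "section_transform (indicator K) \<in> borel_measurable borel"
    "0 < s \<Longrightarrow> (\<integral>\<^sup>+\<eta>. ennreal (gauss (s\<^sup>2) \<eta> * F \<eta>) * section_transform (indicator K) \<eta> \<partial>lborel)
      = ennreal ((sqrt (2 * pi) / s) ^ DIM('a)) * (\<integral>\<^sup>+x. indicator K x * line_transform s x \<partial>lborel)"
    "0 < s \<Longrightarrow> (\<integral>\<^sup>+\<eta>. ennreal (gauss (s\<^sup>2) \<eta> * F \<eta>) * section_transform (indicator K) \<eta> \<partial>lborel) < \<infinity>"
    by blast+
qed

end

section \<open>Change of scale and limit\<close>

lemma one_minus_exp_le: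
  fixes \<rho> :: real
  assumes "0 \<le> \<rho>"
  shows "1 - exp (- (\<rho>\<^sup>2 / 2)) \<le> \<rho>"
proof (cases "\<rho> \<le> 1")
  case True
  have "1 - exp (- (\<rho>\<^sup>2 / 2)) \<le> \<rho>\<^sup>2 / 2"
    using exp_ge_add_one_self [of "- (\<rho>\<^sup>2 / 2)"] by linarith
  also have "\<rho>\<^sup>2 / 2 \<le> \<rho>"
    using assms True mult_left_mono [of \<rho> 1 \<rho>] by (simp add: power2_eq_square)
  finally show ?thesis .
next
  case False
  moreover have "1 - exp (- (\<rho>\<^sup>2 / 2)) \<le> 1"
    by simp
  ultimately show ?thesis
    by linarith
qed

lemma gauss_diff_le: "0 \<le> a \<Longrightarrow> gauss (a * u\<^sup>2) z - gauss (u\<^sup>2) z \<le> \<bar>u\<bar> * norm z"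
proof -
  assume "0 \<le> a"
  then have "gauss (a * u\<^sup>2) z \<le> 1"
    by (simp add: gauss_le_1)
  moreover have "gauss (u\<^sup>2) z = exp (- ((\<bar>u\<bar> * norm z)\<^sup>2 / 2))"
    by (simp add: gauss_def power_mult_distrib)
  ultimately show ?thesis
    using one_minus_exp_le [of "\<bar>u\<bar> * norm z"] by simp
qed

text \<open>Only \<open>limsup\<close> is clear pointwise, because \<open>K\<close> is closed; the mass lost by translating \<open>K\<close>
  equals the mass gained, since both copies have the same volume.\<close>

lemma nn_integral_translate_compact_tendsto:
  fixes K :: "'a::euclidean_space set" and q :: "'a \<Rightarrow> real"
  assumes K: "compact K" and q [measurable]: "q \<in> borel_measurable borel"
    and q0: "\<And>z. 0 \<le> q z" and qQ: "\<And>z. q z \<le> Q" and h: "h \<longlonglongrightarrow> 0"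
  shows "(\<lambda>k. \<integral>\<^sup>+z. ennreal (q z) * indicator K (z + h k) \<partial>lborel)
      \<longlonglongrightarrow> (\<integral>\<^sup>+z. ennreal (q z) * indicator K z \<partial>lborel)"
proof -
  have [measurable]: "K \<in> sets borel"
    using K by (simp add: borel_compact)
  have Q: "0 \<le> Q"
    using order_trans [OF q0 qQ] .
  define e where "e k = (\<integral>\<^sup>+z. indicator K (z + h k) * indicator (- K) z \<partial>lborel)" for k
  define d where "d k = (\<integral>\<^sup>+z. indicator K z * indicator (- K) (z + h k) \<partial>lborel)" for k
  define c where "c k = (\<integral>\<^sup>+z. indicator K z * indicator K (z + h k) \<partial>lborel)" for k
  have vol: "emeasure lborel K < \<infinity>"
    using emeasure_bounded_finite [OF compact_imp_bounded [OF K]] by simp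
  have "e k + c k = (\<integral>\<^sup>+z. indicator K (h k + z) \<partial>lborel)" for k
    unfolding e_def c_def
    by (subst nn_integral_add [symmetric]) (auto intro!: nn_integral_cong simp: indicator_def add.commute)
  then have ec: "e k + c k = emeasure lborel K" for k
    using nn_integral_lborel_translate [of "indicator K" "h k"] by simp
  have "d k + c k = (\<integral>\<^sup>+z. indicator K z \<partial>lborel)" for k
    unfolding d_def c_def
    by (subst nn_integral_add [symmetric], simp, simp, intro nn_integral_cong) (simp add: indicator_def)
  then have dc: "d k + c k = emeasure lborel K" for k
    by simp
  have "c k \<noteq> \<infinity>" for k
    using ec [of k] vol by (metis ennreal_add_eq_top less_irrefl infinity_ennreal_def)
  then have ed: "d k = e k" for k
    using ec [of k] dc [of k] by (metis add.commute ennreal_add_left_cancel infinity_ennreal_def)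
  obtain b where b: "\<And>x. x \<in> K \<Longrightarrow> norm x \<le> b"
    using compact_imp_bounded [OF K] by (auto simp: bounded_iff)
  obtain H where H: "\<And>k. norm (h k) \<le> H"
    using convergent_imp_Bseq [OF convergentI [OF h]] by (auto simp: Bseq_def)
  have e0: "e \<longlonglongrightarrow> (\<integral>\<^sup>+z. 0 \<partial>(lborel :: 'a measure))"
    unfolding e_def
  proof (rule nn_integral_dominated_convergence [where w = "indicator (cball 0 (b + H))"])
    show "(\<integral>\<^sup>+z. indicator (cball 0 (b + H)) z \<partial>(lborel :: 'a measure)) < \<infinity>"
      using emeasure_bounded_finite [OF bounded_cball, of "0::'a" "b + H"] by simp
    have "z \<in> cball 0 (b + H)" if "z + h k \<in> K" for z k
      using b [OF that] H [of k] norm_triangle_ineq4 [of "z + h k" "h k"] by simp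
    then show "AE z in lborel. indicator K (z + h k) * indicator (- K) z
        \<le> (indicator (cball 0 (b + H)) z :: ennreal)" for k
      by (intro AE_I2) (auto simp: indicator_def)
    have "\<forall>\<^sub>F k in sequentially. indicator K (z + h k) * indicator (- K) z = (0 :: ennreal)" for z
    proof (cases "z \<in> K")
      case False
      have "(\<lambda>k. z + h k) \<longlonglongrightarrow> z + 0"
        using h by (intro tendsto_add tendsto_const)
      moreover have "open (- K)"
        using K by (simp add: compact_imp_closed open_Compl)
      ultimately have "\<forall>\<^sub>F k in sequentially. z + h k \<in> - K"
        using False by (intro topological_tendstoD) auto
      then show ?thesis
        by eventually_elim simp
    qed simp
    then show "AE z in lborel. (\<lambda>k. indicator K (z + h k) * indicator (- K) z) \<longlonglongrightarrow> (0 :: ennreal)"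
      by (intro AE_I2 tendsto_eventually)
    show "indicator (cball 0 (b + H)) \<in> borel_measurable (lborel :: 'a measure)"
      by (rule borel_measurable_indicator) simp
  qed auto
  define I where "I = (\<integral>\<^sup>+z. ennreal (q z) * indicator K z \<partial>lborel)"
  define J where "J k = (\<integral>\<^sup>+z. ennreal (q z) * indicator K (z + h k) \<partial>lborel)" for k
  have qQ': "ennreal (q z) \<le> ennreal Q" for z
    using qQ by (rule ennreal_leI)
  have JI: "J k \<le> I + ennreal Q * e k" for k
  proof -
    have "J k \<le> (\<integral>\<^sup>+z. ennreal (q z) * indicator K z + ennreal Q * (indicator K (z + h k)
        * indicator (- K) z) \<partial>lborel)"
      unfolding J_def using qQ' by (intro nn_integral_mono) (auto simp: indicator_def)
    also have "\<dots> = I + ennreal Q * e k"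
      unfolding I_def e_def by (simp add: nn_integral_add nn_integral_cmult)
    finally show ?thesis .
  qed
  have "I \<le> ennreal Q * emeasure lborel K"
    unfolding I_def using qQ'
    by (subst nn_integral_cmult_indicator [symmetric]) (auto intro!: nn_integral_mono mult_right_mono)
  also have "\<dots> < \<infinity>"
    using vol by (simp add: ennreal_mult_less_top)
  finally have I: "I \<noteq> \<infinity>"
    by simp
  have IJ: "I - ennreal Q * e k \<le> J k" for k
  proof -
    have "I \<le> (\<integral>\<^sup>+z. ennreal (q z) * indicator K (z + h k) + ennreal Q
        * (indicator K z * indicator (- K) (z + h k)) \<partial>lborel)"
      unfolding I_def using qQ' by (intro nn_integral_mono) (auto simp: indicator_def)
    also have "\<dots> = J k + ennreal Q * d k"
      unfolding J_def d_def by (simp add: nn_integral_add nn_integral_cmult)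
    finally show ?thesis
      using I unfolding ed by (simp add: ennreal_minus_le_iff add.commute)
  qed
  have Qe: "(\<lambda>k. ennreal Q * e k) \<longlonglongrightarrow> ennreal Q * 0"
    using e0 by (intro ennreal_tendsto_cmult) auto
  have "J \<longlonglongrightarrow> I"
  proof (rule tendsto_sandwich)
    show "(\<lambda>k. I - ennreal Q * e k) \<longlonglongrightarrow> I"
      using tendsto_diff_ennreal [OF tendsto_const Qe, of I] I by simp
    show "(\<lambda>k. I + ennreal Q * e k) \<longlonglongrightarrow> I"
      using tendsto_add [OF tendsto_const [of I] Qe] by simp
  qed (use IJ JI in auto)
  then show ?thesis
    by (simp add: I_def J_def [abs_def])
qed

context positive_definite_kernel
begin

definition gaussian_average :: "'a set \<Rightarrow> real \<Rightarrow> ('a \<Rightarrow> real) \<Rightarrow> real \<Rightarrow> 'a \<Rightarrow> ennreal" where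
  "gaussian_average K \<sigma> q u w = ennreal (gauss 1 w / \<bar>u\<bar>)
      * (\<integral>\<^sup>+z. ennreal (q z) * indicator K (z + (\<sigma> / \<bar>u\<bar>) *\<^sub>R w) \<partial>lborel)"

lemma line_transform_rescale:
  fixes K :: "'a set"
  assumes [measurable]: "K \<in> sets borel" and "0 < \<sigma>" "0 < b"
  shows "(\<integral>\<^sup>+x. indicator K x * line_transform (\<sigma> * b) x \<partial>lborel)
    = ennreal ((\<sigma> * b) ^ DIM('a)) *
      (\<integral>\<^sup>+u. \<integral>\<^sup>+w. gaussian_average K \<sigma> (\<lambda>z. f z * gauss (b\<^sup>2 * u\<^sup>2) z) u w \<partial>lborel \<partial>lborel)"
proof -
  define g where "g t x = (\<integral>\<^sup>+y. ennreal (f y * gauss 1 y * gauss (1 / (\<sigma> * b)\<^sup>2) (y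
      + t *\<^sub>R x)) \<partial>lborel)" for t x
  have [measurable]: "(\<lambda>(t, x). g t x) \<in> borel_measurable (borel \<Otimes>\<^sub>M borel)"
    unfolding g_def by measurable
  have "(\<integral>\<^sup>+x. indicator K x * line_transform (\<sigma> * b) x \<partial>lborel)
      = (\<integral>\<^sup>+x. \<integral>\<^sup>+t. indicator K x * g t x \<partial>lborel \<partial>lborel)"
    unfolding line_transform_def g_def by (simp add: nn_integral_cmult)
  also have "\<dots> = (\<integral>\<^sup>+t. \<integral>\<^sup>+x. indicator K x * g t x \<partial>lborel \<partial>lborel)"
    by (rule lborel_pair.Fubini') simp
  also have "\<dots> = ennreal \<bar>b\<bar> * (\<integral>\<^sup>+u. \<integral>\<^sup>+x. indicator K x * g (0 + b * u) x \<partial>lborel \<partial>lborel)"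
    using assms by (intro nn_integral_real_affine) auto
  also have "(\<integral>\<^sup>+u. \<integral>\<^sup>+x. indicator K x * g (0 + b * u) x \<partial>lborel \<partial>lborel)
    = (\<integral>\<^sup>+u. ennreal ((\<sigma> * b) ^ DIM('a) / b)
        * (\<integral>\<^sup>+w. gaussian_average K \<sigma> (\<lambda>z. f z * gauss (b\<^sup>2 * u\<^sup>2) z) u w \<partial>lborel) \<partial>lborel)"
  proof (rule nn_integral_cong_AE, rule eventually_mono [OF AE_lborel_singleton [of 0]])
    fix u :: real
    assume u: "u \<noteq> 0"
    have g: "g (b * u) x = ennreal ((b * \<bar>u\<bar>) ^ DIM('a) / (b * \<bar>u\<bar>)) *
      (\<integral>\<^sup>+z. ennreal (f z * gauss (b\<^sup>2 * u\<^sup>2) z) * ennreal (gauss (u\<^sup>2 / \<sigma>\<^sup>2) (x - z)) \<partial>lborel)" for x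
    proof -
      have "g (b * u) x = ennreal (\<bar>- (b * u)\<bar> ^ DIM('a)) *
        (\<integral>\<^sup>+z. ennreal (f (0 + (- (b * u)) *\<^sub>R z) * gauss 1 (0 + (- (b * u)) *\<^sub>R z)
            * gauss (1 / (\<sigma> * b)\<^sup>2) (0 + (- (b * u)) *\<^sub>R z + (b * u) *\<^sub>R x)) \<partial>lborel)"
        unfolding g_def using assms u by (intro nn_integral_lborel_affine) auto
      also have "\<dots> = ennreal (\<bar>- (b * u)\<bar> ^ DIM('a)) *
        (\<integral>\<^sup>+z. ennreal (1 / (b * \<bar>u\<bar>)) * (ennreal (f z * gauss (b\<^sup>2 * u\<^sup>2) z)
            * ennreal (gauss (u\<^sup>2 / \<sigma>\<^sup>2) (x - z))) \<partial>lborel)"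
      proof (intro arg_cong2 [where f = "(*)"] nn_integral_cong refl)
        fix z
        have 1: "f ((- (b * u)) *\<^sub>R z) = f z / (b * \<bar>u\<bar>)"
          using homogeneous [of "- (b * u)" z] assms u by (simp add: abs_mult)
        have "(- (b * u)) *\<^sub>R z + (b * u) *\<^sub>R x = (b * u) *\<^sub>R (x - z)"
          by (simp add: scaleR_diff_right)
        moreover have "1 / (\<sigma> * b)\<^sup>2 * (b * u)\<^sup>2 = u\<^sup>2 / \<sigma>\<^sup>2"
          using assms by (simp add: power_mult_distrib)
        ultimately have 2: "gauss (1 / (\<sigma> * b)\<^sup>2) ((- (b * u)) *\<^sub>R z + (b * u) *\<^sub>R x)
            = gauss (u\<^sup>2 / \<sigma>\<^sup>2) (x - z)"
          by (simp only: gauss_scaleR)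
        have 3: "gauss 1 ((- (b * u)) *\<^sub>R z) = gauss (b\<^sup>2 * u\<^sup>2) z"
          by (simp only: gauss_scaleR power2_minus power_mult_distrib mult_1)
        show "ennreal (f (0 + (- (b * u)) *\<^sub>R z) * gauss 1 (0 + (- (b * u)) *\<^sub>R z)
            * gauss (1 / (\<sigma> * b)\<^sup>2) (0 + (- (b * u)) *\<^sub>R z + (b * u) *\<^sub>R x))
          = ennreal (1 / (b * \<bar>u\<bar>)) * (ennreal (f z * gauss (b\<^sup>2 * u\<^sup>2) z)
              * ennreal (gauss (u\<^sup>2 / \<sigma>\<^sup>2) (x - z)))"
          unfolding add_0 1 2 3 using assms by (simp add: ennreal_mult [symmetric])
      qed
      also have "\<dots> = ennreal ((b * \<bar>u\<bar>) ^ DIM('a)) * (ennreal (1 / (b * \<bar>u\<bar>)) *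
        (\<integral>\<^sup>+z. ennreal (f z * gauss (b\<^sup>2 * u\<^sup>2) z) * ennreal (gauss (u\<^sup>2 / \<sigma>\<^sup>2) (x - z)) \<partial>lborel))"
        using assms by (subst nn_integral_cmult) (auto simp: abs_mult)
      finally show ?thesis
        using assms by (simp add: mult.assoc [symmetric] ennreal_mult [symmetric])
    qed
    have x: "(\<integral>\<^sup>+x. indicator K x * ennreal (gauss (u\<^sup>2 / \<sigma>\<^sup>2) (x - z)) \<partial>lborel)
      = ennreal ((\<sigma> / \<bar>u\<bar>) ^ DIM('a)) * (\<integral>\<^sup>+w. indicator K (z + (\<sigma> / \<bar>u\<bar>) *\<^sub>R w)
          * ennreal (gauss 1 w) \<partial>lborel)" for z
    proof -
      have "(\<integral>\<^sup>+x. indicator K x * ennreal (gauss (u\<^sup>2 / \<sigma>\<^sup>2) (x - z)) \<partial>lborel)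
        = ennreal (\<bar>\<sigma> / \<bar>u\<bar>\<bar> ^ DIM('a)) * (\<integral>\<^sup>+w. indicator K (z + (\<sigma> / \<bar>u\<bar>) *\<^sub>R w) *
          ennreal (gauss (u\<^sup>2 / \<sigma>\<^sup>2) (z + (\<sigma> / \<bar>u\<bar>) *\<^sub>R w - z)) \<partial>lborel)"
        using assms u by (intro nn_integral_lborel_affine) auto
      moreover have "gauss (u\<^sup>2 / \<sigma>\<^sup>2) (z + (\<sigma> / \<bar>u\<bar>) *\<^sub>R w - z) = gauss 1 w" for w :: 'a
        using assms u by (simp add: gauss_scaleR power_divide)
      ultimately show ?thesis
        using assms by simp
    qed
    have "(\<integral>\<^sup>+x. indicator K x * g (0 + b * u) x \<partial>lborel)
      = ennreal ((b * \<bar>u\<bar>) ^ DIM('a) / (b * \<bar>u\<bar>)) * (\<integral>\<^sup>+x. \<integral>\<^sup>+z. ennreal (f z * gauss (b\<^sup>2 * u\<^sup>2) z) *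
          (indicator K x * ennreal (gauss (u\<^sup>2 / \<sigma>\<^sup>2) (x - z))) \<partial>lborel \<partial>lborel)"
      unfolding add_0 g
      by (subst nn_integral_cmult [symmetric], measurable)
         (simp add: nn_integral_cmult [symmetric] mult_ac)
    also have "(\<integral>\<^sup>+x. \<integral>\<^sup>+z. ennreal (f z * gauss (b\<^sup>2 * u\<^sup>2) z) *
          (indicator K x * ennreal (gauss (u\<^sup>2 / \<sigma>\<^sup>2) (x - z))) \<partial>lborel \<partial>lborel)
      = (\<integral>\<^sup>+z. \<integral>\<^sup>+x. ennreal (f z * gauss (b\<^sup>2 * u\<^sup>2) z) *
          (indicator K x * ennreal (gauss (u\<^sup>2 / \<sigma>\<^sup>2) (x - z))) \<partial>lborel \<partial>lborel)"
      by (rule lborel_pair.Fubini') simp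
    also have "\<dots> = (\<integral>\<^sup>+z. ennreal ((\<sigma> / \<bar>u\<bar>) ^ DIM('a)) * (\<integral>\<^sup>+w. ennreal (f z * gauss (b\<^sup>2 * u\<^sup>2) z) *
          (indicator K (z + (\<sigma> / \<bar>u\<bar>) *\<^sub>R w) * ennreal (gauss 1 w)) \<partial>lborel) \<partial>lborel)"
    proof (rule nn_integral_cong)
      fix z
      show "(\<integral>\<^sup>+x. ennreal (f z * gauss (b\<^sup>2 * u\<^sup>2) z)
          * (indicator K x * ennreal (gauss (u\<^sup>2 / \<sigma>\<^sup>2) (x - z))) \<partial>lborel)
        = ennreal ((\<sigma> / \<bar>u\<bar>) ^ DIM('a)) * (\<integral>\<^sup>+w. ennreal (f z * gauss (b\<^sup>2 * u\<^sup>2) z) *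
          (indicator K (z + (\<sigma> / \<bar>u\<bar>) *\<^sub>R w) * ennreal (gauss 1 w)) \<partial>lborel)"
        by (subst nn_integral_cmult, measurable, subst nn_integral_cmult, measurable)
           (simp only: x mult.left_commute)
    qed
    also have "\<dots> = ennreal ((\<sigma> / \<bar>u\<bar>) ^ DIM('a)) * (\<integral>\<^sup>+z. \<integral>\<^sup>+w. ennreal (f z * gauss (b\<^sup>2 * u\<^sup>2) z) *
          (indicator K (z + (\<sigma> / \<bar>u\<bar>) *\<^sub>R w) * ennreal (gauss 1 w)) \<partial>lborel \<partial>lborel)"
      by (rule nn_integral_cmult) measurable
    also have "(\<integral>\<^sup>+z. \<integral>\<^sup>+w. ennreal (f z * gauss (b\<^sup>2 * u\<^sup>2) z) *
          (indicator K (z + (\<sigma> / \<bar>u\<bar>) *\<^sub>R w) * ennreal (gauss 1 w)) \<partial>lborel \<partial>lborel)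
      = (\<integral>\<^sup>+w. \<integral>\<^sup>+z. ennreal (f z * gauss (b\<^sup>2 * u\<^sup>2) z) *
          (indicator K (z + (\<sigma> / \<bar>u\<bar>) *\<^sub>R w) * ennreal (gauss 1 w)) \<partial>lborel \<partial>lborel)"
      by (rule lborel_pair.Fubini') measurable
    also have "\<dots> = (\<integral>\<^sup>+w. ennreal \<bar>u\<bar> * gaussian_average K \<sigma> (\<lambda>z. f z * gauss (b\<^sup>2 * u\<^sup>2) z) u w \<partial>lborel)"
    proof (rule nn_integral_cong)
      fix w :: 'a
      have "ennreal \<bar>u\<bar> * ennreal (gauss 1 w / \<bar>u\<bar>) = ennreal (gauss 1 w)"
        using u by (simp add: ennreal_mult [symmetric])
      then show "(\<integral>\<^sup>+z. ennreal (f z * gauss (b\<^sup>2 * u\<^sup>2) z) *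
          (indicator K (z + (\<sigma> / \<bar>u\<bar>) *\<^sub>R w) * ennreal (gauss 1 w)) \<partial>lborel)
        = ennreal \<bar>u\<bar> * gaussian_average K \<sigma> (\<lambda>z. f z * gauss (b\<^sup>2 * u\<^sup>2) z) u w"
        unfolding gaussian_average_def mult.assoc [symmetric]
        by (simp only: mult.commute [of "ennreal (gauss 1 w)"]) (subst nn_integral_multc [symmetric], auto)
    qed
    also have "\<dots> = ennreal \<bar>u\<bar> * (\<integral>\<^sup>+w. gaussian_average K \<sigma> (\<lambda>z. f z * gauss (b\<^sup>2 * u\<^sup>2) z) u w \<partial>lborel)"
      unfolding gaussian_average_def by (rule nn_integral_cmult) measurable
    finally have *: "(\<integral>\<^sup>+x. indicator K x * g (0 + b * u) x \<partial>lborel)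
      = ennreal ((b * \<bar>u\<bar>) ^ DIM('a) / (b * \<bar>u\<bar>)) * (ennreal ((\<sigma> / \<bar>u\<bar>) ^ DIM('a)) *
        (ennreal \<bar>u\<bar> * (\<integral>\<^sup>+w. gaussian_average K \<sigma> (\<lambda>z. f z * gauss (b\<^sup>2 * u\<^sup>2) z) u w \<partial>lborel)))" .
    have "(b * \<bar>u\<bar>) ^ DIM('a) / (b * \<bar>u\<bar>) * ((\<sigma> / \<bar>u\<bar>) ^ DIM('a) * \<bar>u\<bar>) = (\<sigma> * b) ^ DIM('a) / b"
      using u by (simp add: power_mult_distrib power_divide)
    then have "ennreal ((b * \<bar>u\<bar>) ^ DIM('a) / (b * \<bar>u\<bar>)) * (ennreal ((\<sigma> / \<bar>u\<bar>) ^ DIM('a)) * ennreal \<bar>u\<bar>)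
        = ennreal ((\<sigma> * b) ^ DIM('a) / b)"
      using assms by (simp add: ennreal_mult [symmetric])
    then show "(\<integral>\<^sup>+x. indicator K x * g (0 + b * u) x \<partial>lborel)
      = ennreal ((\<sigma> * b) ^ DIM('a) / b)
          * (\<integral>\<^sup>+w. gaussian_average K \<sigma> (\<lambda>z. f z * gauss (b\<^sup>2 * u\<^sup>2) z) u w \<partial>lborel)"
      unfolding * by (simp only: mult.assoc [symmetric])
  qed
  also have "\<dots> = ennreal ((\<sigma> * b) ^ DIM('a) / b)
      * (\<integral>\<^sup>+u. \<integral>\<^sup>+w. gaussian_average K \<sigma> (\<lambda>z. f z * gauss (b\<^sup>2 * u\<^sup>2) z) u w \<partial>lborel \<partial>lborel)"
    unfolding gaussian_average_def gauss_def by (rule nn_integral_cmult) measurable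
  finally show ?thesis
    using assms by (simp add: mult.assoc [symmetric] ennreal_mult [symmetric])
qed

end

definition frullani :: "real \<Rightarrow> ennreal" where
  "frullani a = (\<integral>\<^sup>+v. ennreal ((gauss (a\<^sup>2) v - gauss 1 v) / \<bar>v\<bar>) \<partial>(lborel :: real measure))"

lemma gauss_diff_nonneg:
  assumes "0 \<le> a" "a \<le> 1"
  shows "0 \<le> gauss (a\<^sup>2 * u\<^sup>2) z - gauss (u\<^sup>2) z"
proof -
  have "a\<^sup>2 * u\<^sup>2 \<le> 1 * u\<^sup>2"
    using assms by (intro mult_right_mono) (auto simp: power_le_one)
  then show ?thesis
    using gauss_antimono [of "a\<^sup>2 * u\<^sup>2" "u\<^sup>2" z] by simp
qed

lemma frullani_scale:
  assumes "z \<noteq> 0"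
  shows "(\<integral>\<^sup>+u. ennreal ((gauss (a\<^sup>2 * u\<^sup>2) z - gauss (u\<^sup>2) z) / \<bar>u\<bar>) \<partial>lborel) = frullani a"
proof -
  have "frullani a = ennreal \<bar>norm z\<bar>
      * (\<integral>\<^sup>+u. ennreal ((gauss (a\<^sup>2) (0 + norm z * u) - gauss 1 (0 + norm z * u)) / \<bar>0 + norm z
      * u\<bar>) \<partial>lborel)"
    unfolding frullani_def using assms by (intro nn_integral_real_affine) auto
  also have "\<dots> = (\<integral>\<^sup>+u. ennreal (norm z)
      * ennreal ((gauss (a\<^sup>2) (0 + norm z * u) - gauss 1 (0 + norm z * u)) / \<bar>0 + norm z * u\<bar>) \<partial>lborel)"
    by (subst nn_integral_cmult) auto
  also have "\<dots> = (\<integral>\<^sup>+u. ennreal ((gauss (a\<^sup>2 * u\<^sup>2) z - gauss (u\<^sup>2) z) / \<bar>u\<bar>) \<partial>lborel)"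
  proof (rule nn_integral_cong)
    fix u :: real
    have g: "gauss (a\<^sup>2) (norm z * u) = gauss (a\<^sup>2 * u\<^sup>2) z" "gauss 1 (norm z * u) = gauss (u\<^sup>2) z"
      by (simp_all add: gauss_def power_mult_distrib abs_mult mult_ac)
    show "ennreal (norm z) * ennreal ((gauss (a\<^sup>2) (0 + norm z * u) - gauss 1 (0 + norm z * u)) / \<bar>0
        + norm z * u\<bar>)
      = ennreal ((gauss (a\<^sup>2 * u\<^sup>2) z - gauss (u\<^sup>2) z) / \<bar>u\<bar>)"
      unfolding add_0 g using assms by (subst ennreal_mult' [symmetric]) (simp_all add: abs_mult)
  qed
  finally show ?thesis
    by simp
qed

lemma frullani_finite:
  assumes "0 < a" "a < 1"
  shows "frullani a < \<infinity>"
proof -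
  have "(gauss (a\<^sup>2) v - gauss 1 v) / \<bar>v\<bar> \<le> exp (a\<^sup>2 / 2) * gauss (a\<^sup>2) v" for v :: real
  proof (cases "\<bar>v\<bar> \<le> 1")
    case True
    have "(gauss (a\<^sup>2) v - gauss 1 v) / \<bar>v\<bar> \<le> 1"
    proof (cases "v = 0")
      case False
      have "gauss (a\<^sup>2) v - gauss 1 v \<le> \<bar>v\<bar>"
        using gauss_diff_le [of "a\<^sup>2" 1 v] by simp
      then show ?thesis
        using False by simp
    qed simp
    also have "1 \<le> exp (a\<^sup>2 / 2) * gauss (a\<^sup>2) v"
    proof -
      have "v\<^sup>2 \<le> 1"
        using True by (simp add: abs_square_le_1)
      then have "a\<^sup>2 * v\<^sup>2 \<le> a\<^sup>2"
        using mult_left_mono [of "v\<^sup>2" 1 "a\<^sup>2"] by simp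
      then show ?thesis
        by (simp add: gauss_def exp_add [symmetric])
    qed
    finally show ?thesis .
  next
    case False
    have "(gauss (a\<^sup>2) v - gauss 1 v) / \<bar>v\<bar> \<le> gauss (a\<^sup>2) v / 1"
      using False by (intro frac_le) (auto simp: less_imp_le [OF gauss_pos])
    also have "\<dots> \<le> exp (a\<^sup>2 / 2) * gauss (a\<^sup>2) v"
      using mult_right_mono [of 1 "exp (a\<^sup>2 / 2)" "gauss (a\<^sup>2) v"] by simp
    finally show ?thesis .
  qed
  then have "frullani a \<le> (\<integral>\<^sup>+v. ennreal (exp (a\<^sup>2 / 2)) * ennreal (gauss (a\<^sup>2) (v :: real)) \<partial>lborel)"
    unfolding frullani_def by (intro nn_integral_mono) (simp add: ennreal_mult [symmetric] ennreal_leI)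
  also have "\<dots> < \<infinity>"
    using assms by (simp add: nn_integral_cmult nn_integral_gauss ennreal_mult_less_top)
  finally show ?thesis .
qed

lemma frullani_pos:
  assumes "0 < a" "a < 1"
  shows "frullani a \<noteq> 0"
proof
  assume "frullani a = 0"
  then have "AE v in (lborel :: real measure). ennreal ((gauss (a\<^sup>2) v - gauss 1 v) / \<bar>v\<bar>) = 0"
    unfolding frullani_def by (subst (asm) nn_integral_0_iff_AE) auto
  moreover have "ennreal ((gauss (a\<^sup>2) v - gauss 1 v) / \<bar>v\<bar>) \<noteq> 0" if "v \<noteq> 0" for v :: real
  proof -
    have "a\<^sup>2 * v\<^sup>2 < 1 * v\<^sup>2"
      using assms that by (intro mult_strict_right_mono) (auto simp: power_less_one_iff)
    then show ?thesis
      using that by (simp add: gauss_def ennreal_eq_0_iff not_le)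
  qed
  ultimately have "AE v in (lborel :: real measure). v = 0"
    by (auto elim: eventually_mono)
  then have "AE v in (lborel :: real measure). False"
    using AE_lborel_singleton [of "0 :: real"] by eventually_elim simp
  then have "emeasure lborel (UNIV :: real set) = 0"
    using AE_iff_measurable [of UNIV "lborel :: real measure" "\<lambda>_. False"] by simp
  then show False
    by simp
qed

context positive_definite_kernel
begin

definition diff_kernel :: "real \<Rightarrow> real \<Rightarrow> 'a \<Rightarrow> real" where
  "diff_kernel a u z = f z * (gauss (a\<^sup>2 * u\<^sup>2) z - gauss (u\<^sup>2) z)"

definition smoothed_integral :: "real \<Rightarrow> 'a set \<Rightarrow> real \<Rightarrow> ennreal" where
  "smoothed_integral a K \<sigma> = (\<integral>\<^sup>+u. \<integral>\<^sup>+w. gaussian_average K \<sigma> (diff_kernel a u) u w \<partial>lborel \<partial>lborel)"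

lemma diff_kernel_nonneg: "0 \<le> a \<Longrightarrow> a \<le> 1 \<Longrightarrow> 0 \<le> diff_kernel a u z"
  using gauss_diff_nonneg [of a u z] by (simp add: diff_kernel_def)

lemma diff_kernel_le: "diff_kernel a u z \<le> R * \<bar>u\<bar>"
proof (cases "z = 0")
  case False
  have "diff_kernel a u z \<le> f z * (\<bar>u\<bar> * norm z)"
    unfolding diff_kernel_def using gauss_diff_le [of "a\<^sup>2" u z] by (intro mult_left_mono) auto
  also have "\<dots> \<le> R / norm z * (\<bar>u\<bar> * norm z)"
    using bound by (intro mult_right_mono) auto
  finally show ?thesis
    using False by simp
qed (use R in \<open>simp add: diff_kernel_def gauss_def\<close>)

lemma borel_measurable_diff_kernel [measurable]:
  "(\<lambda>(u, z). diff_kernel a u z) \<in> borel_measurable (borel \<Otimes>\<^sub>M borel)"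
  "diff_kernel a u \<in> borel_measurable borel"
  unfolding diff_kernel_def [abs_def] gauss_def by measurable

lemma borel_measurable_gaussian_average [measurable]:
  assumes [measurable]: "K \<in> sets borel" "(\<lambda>(u, z). q u z) \<in> borel_measurable (borel \<Otimes>\<^sub>M borel)"
  shows "(\<lambda>(u, w). gaussian_average K \<sigma> (q u) u w) \<in> borel_measurable (borel \<Otimes>\<^sub>M borel)"
    "gaussian_average K \<sigma> (q u) u \<in> borel_measurable borel"
proof -
  have [measurable]: "q u \<in> borel_measurable borel" for u
    using assms(2) by measurable
  show "(\<lambda>(u, w). gaussian_average K \<sigma> (q u) u w) \<in> borel_measurable (borel \<Otimes>\<^sub>M borel)"
    "gaussian_average K \<sigma> (q u) u \<in> borel_measurable borel"
    unfolding gaussian_average_def [abs_def] by measurable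
qed

lemma smoothed_integral_add:
  assumes [measurable]: "K \<in> sets borel" and "0 < a" "a < 1"
  shows "(\<integral>\<^sup>+u. \<integral>\<^sup>+w. gaussian_average K \<sigma> (\<lambda>z. f z * gauss (a\<^sup>2 * u\<^sup>2) z) u w \<partial>lborel \<partial>lborel)
    = smoothed_integral a K \<sigma> + (\<integral>\<^sup>+u. \<integral>\<^sup>+w. gaussian_average K \<sigma> (\<lambda>z. f z
        * gauss (1\<^sup>2 * u\<^sup>2) z) u w \<partial>lborel \<partial>lborel)"
proof -
  have m [measurable]: "(\<lambda>(u, z). f z * gauss (c * u\<^sup>2) z) \<in> borel_measurable (borel \<Otimes>\<^sub>M borel)" for c
    unfolding gauss_def by measurable
  have eq: "gaussian_average K \<sigma> (\<lambda>z. f z * gauss (a\<^sup>2 * u\<^sup>2) z) u w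
    = gaussian_average K \<sigma> (diff_kernel a u) u w + gaussian_average K \<sigma> (\<lambda>z. f z
        * gauss (1\<^sup>2 * u\<^sup>2) z) u w" for u w
  proof -
    have "ennreal (f z * gauss (a\<^sup>2 * u\<^sup>2) z)
        = ennreal (diff_kernel a u z) + ennreal (f z * gauss (1\<^sup>2 * u\<^sup>2) z)" for z
      using assms diff_kernel_nonneg [of a u z]
      by (subst ennreal_plus [symmetric]) (auto simp: diff_kernel_def algebra_simps)
    then show ?thesis
      unfolding gaussian_average_def distrib_left [symmetric]
      by (subst nn_integral_add [symmetric]) (auto simp: distrib_right)
  qed
  show ?thesis
    unfolding eq smoothed_integral_def by (subst nn_integral_add, measurable, rule nn_integral_add) measurable
qed

lemma smoothed_integral_mono:
  assumes K: "compact K" and L: "compact L" and a: "0 < a" "a < 1" and \<sigma>: "0 < \<sigma>"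
    and le: "\<And>\<eta>. section_transform (indicator K) \<eta> \<le> section_transform (indicator L) \<eta>"
  shows "smoothed_integral a K \<sigma> \<le> smoothed_integral a L \<sigma>"
proof -
  define c where "c = sqrt (2 * pi) ^ DIM('a)"
  have c: "0 < c"
    by (simp add: c_def)
  define X where "X A = (\<integral>\<^sup>+\<eta>. ennreal ((gauss ((\<sigma> * a)\<^sup>2) \<eta> - gauss (\<sigma>\<^sup>2) \<eta>) * F \<eta>)
      * section_transform (indicator A) \<eta> \<partial>lborel)" for A
  have nonneg: "0 \<le> gauss ((\<sigma> * a)\<^sup>2) \<eta> - gauss (\<sigma>\<^sup>2) \<eta>" for \<eta> :: 'a
    using gauss_diff_nonneg [of a \<sigma> \<eta>] a by (simp add: power_mult_distrib mult.commute)
  have X: "X A = ennreal c * smoothed_integral a A \<sigma>" if A: "compact A" for A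
  proof -
    have [measurable]: "A \<in> sets borel"
      using A by (simp add: borel_compact)
    note [measurable] = section_transform_compact(1) [OF A]
    define Y where "Y s = (\<integral>\<^sup>+\<eta>. ennreal (gauss (s\<^sup>2) \<eta> * F \<eta>)
        * section_transform (indicator A) \<eta> \<partial>lborel)" for s
    have Y: "Y (\<sigma> * b) = ennreal c * (\<integral>\<^sup>+u. \<integral>\<^sup>+w. gaussian_average A \<sigma> (\<lambda>z. f z
        * gauss (b\<^sup>2 * u\<^sup>2) z) u w \<partial>lborel \<partial>lborel)"
      if b: "0 < b" for b
    proof -
      have "(sqrt (2 * pi) / (\<sigma> * b)) ^ DIM('a) * (\<sigma> * b) ^ DIM('a) = c"
        using b \<sigma> by (simp add: c_def power_divide)
      then have cc: "ennreal ((sqrt (2 * pi) / (\<sigma> * b)) ^ DIM('a)) * ennreal ((\<sigma> * b) ^ DIM('a)) = ennreal c"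
        using b \<sigma> by (simp add: ennreal_mult [symmetric])
      show ?thesis
        unfolding Y_def using b \<sigma>
        by (subst section_transform_compact(2) [OF A], simp, subst line_transform_rescale)
           (simp_all add: cc mult.assoc [symmetric])
    qed
    have "X A + Y \<sigma> = Y (\<sigma> * a)"
    proof -
      have "ennreal ((gauss ((\<sigma> * a)\<^sup>2) \<eta> - gauss (\<sigma>\<^sup>2) \<eta>) * F \<eta>) + ennreal (gauss (\<sigma>\<^sup>2) \<eta> * F \<eta>)
        = ennreal (gauss ((\<sigma> * a)\<^sup>2) \<eta> * F \<eta>)" for \<eta>
        using mult_nonneg_nonneg [OF nonneg F_nonneg, of \<eta> \<eta>]
        by (subst ennreal_plus [symmetric]) (auto simp: algebra_simps)
      then show ?thesis
        unfolding X_def Y_def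
        by (subst nn_integral_add [symmetric]) (simp_all add: distrib_right [symmetric])
    qed
    also have "Y (\<sigma> * a) = ennreal c * smoothed_integral a A \<sigma> + Y (\<sigma> * 1)"
      using a by (simp only: Y smoothed_integral_add [OF \<open>A \<in> sets borel\<close> a] distrib_left zero_less_one)
    finally have "Y \<sigma> + X A = Y \<sigma> + ennreal c * smoothed_integral a A \<sigma>"
      by (simp add: add.commute)
    moreover have "Y \<sigma> \<noteq> \<infinity>"
      using section_transform_compact(3) [OF A \<sigma>] by (simp add: Y_def)
    ultimately show ?thesis
      by (simp add: ennreal_add_left_cancel)
  qed
  have "X K \<le> X L"
    unfolding X_def using le by (intro nn_integral_mono mult_left_mono) auto
  then have "ennreal (1 / c) * (ennreal c * smoothed_integral a K \<sigma>)
      \<le> ennreal (1 / c) * (ennreal c * smoothed_integral a L \<sigma>)"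
    unfolding X [OF K] X [OF L] by (rule mult_left_mono) simp
  then show ?thesis
    using c by (simp add: mult.assoc [symmetric] ennreal_mult [symmetric])
qed

lemma nn_integral_f_gauss_rescale_le:
  assumes "1 \<le> \<bar>u\<bar>"
  shows "ennreal \<bar>u\<bar> * (\<integral>\<^sup>+z. ennreal (f z * gauss (c * u\<^sup>2) z) \<partial>lborel)
      \<le> (\<integral>\<^sup>+z. ennreal (f z * gauss c z) \<partial>lborel)"
proof -
  have u: "u \<noteq> 0"
    using assms by auto
  have "(\<integral>\<^sup>+z. ennreal (f z * gauss c z) \<partial>lborel)
      = ennreal (\<bar>u\<bar> ^ DIM('a)) * (\<integral>\<^sup>+z. ennreal (f (0 + u *\<^sub>R z) * gauss c (0 + u *\<^sub>R z)) \<partial>lborel)"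
    using u by (intro nn_integral_lborel_affine) auto
  also have "\<dots> = ennreal (\<bar>u\<bar> ^ DIM('a)) * (\<integral>\<^sup>+z. ennreal (1 / \<bar>u\<bar>)
      * ennreal (f z * gauss (c * u\<^sup>2) z) \<partial>lborel)"
    using u by (simp add: homogeneous gauss_scaleR ennreal_mult [symmetric])
  also have "\<dots> = ennreal (\<bar>u\<bar> ^ DIM('a))
      * (ennreal (1 / \<bar>u\<bar>) * (\<integral>\<^sup>+z. ennreal (f z * gauss (c * u\<^sup>2) z) \<partial>lborel))"
    by (subst nn_integral_cmult) auto
  also have "\<dots> = ennreal (\<bar>u\<bar> ^ DIM('a) / \<bar>u\<bar>) * (\<integral>\<^sup>+z. ennreal (f z * gauss (c * u\<^sup>2) z) \<partial>lborel)"
    by (simp add: mult.assoc [symmetric] ennreal_mult [symmetric])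
  also have "\<dots> \<ge> ennreal \<bar>u\<bar> * (\<integral>\<^sup>+z. ennreal (f z * gauss (c * u\<^sup>2) z) \<partial>lborel)"
  proof (intro mult_right_mono ennreal_leI)
    have "\<bar>u\<bar> ^ 2 \<le> \<bar>u\<bar> ^ DIM('a)"
      using dim assms by (intro power_increasing) auto
    then show "\<bar>u\<bar> \<le> \<bar>u\<bar> ^ DIM('a) / \<bar>u\<bar>"
      using u by (simp add: pos_le_divide_eq power2_eq_square)
  qed simp
  finally show ?thesis .
qed

lemma gaussian_average_le:
  assumes K: "compact K" and a: "0 < a" "a < 1"
  obtains c where "0 \<le> c" "\<And>\<sigma> u w. gaussian_average K \<sigma> (diff_kernel a u) u w
      \<le> ennreal (c * (1 / (1 + u\<^sup>2))) * ennreal (gauss 1 w)"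
proof -
  have [measurable]: "K \<in> sets borel"
    using K by (simp add: borel_compact)
  have "emeasure lborel K < \<infinity>"
    using emeasure_bounded_finite [OF compact_imp_bounded [OF K]] by simp
  then obtain V where V: "0 \<le> V" "emeasure lborel K = ennreal V"
    by (cases "emeasure lborel K") auto
  have "(\<integral>\<^sup>+z. ennreal (f z * gauss (a\<^sup>2) z) \<partial>lborel) < \<infinity>"
    using a by (intro nn_integral_f_gauss_finite) simp
  then obtain A where A: "0 \<le> A" "(\<integral>\<^sup>+z. ennreal (f z * gauss (a\<^sup>2) z) \<partial>lborel) = ennreal A"
    by (cases "\<integral>\<^sup>+z. ennreal (f z * gauss (a\<^sup>2) z) \<partial>lborel") auto
  define c where "c = 2 * (R * V + A)"
  have "0 \<le> c"
    using V A R by (simp add: c_def)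
  moreover have "gaussian_average K \<sigma> (diff_kernel a u) u w
      \<le> ennreal (c * (1 / (1 + u\<^sup>2))) * ennreal (gauss 1 w)" for \<sigma> u w
  proof (cases "u = 0")
    case u: False
    define I where "I = (\<integral>\<^sup>+z. ennreal (diff_kernel a u z) * indicator K (z + (\<sigma> / \<bar>u\<bar>) *\<^sub>R w) \<partial>lborel)"
    have I1: "I \<le> ennreal (R * \<bar>u\<bar> * V)"
    proof -
      have "I \<le> (\<integral>\<^sup>+z. ennreal (R * \<bar>u\<bar>) * indicator K (z + (\<sigma> / \<bar>u\<bar>) *\<^sub>R w) \<partial>lborel)"
        unfolding I_def using diff_kernel_le by (intro nn_integral_mono mult_right_mono ennreal_leI) auto
      also have "\<dots> = ennreal (R * \<bar>u\<bar>) * (\<integral>\<^sup>+z. indicator K ((\<sigma> / \<bar>u\<bar>) *\<^sub>R w + z) \<partial>lborel)"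
        by (subst nn_integral_cmult) (auto simp: add.commute)
      also have "(\<integral>\<^sup>+z. indicator K ((\<sigma> / \<bar>u\<bar>) *\<^sub>R w + z) \<partial>lborel) = ennreal V"
        using nn_integral_lborel_translate [of "indicator K" "(\<sigma> / \<bar>u\<bar>) *\<^sub>R w"] V by simp
      finally show ?thesis
        using R V by (simp add: ennreal_mult [symmetric])
    qed
    have I2: "ennreal \<bar>u\<bar> * I \<le> ennreal A" if "1 \<le> \<bar>u\<bar>"
    proof -
      have "diff_kernel a u z \<le> f z * gauss (a\<^sup>2 * u\<^sup>2) z" for z
        unfolding diff_kernel_def by (intro mult_left_mono) (auto simp: less_imp_le [OF gauss_pos])
      then have "I \<le> (\<integral>\<^sup>+z. ennreal (f z * gauss (a\<^sup>2 * u\<^sup>2) z) \<partial>lborel)"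
        unfolding I_def by (intro nn_integral_mono) (auto simp: indicator_def intro: ennreal_leI)
      then have "ennreal \<bar>u\<bar> * I \<le> ennreal \<bar>u\<bar> * (\<integral>\<^sup>+z. ennreal (f z * gauss (a\<^sup>2 * u\<^sup>2) z) \<partial>lborel)"
        by (rule mult_left_mono) simp
      then show ?thesis
        using nn_integral_f_gauss_rescale_le [OF that, of "a\<^sup>2"] A(2) by simp
    qed
    have "ennreal (1 / \<bar>u\<bar>) * I \<le> ennreal (c * (1 / (1 + u\<^sup>2)))"
    proof (cases "\<bar>u\<bar> \<le> 1")
      case True
      have "u\<^sup>2 \<le> 1"
        using True by (simp add: abs_square_le_1)
      have "ennreal (1 / \<bar>u\<bar>) * I \<le> ennreal (1 / \<bar>u\<bar>) * ennreal (R * \<bar>u\<bar> * V)"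
        using I1 by (rule mult_left_mono) simp
      also have "\<dots> = ennreal (R * V)"
        using u R V by (simp add: ennreal_mult [symmetric])
      also have "\<dots> \<le> ennreal (c * (1 / (1 + u\<^sup>2)))"
      proof (rule ennreal_leI)
        have "R * V * (1 + u\<^sup>2) \<le> R * V * 2"
          using \<open>u\<^sup>2 \<le> 1\<close> R V by (intro mult_left_mono) auto
        also have "\<dots> \<le> c"
          using A by (simp add: c_def)
        finally show "R * V \<le> c * (1 / (1 + u\<^sup>2))"
          by (simp add: pos_le_divide_eq add_pos_nonneg)
      qed
      finally show ?thesis .
    next
      case False
      then have u2: "1 \<le> u\<^sup>2"
        using one_le_power [of "\<bar>u\<bar>" 2] by simp
      have "ennreal (1 / \<bar>u\<bar>) * I = ennreal (1 / u\<^sup>2) * (ennreal \<bar>u\<bar> * I)"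
      proof -
        have "1 / u\<^sup>2 * \<bar>u\<bar> = 1 / \<bar>u\<bar>"
          using u by (simp add: power2_eq_square abs_if)
        then show ?thesis
          by (simp add: mult.assoc [symmetric] ennreal_mult [symmetric] del: times_divide_eq_left)
      qed
      also have "\<dots> \<le> ennreal (1 / u\<^sup>2) * ennreal A"
        using I2 False by (intro mult_left_mono) auto
      also have "\<dots> = ennreal (A / u\<^sup>2)"
        using A by (simp add: ennreal_mult [symmetric])
      also have "\<dots> \<le> ennreal (c * (1 / (1 + u\<^sup>2)))"
      proof (rule ennreal_leI)
        have "A * (1 + u\<^sup>2) \<le> A * (2 * u\<^sup>2)"
          using u2 A by (intro mult_left_mono) auto
        also have "\<dots> \<le> c * u\<^sup>2"
          using R V by (simp add: c_def algebra_simps)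
        finally show "A / u\<^sup>2 \<le> c * (1 / (1 + u\<^sup>2))"
          using u by (simp add: divide_simps add_pos_nonneg)
      qed
      finally show ?thesis .
    qed
    then have "ennreal (1 / \<bar>u\<bar>) * I * ennreal (gauss 1 w)
        \<le> ennreal (c * (1 / (1 + u\<^sup>2))) * ennreal (gauss 1 w)"
      by (rule mult_right_mono) simp
    moreover have "gaussian_average K \<sigma> (diff_kernel a u) u w = ennreal (1 / \<bar>u\<bar>) * I * ennreal (gauss 1 w)"
    proof -
      have "ennreal (gauss 1 w / \<bar>u\<bar>) = ennreal (1 / \<bar>u\<bar>) * ennreal (gauss 1 w)"
        by (simp add: ennreal_mult [symmetric])
      then show ?thesis
        by (simp add: gaussian_average_def I_def mult_ac)
    qed
    ultimately show ?thesis
      by simp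
  qed (simp add: gaussian_average_def)
  ultimately show ?thesis
    by (rule that)
qed

lemma smoothed_integral_tendsto:
  assumes K: "compact K" and a: "0 < a" "a < 1"
  shows "(\<lambda>k. smoothed_integral a K (1 / real (Suc k)))
    \<longlonglongrightarrow> ennreal (sqrt (2 * pi) ^ DIM('a)) * frullani a * (\<integral>\<^sup>+z. ennreal (f z) * indicator K z \<partial>lborel)"
proof -
  have [measurable]: "K \<in> sets borel"
    using K by (simp add: borel_compact)
  obtain c where c: "0 \<le> c" "\<And>\<sigma> u w. gaussian_average K \<sigma> (diff_kernel a u) u w
      \<le> ennreal (c * (1 / (1 + u\<^sup>2))) * ennreal (gauss 1 w)"
    using gaussian_average_le [OF K a] by blast
  define G where "G = (\<lambda>u (w :: 'a). ennreal (gauss 1 w / \<bar>u\<bar>) * (\<integral>\<^sup>+z. ennreal (diff_kernel a u z)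
      * indicator K z \<partial>lborel))"
  have [measurable]: "(\<lambda>(u, w :: 'a). G u w) \<in> borel_measurable (borel \<Otimes>\<^sub>M borel)"
    unfolding G_def by measurable
  have lim: "(\<lambda>k. gaussian_average K (1 / real (Suc k)) (diff_kernel a u) u w) \<longlonglongrightarrow> G u w" for u w
    unfolding gaussian_average_def G_def
  proof (intro ennreal_tendsto_cmult nn_integral_translate_compact_tendsto [OF K _ _ diff_kernel_le])
    have "(\<lambda>k. (1 / real (Suc k) * (1 / \<bar>u\<bar>)) *\<^sub>R w) \<longlonglongrightarrow> (0 * (1 / \<bar>u\<bar>)) *\<^sub>R w"
      by (intro tendsto_scaleR tendsto_mult tendsto_const lim_1_over_n [THEN LIMSEQ_Suc])
    then show "(\<lambda>k. (1 / real (Suc k) / \<bar>u\<bar>) *\<^sub>R w) \<longlonglongrightarrow> 0"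
      by simp
  qed (use a diff_kernel_nonneg in auto)
  have "(\<lambda>k. \<integral>\<^sup>+z. (\<lambda>(u, w). gaussian_average K (1 / real (Suc k)) (diff_kernel a u) u w)
      z \<partial>(lborel \<Otimes>\<^sub>M lborel))
    \<longlonglongrightarrow> (\<integral>\<^sup>+z. (\<lambda>(u, w). G u w) z \<partial>(lborel \<Otimes>\<^sub>M lborel))"
  proof (rule nn_integral_dominated_convergence)
    have "(\<integral>\<^sup>+z. (\<lambda>(u, w :: 'a). ennreal (c * (1 / (1 + u\<^sup>2))) * ennreal (gauss 1 w)) z \<partial>(lborel \<Otimes>\<^sub>M lborel))
      = (\<integral>\<^sup>+u. ennreal c * ennreal (1 / (1 + u\<^sup>2)) * (\<integral>\<^sup>+w. ennreal (gauss 1 (w :: 'a)) \<partial>lborel) \<partial>lborel)"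
    proof -
      have "ennreal (c * (1 / (1 + u\<^sup>2))) = ennreal c * ennreal (1 / (1 + u\<^sup>2))" for u :: real
        using c(1) by (intro ennreal_mult) simp_all
      then show ?thesis
        by (subst lborel.nn_integral_fst [symmetric]) (simp_all add: nn_integral_cmult del:
            times_divide_eq_right)
    qed
    also have "\<dots> = ennreal c * (\<integral>\<^sup>+u. ennreal (1 / (1 + u\<^sup>2)) \<partial>lborel)
        * (\<integral>\<^sup>+w. ennreal (gauss 1 (w :: 'a)) \<partial>lborel)"
      by (subst nn_integral_multc, simp, subst nn_integral_cmult) simp_all
    also have "\<dots> < \<infinity>"
      using nn_integral_inverse_one_plus_square by (simp add: nn_integral_gauss ennreal_mult_less_top)
    finally show "(\<integral>\<^sup>+z. (\<lambda>(u, w :: 'a). ennreal (c * (1 / (1 + u\<^sup>2)))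
        * ennreal (gauss 1 w)) z \<partial>(lborel \<Otimes>\<^sub>M lborel)) < \<infinity>" .
    show "AE z in lborel \<Otimes>\<^sub>M lborel. (\<lambda>(u, w). gaussian_average K (1 / real (Suc k)) (diff_kernel a u) u w) z
        \<le> (\<lambda>(u, w). ennreal (c * (1 / (1 + u\<^sup>2))) * ennreal (gauss 1 w)) z" for k
      using c(2) by (intro AE_I2) (auto split: prod.split)
    show "AE z in lborel \<Otimes>\<^sub>M lborel. (\<lambda>k. (\<lambda>(u, w). gaussian_average K (1 / real (Suc k))
        (diff_kernel a u) u w) z)
        \<longlonglongrightarrow> (\<lambda>(u, w). G u w) z"
      using lim by (intro AE_I2) (auto split: prod.split)
  qed measurable
  moreover have "(\<integral>\<^sup>+z. (\<lambda>(u, w). gaussian_average K (1 / real (Suc k)) (diff_kernel a u) u w)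
      z \<partial>(lborel \<Otimes>\<^sub>M lborel))
    = smoothed_integral a K (1 / real (Suc k))" for k
    unfolding smoothed_integral_def by (subst lborel.nn_integral_fst [symmetric]) simp_all
  moreover have "(\<integral>\<^sup>+z. (\<lambda>(u, w). G u w) z \<partial>(lborel \<Otimes>\<^sub>M lborel))
    = ennreal (sqrt (2 * pi) ^ DIM('a)) * frullani a * (\<integral>\<^sup>+z. ennreal (f z) * indicator K z \<partial>lborel)"
  proof -
    have "(\<integral>\<^sup>+z. (\<lambda>(u, w). G u w) z \<partial>(lborel \<Otimes>\<^sub>M lborel)) = (\<integral>\<^sup>+u. \<integral>\<^sup>+w. G u w \<partial>lborel \<partial>lborel)"
      by (subst lborel.nn_integral_fst [symmetric]) simp_all
    also have "\<dots> = (\<integral>\<^sup>+u. ennreal (sqrt (2 * pi) ^ DIM('a)) * (\<integral>\<^sup>+z. ennreal (diff_kernel a u z / \<bar>u\<bar>)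
        * indicator K z \<partial>lborel) \<partial>lborel)"
    proof (rule nn_integral_cong)
      fix u :: real
      have "ennreal (gauss 1 w / \<bar>u\<bar>) = ennreal (1 / \<bar>u\<bar>) * ennreal (gauss 1 w)" for w :: 'a
        by (simp add: ennreal_mult [symmetric])
      then have "(\<integral>\<^sup>+w. ennreal (gauss 1 (w :: 'a) / \<bar>u\<bar>) \<partial>lborel)
          = ennreal (1 / \<bar>u\<bar>) * ennreal (sqrt (2 * pi) ^ DIM('a))"
        by (simp add: nn_integral_cmult nn_integral_gauss)
      then have "(\<integral>\<^sup>+w. G u w \<partial>lborel) = ennreal (sqrt (2 * pi) ^ DIM('a)) *
          (ennreal (1 / \<bar>u\<bar>) * (\<integral>\<^sup>+z. ennreal (diff_kernel a u z) * indicator K z \<partial>lborel))"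
        unfolding G_def by (subst nn_integral_multc) (simp_all add: mult_ac)
      also have "ennreal (1 / \<bar>u\<bar>) * (\<integral>\<^sup>+z. ennreal (diff_kernel a u z) * indicator K z \<partial>lborel)
        = (\<integral>\<^sup>+z. ennreal (diff_kernel a u z / \<bar>u\<bar>) * indicator K z \<partial>lborel)"
        using a diff_kernel_nonneg
        by (subst nn_integral_cmult [symmetric]) (simp_all add: mult.assoc [symmetric] ennreal_mult
            [symmetric])
      finally show "(\<integral>\<^sup>+w. G u w \<partial>lborel)
          = ennreal (sqrt (2 * pi) ^ DIM('a)) * (\<integral>\<^sup>+z. ennreal (diff_kernel a u z / \<bar>u\<bar>)
          * indicator K z \<partial>lborel)" .
    qed
    also have "\<dots> = ennreal (sqrt (2 * pi) ^ DIM('a)) * (\<integral>\<^sup>+u. \<integral>\<^sup>+z. ennreal (diff_kernel a u z / \<bar>u\<bar>)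
        * indicator K z \<partial>lborel \<partial>lborel)"
      by (rule nn_integral_cmult) measurable
    also have "(\<integral>\<^sup>+u. \<integral>\<^sup>+z. ennreal (diff_kernel a u z / \<bar>u\<bar>) * indicator K z \<partial>lborel \<partial>lborel)
      = (\<integral>\<^sup>+z. \<integral>\<^sup>+u. ennreal (diff_kernel a u z / \<bar>u\<bar>) * indicator K z \<partial>lborel \<partial>lborel)"
      by (rule lborel_pair.Fubini') measurable
    also have "\<dots> = (\<integral>\<^sup>+z. frullani a * (ennreal (f z) * indicator K z) \<partial>lborel)"
    proof (rule nn_integral_cong_AE, rule eventually_mono [OF AE_lborel_singleton [of 0]])
      fix z :: 'a
      assume z: "z \<noteq> 0"
      have "ennreal (diff_kernel a u z / \<bar>u\<bar>)
          = ennreal (f z) * ennreal ((gauss (a\<^sup>2 * u\<^sup>2) z - gauss (u\<^sup>2) z) / \<bar>u\<bar>)" for u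
        unfolding diff_kernel_def by (subst ennreal_mult' [symmetric]) simp_all
      then have "(\<integral>\<^sup>+u. ennreal (diff_kernel a u z / \<bar>u\<bar>) \<partial>lborel) = ennreal (f z) * frullani a"
        by (simp only: frullani_scale [OF z, symmetric]) (rule nn_integral_cmult, simp add: gauss_def)
      then show "(\<integral>\<^sup>+u. ennreal (diff_kernel a u z / \<bar>u\<bar>) * indicator K z \<partial>lborel)
          = frullani a * (ennreal (f z) * indicator K z)"
        by (subst nn_integral_multc) (simp_all add: mult_ac diff_kernel_def gauss_def)
    qed
    also have "\<dots> = frullani a * (\<integral>\<^sup>+z. ennreal (f z) * indicator K z \<partial>lborel)"
      by (rule nn_integral_cmult) measurable
    finally show ?thesis
      by (simp add: mult.assoc)
  qed
  ultimately show ?thesis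
    by simp
qed

lemma nn_integral_le_of_section_transform_le:
  assumes "compact K" "compact L"
    and "\<And>\<eta>. section_transform (indicator K) \<eta> \<le> section_transform (indicator L) \<eta>"
  shows "(\<integral>\<^sup>+z. ennreal (f z) * indicator K z \<partial>lborel) \<le> (\<integral>\<^sup>+z. ennreal (f z) * indicator L z \<partial>lborel)"
proof -
  have half: "0 < (1 / 2 :: real)" "(1 / 2 :: real) < 1"
    by simp_all
  define c where "c = ennreal (sqrt (2 * pi) ^ DIM('a)) * frullani (1 / 2)"
  have c: "c \<noteq> 0" "c \<noteq> \<top>"
    using frullani_pos [OF half] frullani_finite [OF half] by (auto simp: c_def ennreal_mult_eq_top_iff)
  have "c * (\<integral>\<^sup>+z. ennreal (f z) * indicator K z \<partial>lborel) \<le> c * (\<integral>\<^sup>+z. ennreal (f z) * indicator L z \<partial>lborel)"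
    unfolding c_def
    by (rule LIMSEQ_le [OF smoothed_integral_tendsto [OF assms(1) half] smoothed_integral_tendsto
        [OF assms(2) half]])
       (use smoothed_integral_mono [OF assms(1,2) half _ assms(3)] in auto)
  then show ?thesis
    using c by (simp add: ennreal_mult_le_mult_iff)
qed

end

section \<open>The Minkowski functional\<close>

lemma minkowski_functional_le:
  assumes "0 < a" "y \<in> M"
  shows "minkowski_functional M (a *\<^sub>R y) \<le> ennreal a"
  unfolding minkowski_functional_def using assms by (intro INF_lower) auto

lemma minkowski_functional_geI:
  assumes "\<And>a y. 0 < a \<Longrightarrow> y \<in> M \<Longrightarrow> x = a *\<^sub>R y \<Longrightarrow> c \<le> ennreal a"
  shows "c \<le> minkowski_functional M x"
  unfolding minkowski_functional_def using assms by (intro INF_greatest) auto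

lemma minkowski_functional_scaleR_pos:
  assumes t: "0 < t"
  shows "minkowski_functional M (t *\<^sub>R x) = ennreal t * minkowski_functional M x"
proof -
  have *: "minkowski_functional M (t *\<^sub>R x) * ennreal (1 / t)
      \<le> minkowski_functional M x" if t: "0 < t" for t x
  proof (rule minkowski_functional_geI)
    fix a y
    assume a: "0 < a" "y \<in> M" "x = a *\<^sub>R y"
    then have "minkowski_functional M (t *\<^sub>R x) \<le> ennreal (t * a)"
      using minkowski_functional_le [of "t * a" y M] t by simp
    then have "minkowski_functional M (t *\<^sub>R x) * ennreal (1 / t) \<le> ennreal (t * a) * ennreal (1 / t)"
      by (rule mult_right_mono) simp
    also have "\<dots> = ennreal a"
      using t a by (simp add: ennreal_mult [symmetric])
    finally show "minkowski_functional M (t *\<^sub>R x) * ennreal (1 / t) \<le> ennreal a" .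
  qed
  have inv: "ennreal t * ennreal (1 / t) = 1"
    using t by (simp add: ennreal_mult [symmetric])
  show ?thesis
  proof (rule antisym)
    have "ennreal t * (minkowski_functional M (t *\<^sub>R x) * ennreal (1 / t))
        \<le> ennreal t * minkowski_functional M x"
      using * [OF t] by (rule mult_left_mono) simp
    then show "minkowski_functional M (t *\<^sub>R x) \<le> ennreal t * minkowski_functional M x"
      unfolding mult.left_commute [of "ennreal t"] inv by simp
    show "ennreal t * minkowski_functional M x \<le> minkowski_functional M (t *\<^sub>R x)"
      using * [of "1 / t" "t *\<^sub>R x"] t by (simp add: mult.commute)
  qed
qed

lemma minkowski_functional_uminus:
  assumes "origin_symmetric M"
  shows "minkowski_functional M (- x) = minkowski_functional M x"
proof -
  have "minkowski_functional M (- x) \<le> minkowski_functional M x" for x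
  proof (rule minkowski_functional_geI)
    fix a y
    assume "0 < a" "y \<in> M" "x = a *\<^sub>R y"
    then show "minkowski_functional M (- x) \<le> ennreal a"
      using minkowski_functional_le [of a "- y" M] assms by (simp add: origin_symmetric_def)
  qed
  from this [of x] this [of "- x"] show ?thesis
    by simp
qed

lemma minkowski_functional_scaleR:
  assumes "origin_symmetric M" "t \<noteq> 0"
  shows "minkowski_functional M (t *\<^sub>R x) = ennreal \<bar>t\<bar> * minkowski_functional M x"
proof (cases "0 < t")
  case False
  then show ?thesis
    using minkowski_functional_scaleR_pos [of "- t" M x] minkowski_functional_uminus
        [OF assms(1), of "t *\<^sub>R x"] assms(2)
    by simp
qed (simp add: minkowski_functional_scaleR_pos)

lemma minkowski_functional_zero:
  assumes "0 \<in> M"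
  shows "minkowski_functional M 0 = 0"
proof -
  have "minkowski_functional M 0 \<le> 0"
  proof (rule ennreal_le_epsilon)
    fix e :: real
    assume "0 < e"
    then show "minkowski_functional M 0 \<le> 0 + ennreal e"
      using minkowski_functional_le [OF _ assms, of e] by simp
  qed
  then show ?thesis
    by simp
qed

lemma minkowski_functional_ge_norm:
  assumes "\<And>y. y \<in> M \<Longrightarrow> norm y \<le> R" "0 < R"
  shows "ennreal (norm x / R) \<le> minkowski_functional M x"
proof (rule minkowski_functional_geI)
  fix a y
  assume a: "0 < a" "y \<in> M" "x = a *\<^sub>R y"
  then have "norm x \<le> a * R"
    using assms(1) [of y] by simp
  then show "ennreal (norm x / R) \<le> ennreal a"
    using assms(2) by (intro ennreal_leI) (simp add: pos_divide_le_eq)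
qed

lemma star_body_scaleR:
  assumes "star_body M" "x \<in> M" "0 \<le> t" "t \<le> 1"
  shows "t *\<^sub>R x \<in> M"
proof -
  have "t *\<^sub>R x \<in> closed_segment 0 x"
    using assms(3,4) by (auto simp: in_segment)
  then show ?thesis
    using assms(1,2) by (auto simp: star_body_def)
qed

lemma borel_measurable_minkowski_functional:
  fixes M :: "'a::euclidean_space set"
  assumes M: "star_body M"
  shows "minkowski_functional M \<in> borel_measurable borel"
proof (rule borel_measurableI_less)
  fix c :: ennreal
  define Q where "Q = {b \<in> \<rat>. 0 < b \<and> ennreal b < c}"
  have "{x. minkowski_functional M x < c} = (\<Union>b\<in>Q. (\<lambda>y. b *\<^sub>R y) ` M)"
  proof (intro set_eqI iffI)
    fix x
    assume "x \<in> {x. minkowski_functional M x < c}"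
    then obtain a y where a: "0 < a" "y \<in> M" "x = a *\<^sub>R y" "ennreal a < c"
      by (auto simp: minkowski_functional_def INF_less_iff)
    have "\<exists>d>a. ennreal d \<le> c"
    proof (cases c)
      case (real r)
      then show ?thesis
        using a by (intro exI [of _ r]) (auto simp: ennreal_less_iff)
    next
      case top
      then show ?thesis
        by (intro exI [of _ "a + 1"]) simp
    qed
    then obtain d where d: "a < d" "ennreal d \<le> c"
      by blast
    obtain b where b: "b \<in> \<rat>" "a < b" "b < d"
      using Rats_dense_in_real [OF d(1)] by blast
    have "b \<in> Q"
    proof -
      have "ennreal b < ennreal d"
        using a(1) b by (intro ennreal_lessI) auto
      then show ?thesis
        using a(1) b d(2) by (auto simp: Q_def)
    qed
    moreover have "(a / b) *\<^sub>R y \<in> M"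
      using M a b by (intro star_body_scaleR) auto
    then have "x \<in> (\<lambda>y. b *\<^sub>R y) ` M"
      using a b by (intro image_eqI [of _ _ "(a / b) *\<^sub>R y"]) auto
    ultimately show "x \<in> (\<Union>b\<in>Q. (\<lambda>y. b *\<^sub>R y) ` M)"
      by blast
  next
    fix x
    assume "x \<in> (\<Union>b\<in>Q. (\<lambda>y. b *\<^sub>R y) ` M)"
    then show "x \<in> {x. minkowski_functional M x < c}"
      using minkowski_functional_le by (fastforce simp: Q_def intro: le_less_trans)
  qed
  moreover have "(\<Union>b\<in>Q. (\<lambda>y. b *\<^sub>R y) ` M) \<in> sets borel"
  proof (rule sets.countable_UN'')
    show "countable Q"
      by (rule countable_subset [OF _ countable_rat]) (auto simp: Q_def)
    show "(\<lambda>y. b *\<^sub>R y) ` M \<in> sets borel" for b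
      using M by (intro borel_compact compact_scaling) (simp add: star_body_def)
  qed
  ultimately show "{x \<in> space borel. minkowski_functional M x < c} \<in> sets borel"
    by simp
qed

lemma positive_definite_kernel_minkowski:
  fixes M :: "'a::euclidean_space set"
  assumes dim: "2 \<le> DIM('a)" and M: "star_body M" "origin_symmetric M"
    and pd: "positive_definite_distribution (distribution_of (\<lambda>x. inverse (minkowski_functional M x)))"
    and R: "\<And>y. y \<in> M \<Longrightarrow> norm y \<le> R" "0 < R"
  shows "positive_definite_kernel (\<lambda>x. enn2real (inverse (minkowski_functional M x))) R"
    (is "positive_definite_kernel ?f R")
proof
  note [measurable] = borel_measurable_minkowski_functional [OF M(1)]
  show meas: "?f \<in> borel_measurable borel"
    by measurable
  show "?f y \<le> R / norm y" for y
  proof (cases "y = 0")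
    case True
    have "M \<noteq> {}"
      using M(1) by (auto simp: star_body_def)
    then have "0 \<in> M"
      using star_body_scaleR [OF M(1), of _ 0] by auto
    then show ?thesis
      using True by (simp add: minkowski_functional_zero)
  next
    case False
    have ge: "ennreal (norm y / R) \<le> minkowski_functional M y"
      by (rule minkowski_functional_ge_norm [OF R])
    show ?thesis
    proof (cases "minkowski_functional M y")
      case (real r)
      then have "norm y / R \<le> r"
        using ge R by (simp add: ennreal_le_iff)
      moreover have "0 < norm y / R"
        using False R by simp
      ultimately show ?thesis
      proof -
        assume "norm y / R \<le> r" "0 < norm y / R"
        then have "0 < r" "inverse r \<le> inverse (norm y / R)"
          using le_imp_inverse_le [of "norm y / R" r] by linarith+
        then show ?thesis
          using real by (simp add: inverse_ennreal)
      qed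
    qed (use R in simp)
  qed
  show "?f (t *\<^sub>R y) = ?f y / \<bar>t\<bar>" if t: "t \<noteq> 0" for t y
  proof (cases "minkowski_functional M y")
    case (real r)
    show ?thesis
    proof (cases "r = 0")
      case False
      then have "ennreal \<bar>t\<bar> * ennreal r = ennreal (\<bar>t\<bar> * r)"
        using real by (simp add: ennreal_mult)
      then show ?thesis
        using real t False by (simp add: minkowski_functional_scaleR [OF M(2) t] inverse_ennreal
            divide_inverse)
    qed (use real in \<open>simp add: minkowski_functional_scaleR [OF M(2) t]\<close>)
  qed (use t in \<open>simp add: minkowski_functional_scaleR [OF M(2) t] ennreal_mult_top\<close>)
  show "fourier (\<lambda>y. complex_of_real (?f y * gauss 1 y)) \<eta> \<in> \<real>\<^sub>\<ge>\<^sub>0" for \<eta>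
  proof -
    define c where "c = sqrt (2 * pi) ^ DIM('a)"
    have c: "0 < c"
      by (simp add: c_def)
    have "fourier (\<lambda>x. complex_of_real (gauss 1 (x - \<eta>))) y
      = complex_of_real c * (complex_of_real (gauss 1 y) * exp (- \<i> * complex_of_real (y \<bullet> \<eta>)))" for y
      by (subst fourier_shift) (simp_all add: integrable_gauss(2) c_def inner_commute)
    then have "distribution_of (\<lambda>x. inverse (minkowski_functional M x))
        (fourier (\<lambda>x. complex_of_real (gauss 1 (x - \<eta>))))
      = (LINT y|lborel. complex_of_real c * (complex_of_real (?f y * gauss 1 y)
          * exp (- \<i> * complex_of_real (y \<bullet> \<eta>))))"
      unfolding distribution_of_def by (intro Bochner_Integration.integral_cong) (simp_all add: mult_ac)
    also have "\<dots> = complex_of_real c * fourier (\<lambda>y. complex_of_real (?f y * gauss 1 y)) \<eta>"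
      unfolding fourier_def by (rule integral_mult_right_zero)
    finally have "complex_of_real c * fourier (\<lambda>y. complex_of_real (?f y * gauss 1 y)) \<eta>
      = fourier_distribution (distribution_of (\<lambda>x. inverse (minkowski_functional M x)))
          (\<lambda>x. complex_of_real (gauss 1 (x - \<eta>)))"
      by (simp add: fourier_distribution_def)
    also have "\<dots> \<in> \<real>\<^sub>\<ge>\<^sub>0"
      using pd schwartz_gauss [of 1 \<eta>] unfolding positive_definite_distribution_def
      by (auto simp: less_imp_le)
    finally have "complex_of_real c * fourier (\<lambda>y. complex_of_real (?f y * gauss 1 y)) \<eta> \<in> \<real>\<^sub>\<ge>\<^sub>0" .
    moreover have "complex_of_real (1 / c) \<in> \<real>\<^sub>\<ge>\<^sub>0"
      using c by simp
    ultimately have "complex_of_real (1 / c)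
        * (complex_of_real c * fourier (\<lambda>y. complex_of_real (?f y * gauss 1 y)) \<eta>) \<in> \<real>\<^sub>\<ge>\<^sub>0"
      by (rule nonneg_Reals_mult_I [rotated])
    moreover have "complex_of_real (1 / c) * (complex_of_real c * z) = z" for z
      using c by simp
    ultimately show ?thesis
      by (simp only:)
  qed
qed (use dim R in auto)

lemma (in positive_definite_kernel) section_transform_eq_section_volume:
  fixes K :: "'a set"
  assumes "compact K"
  shows "section_transform (indicator K) \<eta> = ennreal (2 * pi / norm \<eta>) * section_volume K (\<eta> /\<^sub>R norm \<eta>)"
proof (cases "\<eta> = 0")
  case False
  have [measurable]: "K \<in> sets borel"
    using assms by (simp add: borel_compact)
  have "perp (\<eta> /\<^sub>R norm \<eta>) = perp \<eta>"
    using False by (simp add: perp_scaleR)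
  moreover have "emeasure (lborel_subspace (perp \<eta>)) K = emeasure (lborel_subspace (perp \<eta>)) (K \<inter> perp \<eta>)"
    using AE_lborel_subspace_perp' [OF False] by (intro emeasure_eq_AE) auto
  ultimately show ?thesis
    by (simp add: section_transform_def section_volume_def)
qed (simp add: section_transform_def)

theorem lemma3:
  fixes M K L :: "(real ^ 'n) set"
  assumes "CARD('n) \<ge> 2"
    and "star_body M" and "origin_symmetric M"
    and "positive_definite_distribution
           (distribution_of (\<lambda>x. inverse (minkowski_functional M x)))"
    and "star_body K" and "origin_symmetric K"
    and "star_body L" and "origin_symmetric L"
    and "\<And>\<xi>. \<xi> \<in> sphere 0 1 \<Longrightarrow> section_volume K \<xi> \<le> section_volume L \<xi>"
  shows "(\<integral>\<^sup>+x\<in>K. inverse (minkowski_functional M x) \<partial>lborel)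
           \<le> (\<integral>\<^sup>+x\<in>L. inverse (minkowski_functional M x) \<partial>lborel)"
proof -
  define f where "f x = enn2real (inverse (minkowski_functional M x))" for x
  have "bounded M"
    using assms(2) by (auto simp: star_body_def compact_imp_bounded)
  then obtain R where MR: "0 < R" "\<And>y. y \<in> M \<Longrightarrow> norm y \<le> R"
    by (auto simp: bounded_pos)
  interpret positive_definite_kernel f R
    unfolding f_def [abs_def] using assms(1-4) MR by (intro positive_definite_kernel_minkowski) auto
  have comp: "compact K" "compact L"
    using assms(5,7) by (auto simp: star_body_def)
  have le: "section_transform (indicator K) \<eta> \<le> section_transform (indicator L) \<eta>" for \<eta>
  proof (cases "\<eta> = 0")
    case False
    then show ?thesis
      using assms(9) [of "\<eta> /\<^sub>R norm \<eta>"] comp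
      by (simp add: section_transform_eq_section_volume mult_left_mono)
  qed (simp add: section_transform_def)
  have "inverse (minkowski_functional M x) = ennreal (f x)" if "x \<noteq> 0" for x
  proof -
    have "0 < ennreal (norm x / R)"
      using that MR by simp
    also have "\<dots> \<le> minkowski_functional M x"
      by (rule minkowski_functional_ge_norm [OF MR(2,1)])
    finally show ?thesis
      by (simp add: f_def ennreal_enn2real_if)
  qed
  then have "(\<integral>\<^sup>+x\<in>A. inverse (minkowski_functional M x) \<partial>lborel)
      = (\<integral>\<^sup>+x. ennreal (f x) * indicator A x \<partial>lborel)" for A
    by (intro nn_integral_cong_AE eventually_mono [OF AE_lborel_singleton [of 0]]) simp
  then show ?thesis
    using nn_integral_le_of_section_transform_le [OF comp le] by simp
qed

end
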